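(* Let $(M,m)$ be a real, finite-dimensional, connected Riemannian manifold without boundary, $n=\dim M\ge2$, complete with respect to its intrinsic distance, and let $(Q,\mu,L)$ be as in Case 1 (Langevin, $Q=TM$) or Case 2 (fibre lay-down, $Q=SM$) described in the context, with all assumptions stated there. Let $(T_t)_{t\ge0}$ be the strongly continuous contraction semigroup on $L^2(Q;\mu)$ generated by the closure $(L,D(L))$ of $(L,C_c^\infty(Q))$, and let $\kappa_1,\kappa_2\in(0,\infty)$ be constants (which exist in both cases) such that $$\|T_tg-(g,1)_{L^2(\mu)}\|_{L^2(\mu)}\le\kappa_1e^{-\kappa_2t}\|g-(g,1)_{L^2(\mu)}\|_{L^2(\mu)}\qquad\text{for all }g\in L^2(Q;\mu),\ t\ge0.$$ Let $(\Omega,\mathfrak A,(\mathfrak F_t),(\eta_t)_{t\ge0},(\mathbb P_v)_{v\in Q})$ be the Hunt process with infinite life-time and continuous paths that is properly associated in the resolvent sense with $(L,D(L))$, and let $\mathbb P(A)=\int_Q\mathbb P_v(A)\,\mu(dv)$ for $A\in\mathfrak A$. Then for all $f\in L^2(Q;\mu)$ and all $t\in(0,\infty)$ $$\Big\|\frac1t\int_{[0,t)}f(\eta_s)\,ds-\mathbb E_\mu[f]\Big\|_{L^2(\mathbb P)}\le\frac{2}{\sqrt t}\,\sqrt{\frac{2\kappa_1}{\kappa_2}\big(1-e^{-t\kappa_2}\big)}\;\|f-\mathbb E_\mu[f]\|_{L^2(\mu)},$$ where $\mathbb E_\mu[f]=\int_Qf\,d\mu$.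
   Context: Geometry. $\lambda_m$: Riemannian volume measure; $\nabla_m$: gradient; $|\mathrm{Hess}_m\cdot|$: Frobenius norm of the Hessian; $\pi\colon TM\to M$: tangent bundle; $SM=\{v\in TM:m(v,v)=1\}$, $S_xM=SM\cap T_xM$. For $v\in TM$, $w\in T_{\pi(v)}M$: $\mathrm{vl}_v(w)=\frac{d}{dt}(v+tw)|_{t=0}$; $d\kappa\colon T_vTM\to T_{\pi(v)}M$ is the Levi-Civita connector map ($d\kappa(s'(0))$ is the covariant derivative at $0$ of $s$ along $\pi\circ s$); $\mathrm{hl}_v(w)$ is the unique vector in $\ker d_v\kappa$ with $d\pi(\mathrm{hl}_v(w))=w$. $\mathcal H_m(v)=\mathrm{hl}_v(v)$ (geodesic spray, tangent to $SM$), $\mathcal V(v)=\mathrm{vl}_v(v)$. Vector fields act as first-order differential operators. Potential conditions for $\Phi\colon M\to\mathbb R$, with $\lambda_\Phi=e^{-\Phi}\lambda_m$: (P1) $\Phi$ is locally Lipschitz, bounded below, and $\lambda_\Phi$ is a probability measure; (P2) for some $\Lambda\in(0,\infty)$, $\int_M|\nabla_mf_0|_m^2d\lambda_\Phi\ge\Lambda\int_M(f_0-\int f_0d\lambda_\Phi)^2d\lambda_\Phi$ for all $f_0\in C_c^\infty(M)$; (P3) $\Phi\in C^2(M)$ and $|\mathrm{Hess}_m\Phi|\le c(1+|\nabla_m\Phi|_m)$ on $M$ for some $c\in(0,\infty)$. Case 1: $Q=TM$; $\alpha,\beta\in(0,\infty)$; $\Psi\colon M\to\mathbb R$ with $\Phi=\beta\Psi$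 satisfying (P1)-(P3); $\int f\,d\mu=\int_M\int_{T_xM}f\,d\nu_x\,d\lambda_\Phi(x)$ with $\nu_x$ the centred Gaussian measure on $(T_xM,m_x)$ with covariance $\beta^{-1}\mathrm{Id}$; $L=\frac\alpha\beta\Delta_{\mathrm v}-\alpha\mathcal V+\mathcal H_m-\frac1\beta\mathrm{vl}(\nabla_m\Phi)$, where $\Delta_{\mathrm v}$ is the fibrewise Euclidean Laplacian on $(T_xM,m_x)$ and $\mathrm{vl}(\nabla_m\Phi)(v)=\mathrm{vl}_v(\nabla_m\Phi(\pi(v)))$. Case 2: $Q=SM$; $\sigma\in(0,\infty)$; $\Phi=\Psi$ satisfying (P1)-(P3) and $\mathcal H_m\Psi^{\mathrm v}=(n-1)\Psi^{\mathrm h}$ on $SM$ (up to an additive constant), where $\Psi^{\mathrm v}=\Psi\circ\pi|_{SM}$ and the horizontal lift $\Psi^{\mathrm h}$ is a function on $SM$ characterised up to constants by $d\Psi^{\mathrm h}(a)=d\Psi(d\kappa(a))$ for all $a\in T(SM)$; $\int f\,d\mu=\int_M\int_{S_xM}f\,d\nu_x\,d\lambda_\Psi(x)$ with $\nu_x$ the normalised surface measure on $S_xM$; $L=\frac{\sigma^2}2\Delta_{\mathbb S}+\mathcal H_m-\frac1{n-1}\nabla_{\mathbb S}(\mathcal H_m\Psi^{\mathrm v})$, where $\nabla_{\mathbb S},\Delta_{\mathbb S}$ are the gradient and Laplace-Beltrami operator taken fibrewise on the unit spheres $S_xM\subset(T_xM,m_x)$. Properly associated in the resolvent sense: for all $f\in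 L^2(Q;\mu)$ and $a>0$, the function $v\mapsto\int_{(0,\infty)}e^{-as}\mathbb E_v[f(\eta_s)]\,ds$ is a quasi-continuous (with respect to the generalised Dirichlet form induced by $(L,D(L))$) $\mu$-version of $G_af=\int_{(0,\infty)}e^{-as}T_sf\,ds$. Such a Hunt process exists in both cases. *)

theory Defs
  imports "HOL-Probability.Probability"
begin

section \<open>Smooth functions on open subsets of Euclidean spaces\<close>

primrec Ck_on ::
  "nat \<Rightarrow> 'a::euclidean_space set \<Rightarrow> ('a \<Rightarrow> 'b::real_normed_vector) \<Rightarrow> bool" where
  "Ck_on 0 S f = continuous_on S f"
| "Ck_on (Suc k) S f =
     (f differentiable_on S \<and> (\<forall>i\<in>Basis. Ck_on k S (\<lambda>x. frechet_derivative f (at x) i)))"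

definition smooth_on :: "'a::euclidean_space set \<Rightarrow> ('a \<Rightarrow> 'b::real_normed_vector) \<Rightarrow> bool" where
  "smooth_on S f \<longleftrightarrow> (\<forall>k. Ck_on k S f)"


section \<open>Charts and smooth manifolds\<close>

type_synonym ('m, 'e) chart = "'m set \<times> ('m \<Rightarrow> 'e)"

abbreviation cdom :: "('m, 'e) chart \<Rightarrow> 'm set" where "cdom c \<equiv> fst c"
abbreviation cmap :: "('m, 'e) chart \<Rightarrow> 'm \<Rightarrow> 'e" where "cmap c \<equiv> snd c"
abbreviation cimg :: "('m, 'e) chart \<Rightarrow> 'e set" where "cimg c \<equiv> cmap c ` cdom c"

definition cinv :: "('m, 'e) chart \<Rightarrow> 'e \<Rightarrow> 'm" where
  "cinv c = inv_into (cdom c) (cmap c)"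

text \<open>The manifold is the whole type \<open>'m\<close> with its type class topology
  (Hausdorff, second countable); \<open>A\<close> is a smooth atlas, not necessarily maximal.\<close>

definition smooth_atlas ::
  "('m::{t2_space, second_countable_topology}, 'e::euclidean_space) chart set \<Rightarrow> bool" where
  "smooth_atlas A \<longleftrightarrow>
     (\<forall>c\<in>A. open (cdom c) \<and> open (cimg c) \<and> homeomorphism (cdom c) (cimg c) (cmap c) (cinv c)) \<and>
     (\<Union>c\<in>A. cdom c) = UNIV \<and>
     (\<forall>c\<in>A. \<forall>d\<in>A. smooth_on (cmap c ` (cdom c \<inter> cdom d)) (cmap d \<circ> cinv c))"

definition Ck_fun :: "nat \<Rightarrow> ('q, 'e::euclidean_space) chart set \<Rightarrow> 'q set \<Rightarrow> ('q \<Rightarrow> real) \<Rightarrow> bool" where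
  "Ck_fun k A S f \<longleftrightarrow> (\<forall>c\<in>A. Ck_on k (cmap c ` (cdom c \<inter> S)) (f \<circ> cinv c))"

definition smooth_fun :: "('q, 'e::euclidean_space) chart set \<Rightarrow> 'q set \<Rightarrow> ('q \<Rightarrow> real) \<Rightarrow> bool" where
  "smooth_fun A S f \<longleftrightarrow> (\<forall>k. Ck_fun k A S f)"

definition test_functions ::
  "('m::topological_space, 'e::euclidean_space) chart set \<Rightarrow> ('m \<Rightarrow> real) set" where
  "test_functions A = {f. smooth_fun A UNIV f \<and> compact (closure {x. f x \<noteq> 0})}"


section \<open>Tangent bundle\<close>

text \<open>A chart around each point is selected once and for all. The pair \<open>(x, e)\<close> stands for the
  tangent vector at \<open>x\<close> whose coordinate vector in the selected chart \<open>chart_at A x\<close> is \<open>e\<close>; thus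
  \<open>'m \<times> 'e\<close> is the underlying set of \<open>TM\<close>, and \<open>'e\<close> with its vector space structure is \<open>T_x M\<close>.
  The product topology of the type \<open>'m \<times> 'e\<close> is in general not the topology of \<open>TM\<close>; the latter
  is \<open>TM_topology\<close> below.\<close>

definition chart_at :: "('m, 'e) chart set \<Rightarrow> 'm \<Rightarrow> ('m, 'e) chart" where
  "chart_at A x = (SOME c. c \<in> A \<and> x \<in> cdom c)"

abbreviation chart_pt :: "('m, 'e) chart set \<Rightarrow> 'm \<Rightarrow> 'e" where
  "chart_pt A x \<equiv> cmap (chart_at A x) x"

text \<open>Change of coordinates of tangent vectors at \<open>x\<close>, from the selected chart to \<open>c\<close> and back.\<close>

definition tcoord ::
  "('m, 'e::euclidean_space) chart set \<Rightarrow> ('m, 'e) chart \<Rightarrow> 'm \<Rightarrow> 'e \<Rightarrow> 'e" where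
  "tcoord A c x e = frechet_derivative (cmap c \<circ> cinv (chart_at A x)) (at (chart_pt A x)) e"

definition tvec ::
  "('m, 'e::euclidean_space) chart set \<Rightarrow> ('m, 'e) chart \<Rightarrow> 'm \<Rightarrow> 'e \<Rightarrow> 'e" where
  "tvec A c x \<xi> = frechet_derivative (cmap (chart_at A x) \<circ> cinv c) (at (cmap c x)) \<xi>"

definition TM_chart ::
  "('m, 'e::euclidean_space) chart set \<Rightarrow> ('m, 'e) chart \<Rightarrow> ('m \<times> 'e, 'e \<times> 'e) chart" where
  "TM_chart A c = (cdom c \<times> UNIV, \<lambda>(x, e). (cmap c x, tcoord A c x e))"

definition TM_atlas ::
  "('m, 'e::euclidean_space) chart set \<Rightarrow> ('m \<times> 'e, 'e \<times> 'e) chart set" where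
  "TM_atlas A = TM_chart A ` A"

definition TM_topology :: "('m, 'e::euclidean_space) chart set \<Rightarrow> ('m \<times> 'e) topology" where
  "TM_topology A = topology_generated_by
     {cdom C \<inter> cmap C -` W | C W. C \<in> TM_atlas A \<and> open W}"

text \<open>A vector tangent to \<open>TM\<close> at \<open>v = (x, e)\<close> is given by its coordinates \<open>(\<xi>, \<zeta>)\<close> in the chart of
  \<open>TM\<close> induced by \<open>chart_at A x\<close>; \<open>dTM A F v a\<close> is the derivative of \<open>F\<close> at \<open>v\<close> along \<open>a\<close>.
  In these coordinates \<open>d\<pi> (\<xi>, \<zeta>) = \<xi>\<close>, and the velocity of \<open>t \<mapsto> v + t w\<close> is \<open>(0, w)\<close>.\<close>

definition dTM ::
  "('m, 'e::euclidean_space) chart set \<Rightarrow> ('m \<times> 'e \<Rightarrow> real) \<Rightarrow> 'm \<times> 'e \<Rightarrow> 'e \<times> 'e \<Rightarrow> real" where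
  "dTM A F v a = (let C = TM_chart A (chart_at A (fst v))
                  in frechet_derivative (F \<circ> cinv C) (at (cmap C v)) a)"

definition dM :: "('m, 'e::euclidean_space) chart set \<Rightarrow> ('m \<Rightarrow> real) \<Rightarrow> 'm \<Rightarrow> 'e \<Rightarrow> real" where
  "dM A f x w = frechet_derivative (f \<circ> cinv (chart_at A x)) (at (chart_pt A x)) w"


section \<open>Riemannian metrics\<close>

text \<open>\<open>g x u w\<close> is the inner product of the tangent vectors \<open>(x, u)\<close> and \<open>(x, w)\<close>;
  \<open>metric_in A g c y\<close> is its coordinate expression in the chart \<open>c\<close> at the coordinate point \<open>y\<close>.\<close>

type_synonym ('m, 'e) metric = "'m \<Rightarrow> 'e \<Rightarrow> 'e \<Rightarrow> real"

definition metric_in ::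
  "('m, 'e::euclidean_space) chart set \<Rightarrow> ('m, 'e) metric \<Rightarrow> ('m, 'e) chart \<Rightarrow> 'e \<Rightarrow> 'e \<Rightarrow> 'e \<Rightarrow> real" where
  "metric_in A g c y \<xi> \<zeta> = g (cinv c y) (tvec A c (cinv c y) \<xi>) (tvec A c (cinv c y) \<zeta>)"

definition riemannian_metric ::
  "('m, 'e::euclidean_space) chart set \<Rightarrow> ('m, 'e) metric \<Rightarrow> bool" where
  "riemannian_metric A g \<longleftrightarrow>
     (\<forall>x. bilinear (g x) \<and> (\<forall>u w. g x u w = g x w u) \<and> (\<forall>u. u \<noteq> 0 \<longrightarrow> 0 < g x u u)) \<and>
     (\<forall>c\<in>A. \<forall>i\<in>Basis. \<forall>j\<in>Basis. smooth_on (cimg c) (\<lambda>y. metric_in A g c y i j))"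

definition gnorm :: "('m, 'e) metric \<Rightarrow> 'm \<Rightarrow> 'e \<Rightarrow> real" where
  "gnorm g x u = sqrt (g x u u)"

definition piecewise_C1_curve ::
  "('m::topological_space, 'e::euclidean_space) chart set \<Rightarrow> (real \<Rightarrow> 'm) \<Rightarrow> bool" where
  "piecewise_C1_curve A \<gamma> \<longleftrightarrow> continuous_on {0..1} \<gamma> \<and>
     (\<forall>c\<in>A. \<forall>a b. 0 \<le> a \<and> a \<le> b \<and> b \<le> 1 \<and> \<gamma> ` {a..b} \<subseteq> cdom c \<longrightarrow>
        (cmap c \<circ> \<gamma>) piecewise_C1_differentiable_on {a..b})"

definition velocity ::
  "('m, 'e::euclidean_space) chart set \<Rightarrow> (real \<Rightarrow> 'm) \<Rightarrow> real \<Rightarrow> 'e" where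
  "velocity A \<gamma> t = vector_derivative (cmap (chart_at A (\<gamma> t)) \<circ> \<gamma>) (at t)"

definition curve_length ::
  "('m, 'e::euclidean_space) chart set \<Rightarrow> ('m, 'e) metric \<Rightarrow> (real \<Rightarrow> 'm) \<Rightarrow> ennreal" where
  "curve_length A g \<gamma> = (\<integral>\<^sup>+t\<in>{0..1}. ennreal (gnorm g (\<gamma> t) (velocity A \<gamma> t)) \<partial>lborel)"

definition intrinsic_dist ::
  "('m::topological_space, 'e::euclidean_space) chart set \<Rightarrow> ('m, 'e) metric \<Rightarrow> 'm \<Rightarrow> 'm \<Rightarrow> ennreal" where
  "intrinsic_dist A g x y =
     (INF \<gamma> \<in> {\<gamma>. piecewise_C1_curve A \<gamma> \<and> \<gamma> 0 = x \<and> \<gamma> 1 = y}. curve_length A g \<gamma>)"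

definition intrinsically_complete ::
  "('m::topological_space, 'e::euclidean_space) chart set \<Rightarrow> ('m, 'e) metric \<Rightarrow> bool" where
  "intrinsically_complete A g \<longleftrightarrow>
     (\<forall>X :: nat \<Rightarrow> 'm.
        (\<forall>\<epsilon>>0. \<exists>N. \<forall>i\<ge>N. \<forall>j\<ge>N. intrinsic_dist A g (X i) (X j) < \<epsilon>) \<longrightarrow>
        (\<exists>x. (\<lambda>i. intrinsic_dist A g (X i) x) \<longlonglongrightarrow> 0))"

definition complete_connected_riemannian_manifold ::
  "('m::{t2_space, second_countable_topology}, 'e::euclidean_space) chart set \<Rightarrow>
   ('m, 'e) metric \<Rightarrow> bool" where
  "complete_connected_riemannian_manifold A g \<longleftrightarrow>
     smooth_atlas A \<and> riemannian_metric A g \<and> connected (UNIV :: 'm set) \<and>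
     intrinsically_complete A g"

definition riemannian_volume ::
  "('m::topological_space, real ^ 'n) chart set \<Rightarrow> ('m, real ^ 'n) metric \<Rightarrow> 'm measure \<Rightarrow> bool" where
  "riemannian_volume A g lam \<longleftrightarrow> sets lam = sets borel \<and>
     (\<forall>c\<in>A. \<forall>B\<in>sets borel. B \<subseteq> cdom c \<longrightarrow>
        emeasure lam B = (\<integral>\<^sup>+y\<in>cmap c ` B.
          ennreal (sqrt (det (\<chi> i j. metric_in A g c y (axis i 1) (axis j 1)))) \<partial>lborel))"

definition grad ::
  "('m, 'e::euclidean_space) chart set \<Rightarrow> ('m, 'e) metric \<Rightarrow> ('m \<Rightarrow> real) \<Rightarrow> 'm \<Rightarrow> 'e" where
  "grad A g f x = (THE w. \<forall>u. g x w u = dM A f x u)"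

text \<open>\<open>christoffel A g c y \<xi> \<zeta>\<close> is the vector with components \<open>\<Gamma>\<^sup>k\<^sub>i\<^sub>j \<xi>\<^sup>i \<zeta>\<^sup>j\<close> in the chart \<open>c\<close>, determined by the
  Koszul formula for the Levi-Civita connection.\<close>

definition christoffel ::
  "('m, 'e::euclidean_space) chart set \<Rightarrow> ('m, 'e) metric \<Rightarrow> ('m, 'e) chart \<Rightarrow> 'e \<Rightarrow> 'e \<Rightarrow> 'e \<Rightarrow> 'e" where
  "christoffel A g c y \<xi> \<zeta> = (THE w. \<forall>\<theta>.
     metric_in A g c y w \<theta> =
       (frechet_derivative (\<lambda>z. metric_in A g c z \<zeta> \<theta>) (at y) \<xi>
        + frechet_derivative (\<lambda>z. metric_in A g c z \<xi> \<theta>) (at y) \<zeta>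
        - frechet_derivative (\<lambda>z. metric_in A g c z \<xi> \<zeta>) (at y) \<theta>) / 2)"

text \<open>The symbols at \<open>x\<close> in the selected chart.\<close>

abbreviation chris_at ::
  "('m, 'e::euclidean_space) chart set \<Rightarrow> ('m, 'e) metric \<Rightarrow> 'm \<Rightarrow> 'e \<Rightarrow> 'e \<Rightarrow> 'e" where
  "chris_at A g x \<equiv> christoffel A g (chart_at A x) (chart_pt A x)"

text \<open>A linear isometry from the model Euclidean space onto \<open>(T_x M, m_x)\<close>, that is, an
  orthonormal basis of \<open>T_x M\<close>. No notion below depends on the selection.\<close>

definition frame :: "('m, 'e::euclidean_space) metric \<Rightarrow> 'm \<Rightarrow> 'e \<Rightarrow> 'e" where
  "frame g x = (SOME J. linear J \<and> (\<forall>u w. g x (J u) (J w) = u \<bullet> w))"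

definition hessian ::
  "('m, 'e::euclidean_space) chart set \<Rightarrow> ('m, 'e) metric \<Rightarrow> ('m \<Rightarrow> real) \<Rightarrow> 'm \<Rightarrow> 'e \<Rightarrow> 'e \<Rightarrow> real" where
  "hessian A g f x u w =
     (let F = f \<circ> cinv (chart_at A x) in
      frechet_derivative (\<lambda>y. frechet_derivative F (at y) w) (at (chart_pt A x)) u
      - dM A f x (chris_at A g x u w))"

definition hessian_norm ::
  "('m, 'e::euclidean_space) chart set \<Rightarrow> ('m, 'e) metric \<Rightarrow> ('m \<Rightarrow> real) \<Rightarrow> 'm \<Rightarrow> real" where
  "hessian_norm A g f x =
     sqrt (\<Sum>i\<in>Basis. \<Sum>j\<in>Basis. (hessian A g f x (frame g x i) (frame g x j))\<^sup>2)"


section \<open>Lifts and the unit tangent bundle\<close>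

definition connector ::
  "('m, 'e::euclidean_space) chart set \<Rightarrow> ('m, 'e) metric \<Rightarrow> 'm \<times> 'e \<Rightarrow> 'e \<times> 'e \<Rightarrow> 'e" where
  "connector A g v a = snd a + chris_at A g (fst v) (fst a) (snd v)"

definition vlift :: "'e::euclidean_space \<Rightarrow> 'e \<times> 'e" where
  "vlift w = (0, w)"

definition hlift ::
  "('m, 'e::euclidean_space) chart set \<Rightarrow> ('m, 'e) metric \<Rightarrow> 'm \<times> 'e \<Rightarrow> 'e \<Rightarrow> 'e \<times> 'e" where
  "hlift A g v w = (THE a. connector A g v a = 0 \<and> fst a = w)"

definition SM :: "('m, 'e) metric \<Rightarrow> ('m \<times> 'e) set" where
  "SM g = {v. g (fst v) (snd v) (snd v) = 1}"

text \<open>Functions on \<open>SM\<close> are represented by functions on \<open>'m \<times> 'e\<close> of which only the values on \<open>SM\<close>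
  matter. Since \<open>v \<mapsto> v / |v|\<close> is a smooth retraction of \<open>TM\<close> minus the zero section onto the embedded
  submanifold \<open>SM\<close>, such an \<open>f\<close> is smooth (differentiable) iff \<open>f \<circ> SM_retract g\<close> is, and the two have
  the same derivative along vectors tangent to \<open>SM\<close>.\<close>

definition SM_retract :: "('m, 'e::real_vector) metric \<Rightarrow> 'm \<times> 'e \<Rightarrow> 'm \<times> 'e" where
  "SM_retract g v = (fst v, snd v /\<^sub>R gnorm g (fst v) (snd v))"

definition SM_tangent ::
  "('m, 'e::euclidean_space) chart set \<Rightarrow> ('m, 'e) metric \<Rightarrow> 'm \<times> 'e \<Rightarrow> ('e \<times> 'e) set" where
  "SM_tangent A g v = {a. dTM A (\<lambda>u. g (fst u) (snd u) (snd u)) v a = 0}"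

definition dSM ::
  "('m, 'e::euclidean_space) chart set \<Rightarrow> ('m, 'e) metric \<Rightarrow> ('m \<times> 'e \<Rightarrow> real) \<Rightarrow>
   'm \<times> 'e \<Rightarrow> 'e \<times> 'e \<Rightarrow> real" where
  "dSM A g f v a = dTM A (f \<circ> SM_retract g) v a"

definition SM_differentiable ::
  "('m, 'e::euclidean_space) chart set \<Rightarrow> ('m, 'e) metric \<Rightarrow> ('m \<times> 'e \<Rightarrow> real) \<Rightarrow> bool" where
  "SM_differentiable A g f \<longleftrightarrow>
     (\<forall>C\<in>TM_atlas A. (f \<circ> SM_retract g \<circ> cinv C) differentiable_on
                        cmap C ` (cdom C \<inter> {v. snd v \<noteq> 0}))"

definition TM_test_functions ::
  "('m, 'e::euclidean_space) chart set \<Rightarrow> ('m \<times> 'e \<Rightarrow> real) set" where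
  "TM_test_functions A = {f. smooth_fun (TM_atlas A) UNIV f \<and>
     compactin (TM_topology A) (TM_topology A closure_of {v. f v \<noteq> 0})}"

definition SM_topology ::
  "('m, 'e::euclidean_space) chart set \<Rightarrow> ('m, 'e) metric \<Rightarrow> ('m \<times> 'e) topology" where
  "SM_topology A g = subtopology (TM_topology A) (SM g)"

definition SM_test_functions ::
  "('m, 'e::euclidean_space) chart set \<Rightarrow> ('m, 'e) metric \<Rightarrow> ('m \<times> 'e \<Rightarrow> real) set" where
  "SM_test_functions A g = {f. smooth_fun (TM_atlas A) {v. snd v \<noteq> 0} (f \<circ> SM_retract g) \<and>
     compactin (SM_topology A g) (SM_topology A g closure_of {v \<in> SM g. f v \<noteq> 0})}"


section \<open>Fibrewise operators\<close>

definition fibre_laplacian ::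
  "('m, 'e::euclidean_space) metric \<Rightarrow> ('m \<times> 'e \<Rightarrow> real) \<Rightarrow> 'm \<times> 'e \<Rightarrow> real" where
  "fibre_laplacian g f v =
     (\<Sum>i\<in>Basis. (deriv ^^ 2) (\<lambda>t. f (fst v, snd v + t *\<^sub>R frame g (fst v) i)) 0)"

text \<open>The unit speed great circle of \<open>S_x M\<close> through \<open>v\<close> with initial velocity the unit vector \<open>u\<close>.\<close>

definition great_circle :: "'m \<times> 'e::real_vector \<Rightarrow> 'e \<Rightarrow> real \<Rightarrow> 'm \<times> 'e" where
  "great_circle v u t = (fst v, cos t *\<^sub>R snd v + sin t *\<^sub>R u)"

definition sphere_frame ::
  "('m, 'e::euclidean_space) metric \<Rightarrow> 'm \<times> 'e \<Rightarrow> 'e set" where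
  "sphere_frame g v = (SOME B. finite B \<and> card B = DIM('e) - 1 \<and>
     (\<forall>u\<in>B. g (fst v) u (snd v) = 0) \<and>
     (\<forall>u\<in>B. \<forall>w\<in>B. g (fst v) u w = (if u = w then 1 else 0)))"

definition sphere_grad ::
  "('m, 'e::euclidean_space) metric \<Rightarrow> ('m \<times> 'e \<Rightarrow> real) \<Rightarrow> 'm \<times> 'e \<Rightarrow> 'e" where
  "sphere_grad g f v = (THE w. g (fst v) w (snd v) = 0 \<and>
     (\<forall>u. g (fst v) u (snd v) = 0 \<and> g (fst v) u u = 1 \<longrightarrow>
        g (fst v) w u = deriv (\<lambda>t. f (great_circle v u t)) 0))"

text \<open>The Laplace-Beltrami operator of \<open>S_x M\<close> as divergence of the gradient. The covariant derivative
  of the round sphere is the tangential part of the derivative in \<open>T_x M\<close>, so that the divergence is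
  the trace of the latter over the tangent space of the sphere.\<close>

definition sphere_laplacian ::
  "('m, 'e::euclidean_space) metric \<Rightarrow> ('m \<times> 'e \<Rightarrow> real) \<Rightarrow> 'm \<times> 'e \<Rightarrow> real" where
  "sphere_laplacian g f v = (\<Sum>u\<in>sphere_frame g v.
     g (fst v) (vector_derivative (\<lambda>t. sphere_grad g f (great_circle v u t)) (at 0)) u)"


section \<open>The Langevin and the fibre lay-down setting\<close>

definition weighted_volume :: "'m measure \<Rightarrow> ('m \<Rightarrow> real) \<Rightarrow> 'm measure" where
  "weighted_volume lam \<Phi> = density lam (\<lambda>x. ennreal (exp (- \<Phi> x)))"

definition locally_lipschitz ::
  "('m::topological_space, 'e::euclidean_space) chart set \<Rightarrow> ('m, 'e) metric \<Rightarrow> ('m \<Rightarrow> real) \<Rightarrow> bool" where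
  "locally_lipschitz A g \<Phi> \<longleftrightarrow> (\<forall>x. \<exists>U K. open U \<and> x \<in> U \<and>
     (\<forall>y\<in>U. \<forall>z\<in>U. ennreal \<bar>\<Phi> y - \<Phi> z\<bar> \<le> ennreal K * intrinsic_dist A g y z))"

definition P1 ::
  "('m::topological_space, 'e::euclidean_space) chart set \<Rightarrow> ('m, 'e) metric \<Rightarrow> 'm measure \<Rightarrow>
   ('m \<Rightarrow> real) \<Rightarrow> bool" where
  "P1 A g lam \<Phi> \<longleftrightarrow> locally_lipschitz A g \<Phi> \<and> (\<exists>b. \<forall>x. b \<le> \<Phi> x) \<and>
     prob_space (weighted_volume lam \<Phi>)"

definition P2 ::
  "('m::topological_space, 'e::euclidean_space) chart set \<Rightarrow> ('m, 'e) metric \<Rightarrow> 'm measure \<Rightarrow>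
   ('m \<Rightarrow> real) \<Rightarrow> bool" where
  "P2 A g lam \<Phi> \<longleftrightarrow> (\<exists>\<Lambda>>0. \<forall>f\<in>test_functions A.
     (\<integral>x. (gnorm g x (grad A g f x))\<^sup>2 \<partial>weighted_volume lam \<Phi>)
       \<ge> \<Lambda> * (\<integral>x. (f x - (\<integral>y. f y \<partial>weighted_volume lam \<Phi>))\<^sup>2 \<partial>weighted_volume lam \<Phi>))"

definition P3 ::
  "('m, 'e::euclidean_space) chart set \<Rightarrow> ('m, 'e) metric \<Rightarrow> ('m \<Rightarrow> real) \<Rightarrow> bool" where
  "P3 A g \<Phi> \<longleftrightarrow> Ck_fun 2 A UNIV \<Phi> \<and>
     (\<exists>c>0. \<forall>x. hessian_norm A g \<Phi> x \<le> c * (1 + gnorm g x (grad A g \<Phi> x)))"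

definition potential_conditions ::
  "('m::topological_space, 'e::euclidean_space) chart set \<Rightarrow> ('m, 'e) metric \<Rightarrow> 'm measure \<Rightarrow>
   ('m \<Rightarrow> real) \<Rightarrow> bool" where
  "potential_conditions A g lam \<Phi> \<longleftrightarrow> P1 A g lam \<Phi> \<and> P2 A g lam \<Phi> \<and> P3 A g \<Phi>"

text \<open>Lebesgue measure of the Euclidean space \<open>(T_x M, m_x)\<close>, the centred Gaussian measure on it with
  covariance \<open>\<beta>\<^sup>-\<^sup>1 Id\<close>, and the normalised surface measure of its unit sphere. The latter is the image
  of the uniform distribution on the unit ball under radial projection.\<close>

definition fibre_lebesgue :: "('m, 'e::euclidean_space) metric \<Rightarrow> 'm \<Rightarrow> 'e measure" where
  "fibre_lebesgue g x = distr lborel borel (frame g x)"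

definition fibre_gaussian :: "('m, 'e::euclidean_space) metric \<Rightarrow> real \<Rightarrow> 'm \<Rightarrow> 'e measure" where
  "fibre_gaussian g \<beta> x = density (fibre_lebesgue g x)
     (\<lambda>e. ennreal ((\<beta> / (2 * pi)) powr (real DIM('e) / 2) * exp (- \<beta> * g x e e / 2)))"

definition fibre_sphere_measure :: "('m, 'e::euclidean_space) metric \<Rightarrow> 'm \<Rightarrow> 'e measure" where
  "fibre_sphere_measure g x =
     distr (uniform_measure (fibre_lebesgue g x) {e. g x e e \<le> 1}) borel (\<lambda>e. e /\<^sub>R gnorm g x e)"

definition borel_sets_of :: "'q topology \<Rightarrow> 'q measure" where
  "borel_sets_of X = sigma (topspace X) {U. openin X U}"

definition disintegrates ::
  "('m \<times> 'e) topology \<Rightarrow> 'm measure \<Rightarrow> ('m \<Rightarrow> 'e measure) \<Rightarrow> ('m \<times> 'e) measure \<Rightarrow> bool" where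
  "disintegrates X base \<nu> \<mu> \<longleftrightarrow> sets \<mu> = sets (borel_sets_of X) \<and>
     (\<forall>f :: 'm \<times> 'e \<Rightarrow> ennreal. f \<in> borel_measurable (borel_sets_of X) \<longrightarrow>
        (\<integral>\<^sup>+v. f v \<partial>\<mu>) = (\<integral>\<^sup>+x. (\<integral>\<^sup>+e\<in>{e. (x, e) \<in> topspace X}. f (x, e) \<partial>\<nu> x) \<partial>base))"

definition langevin_operator ::
  "('m, 'e::euclidean_space) chart set \<Rightarrow> ('m, 'e) metric \<Rightarrow> real \<Rightarrow> real \<Rightarrow> ('m \<Rightarrow> real) \<Rightarrow>
   ('m \<times> 'e \<Rightarrow> real) \<Rightarrow> 'm \<times> 'e \<Rightarrow> real" where
  "langevin_operator A g \<alpha> \<beta> \<Phi> f v =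
     \<alpha> / \<beta> * fibre_laplacian g f v
     - \<alpha> * dTM A f v (vlift (snd v))
     + dTM A f v (hlift A g v (snd v))
     - 1 / \<beta> * dTM A f v (vlift (grad A g \<Phi> (fst v)))"

definition langevin_setting ::
  "('m::topological_space, 'e::euclidean_space) chart set \<Rightarrow> ('m, 'e) metric \<Rightarrow> 'm measure \<Rightarrow>
   real \<Rightarrow> real \<Rightarrow> ('m \<Rightarrow> real) \<Rightarrow>
   ('m \<times> 'e) topology \<Rightarrow> ('m \<times> 'e) measure \<Rightarrow> ('m \<times> 'e \<Rightarrow> real) set \<Rightarrow>
   (('m \<times> 'e \<Rightarrow> real) \<Rightarrow> 'm \<times> 'e \<Rightarrow> real) \<Rightarrow> bool" where
  "langevin_setting A g lam \<alpha> \<beta> \<Psi> Q \<mu> D L \<longleftrightarrow> 0 < \<alpha> \<and> 0 < \<beta> \<and>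
     (let \<Phi> = (\<lambda>x. \<beta> * \<Psi> x) in
      potential_conditions A g lam \<Phi> \<and>
      Q = TM_topology A \<and>
      disintegrates Q (weighted_volume lam \<Phi>) (fibre_gaussian g \<beta>) \<mu> \<and>
      D = TM_test_functions A \<and>
      L = langevin_operator A g \<alpha> \<beta> \<Phi>)"

text \<open>The function \<open>\<H>\<^sub>m \<Psi>\<^sup>v\<close> on \<open>SM\<close>.\<close>

definition spray_potential ::
  "('m, 'e::euclidean_space) chart set \<Rightarrow> ('m, 'e) metric \<Rightarrow> ('m \<Rightarrow> real) \<Rightarrow> 'm \<times> 'e \<Rightarrow> real" where
  "spray_potential A g \<Psi> v = dSM A g (\<Psi> \<circ> fst) v (hlift A g v (snd v))"

definition horizontal_lift_on_SM ::
  "('m, 'e::euclidean_space) chart set \<Rightarrow> ('m, 'e) metric \<Rightarrow> ('m \<Rightarrow> real) \<Rightarrow> ('m \<times> 'e \<Rightarrow> real) \<Rightarrow> bool" where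
  "horizontal_lift_on_SM A g \<Psi> \<psi> \<longleftrightarrow> SM_differentiable A g \<psi> \<and>
     (\<forall>v\<in>SM g. \<forall>a\<in>SM_tangent A g v. dSM A g \<psi> v a = dM A \<Psi> (fst v) (connector A g v a))"

definition fibre_lay_down_operator ::
  "('m, 'e::euclidean_space) chart set \<Rightarrow> ('m, 'e) metric \<Rightarrow> real \<Rightarrow> ('m \<Rightarrow> real) \<Rightarrow>
   ('m \<times> 'e \<Rightarrow> real) \<Rightarrow> 'm \<times> 'e \<Rightarrow> real" where
  "fibre_lay_down_operator A g \<sigma> \<Psi> f v =
     \<sigma>\<^sup>2 / 2 * sphere_laplacian g f v
     + dSM A g f v (hlift A g v (snd v))
     - 1 / (real DIM('e) - 1) * dSM A g f v (vlift (sphere_grad g (spray_potential A g \<Psi>) v))"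

definition fibre_lay_down_setting ::
  "('m::topological_space, 'e::euclidean_space) chart set \<Rightarrow> ('m, 'e) metric \<Rightarrow> 'm measure \<Rightarrow>
   real \<Rightarrow> ('m \<Rightarrow> real) \<Rightarrow>
   ('m \<times> 'e) topology \<Rightarrow> ('m \<times> 'e) measure \<Rightarrow> ('m \<times> 'e \<Rightarrow> real) set \<Rightarrow>
   (('m \<times> 'e \<Rightarrow> real) \<Rightarrow> 'm \<times> 'e \<Rightarrow> real) \<Rightarrow> bool" where
  "fibre_lay_down_setting A g lam \<sigma> \<Psi> Q \<mu> D L \<longleftrightarrow> 0 < \<sigma> \<and>
     potential_conditions A g lam \<Psi> \<and>
     (\<exists>\<psi> c. horizontal_lift_on_SM A g \<Psi> \<psi> \<and>
        (\<forall>v\<in>SM g. spray_potential A g \<Psi> v = (real DIM('e) - 1) * \<psi> v + c)) \<and>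
     Q = SM_topology A g \<and>
     disintegrates Q (weighted_volume lam \<Psi>) (fibre_sphere_measure g) \<mu> \<and>
     D = SM_test_functions A g \<and>
     L = fibre_lay_down_operator A g \<sigma> \<Psi>"


section \<open>Semigroups on \<open>L\<^sup>2\<close>\<close>

text \<open>Elements of \<open>L\<^sup>2(\<mu>)\<close> are represented by square integrable functions; identities between them
  are identities almost everywhere.\<close>

definition L2 :: "'q measure \<Rightarrow> ('q \<Rightarrow> real) set" where
  "L2 \<mu> = {f \<in> borel_measurable \<mu>. integrable \<mu> (\<lambda>x. (f x)\<^sup>2)}"

definition L2_inner :: "'q measure \<Rightarrow> ('q \<Rightarrow> real) \<Rightarrow> ('q \<Rightarrow> real) \<Rightarrow> real" where
  "L2_inner \<mu> f h = (\<integral>x. f x * h x \<partial>\<mu>)"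

definition L2norm :: "'q measure \<Rightarrow> ('q \<Rightarrow> real) \<Rightarrow> real" where
  "L2norm \<mu> f = sqrt (\<integral>x. (f x)\<^sup>2 \<partial>\<mu>)"

definition contraction_semigroup ::
  "'q measure \<Rightarrow> (real \<Rightarrow> ('q \<Rightarrow> real) \<Rightarrow> 'q \<Rightarrow> real) \<Rightarrow> bool" where
  "contraction_semigroup \<mu> T \<longleftrightarrow>
     (\<forall>t\<ge>0. \<forall>f\<in>L2 \<mu>. T t f \<in> L2 \<mu> \<and> L2norm \<mu> (T t f) \<le> L2norm \<mu> f) \<and>
     (\<forall>t\<ge>0. \<forall>f\<in>L2 \<mu>. \<forall>h\<in>L2 \<mu>. (AE x in \<mu>. f x = h x) \<longrightarrow> (AE x in \<mu>. T t f x = T t h x)) \<and>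
     (\<forall>t\<ge>0. \<forall>f\<in>L2 \<mu>. \<forall>h\<in>L2 \<mu>. \<forall>a b.
        AE x in \<mu>. T t (\<lambda>y. a * f y + b * h y) x = a * T t f x + b * T t h x) \<and>
     (\<forall>f\<in>L2 \<mu>. AE x in \<mu>. T 0 f x = f x) \<and>
     (\<forall>s\<ge>0. \<forall>t\<ge>0. \<forall>f\<in>L2 \<mu>. AE x in \<mu>. T (s + t) f x = T s (T t f) x) \<and>
     (\<forall>f\<in>L2 \<mu>. ((\<lambda>t. L2norm \<mu> (\<lambda>x. T t f x - f x)) \<longlongrightarrow> 0) (at_right 0))"

text \<open>Operators are given by their graphs.\<close>

definition generator ::
  "'q measure \<Rightarrow> (real \<Rightarrow> ('q \<Rightarrow> real) \<Rightarrow> 'q \<Rightarrow> real) \<Rightarrow> (('q \<Rightarrow> real) \<times> ('q \<Rightarrow> real)) set" where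
  "generator \<mu> T = {(f, h). f \<in> L2 \<mu> \<and> h \<in> L2 \<mu> \<and>
     ((\<lambda>t. L2norm \<mu> (\<lambda>x. (T t f x - f x) / t - h x)) \<longlongrightarrow> 0) (at_right 0)}"

definition L2_closure ::
  "'q measure \<Rightarrow> (('q \<Rightarrow> real) \<times> ('q \<Rightarrow> real)) set \<Rightarrow> (('q \<Rightarrow> real) \<times> ('q \<Rightarrow> real)) set" where
  "L2_closure \<mu> G = {(f, h). f \<in> L2 \<mu> \<and> h \<in> L2 \<mu> \<and>
     (\<exists>u w. (\<forall>k::nat. (u k, w k) \<in> G) \<and>
        (\<lambda>k. L2norm \<mu> (\<lambda>x. u k x - f x)) \<longlonglongrightarrow> 0 \<and>
        (\<lambda>k. L2norm \<mu> (\<lambda>x. w k x - h x)) \<longlonglongrightarrow> 0)}"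

definition generated_by_closure ::
  "'q measure \<Rightarrow> (real \<Rightarrow> ('q \<Rightarrow> real) \<Rightarrow> 'q \<Rightarrow> real) \<Rightarrow>
   ('q \<Rightarrow> real) set \<Rightarrow> (('q \<Rightarrow> real) \<Rightarrow> 'q \<Rightarrow> real) \<Rightarrow> bool" where
  "generated_by_closure \<mu> T D L \<longleftrightarrow> generator \<mu> T = L2_closure \<mu> {(f, L f) | f. f \<in> D}"

text \<open>\<open>h\<close> represents the \<open>L\<^sup>2\<close>-valued integral \<open>\<integral> exp (- a s) T\<^sub>s f ds\<close> over \<open>(0,\<infinity>)\<close>, which is
  characterised by its inner products with elements of \<open>L\<^sup>2\<close>.\<close>

definition is_resolvent ::
  "'q measure \<Rightarrow> (real \<Rightarrow> ('q \<Rightarrow> real) \<Rightarrow> 'q \<Rightarrow> real) \<Rightarrow> real \<Rightarrow> ('q \<Rightarrow> real) \<Rightarrow> ('q \<Rightarrow> real) \<Rightarrow> bool" where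
  "is_resolvent \<mu> T a f h \<longleftrightarrow> h \<in> L2 \<mu> \<and>
     (\<forall>w\<in>L2 \<mu>. L2_inner \<mu> h w = (LINT s:{0<..}|lborel. exp (- a * s) * L2_inner \<mu> (T s f) w))"


section \<open>Nests and quasi-continuity\<close>

text \<open>Potential theory of the generalised Dirichlet form \<open>\<E>(u, w) = - (L u, w)\<close>, \<open>u \<in> D(L)\<close>,
  \<open>w \<in> L\<^sup>2(\<mu>)\<close>, whose coercive part vanishes, in the sense of Stannat: 1-excessive functions,
  1-reduced functions and \<open>\<E>\<close>-nests.\<close>

definition excessive ::
  "'q measure \<Rightarrow> (real \<Rightarrow> ('q \<Rightarrow> real) \<Rightarrow> 'q \<Rightarrow> real) \<Rightarrow> ('q \<Rightarrow> real) \<Rightarrow> bool" where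
  "excessive \<mu> T u \<longleftrightarrow> u \<in> L2 \<mu> \<and>
     (\<forall>b\<ge>0. \<forall>h. is_resolvent \<mu> T (b + 1) u h \<longrightarrow> (AE x in \<mu>. b * h x \<le> u x))"

definition reduced_function ::
  "'q measure \<Rightarrow> (real \<Rightarrow> ('q \<Rightarrow> real) \<Rightarrow> 'q \<Rightarrow> real) \<Rightarrow> ('q \<Rightarrow> real) \<Rightarrow> 'q set \<Rightarrow> ('q \<Rightarrow> real) \<Rightarrow> bool" where
  "reduced_function \<mu> T u U w \<longleftrightarrow>
     excessive \<mu> T w \<and> (AE x in \<mu>. x \<in> U \<longrightarrow> u x \<le> w x) \<and>
     (\<forall>w'. excessive \<mu> T w' \<and> (AE x in \<mu>. x \<in> U \<longrightarrow> u x \<le> w' x) \<longrightarrow> (AE x in \<mu>. w x \<le> w' x))"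

definition dirichlet_nest ::
  "'q topology \<Rightarrow> 'q measure \<Rightarrow> (real \<Rightarrow> ('q \<Rightarrow> real) \<Rightarrow> 'q \<Rightarrow> real) \<Rightarrow> (nat \<Rightarrow> 'q set) \<Rightarrow> bool" where
  "dirichlet_nest Q \<mu> T K \<longleftrightarrow> (\<forall>k. closedin Q (K k)) \<and> incseq K \<and>
     (\<forall>u. excessive \<mu> T u \<and> u \<in> Domain (generator \<mu> T) \<longrightarrow>
        (\<exists>w. (\<forall>k. reduced_function \<mu> T u (topspace Q - K k) (w k)) \<and>
             (\<lambda>k. L2norm \<mu> (w k)) \<longlonglongrightarrow> 0))"

text \<open>Quasi-continuity of a function \<open>r\<close> that is well defined at the points of \<open>V\<close>.\<close>

definition quasi_continuous ::
  "'q topology \<Rightarrow> 'q measure \<Rightarrow> (real \<Rightarrow> ('q \<Rightarrow> real) \<Rightarrow> 'q \<Rightarrow> real) \<Rightarrow> 'q set \<Rightarrow> ('q \<Rightarrow> real) \<Rightarrow> bool" where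
  "quasi_continuous Q \<mu> T V r \<longleftrightarrow> (\<exists>K. dirichlet_nest Q \<mu> T K \<and>
     (\<forall>k. K k \<subseteq> V \<and> continuous_map (subtopology Q (K k)) euclideanreal r))"


section \<open>Hunt processes with infinite life-time and continuous paths\<close>

text \<open>\<open>\<AA>\<close> carries the sample space and its sigma-algebra (its measure is irrelevant). The filtration is
  extended by \<open>\<AA>\<close> at time infinity, so that the library's stopping times and their
  sigma-algebras apply to \<open>[0,\<infinity>]\<close>-valued times.\<close>

definition extend_filtration ::
  "'w measure \<Rightarrow> (real \<Rightarrow> 'w measure) \<Rightarrow> ennreal \<Rightarrow> 'w measure" where
  "extend_filtration \<AA> F t = (if t = \<top> then \<AA> else F (enn2real t))"

definition process_events ::
  "'q topology \<Rightarrow> 'w measure \<Rightarrow> (real \<Rightarrow> 'w \<Rightarrow> 'q) \<Rightarrow> 'w set set" where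
  "process_events Q \<AA> \<eta> = sigma_sets (space \<AA>)
     {\<eta> s -` C \<inter> space \<AA> | s C. 0 \<le> s \<and> C \<in> sets (borel_sets_of Q)}"

text \<open>Since the life-time is infinite, no cemetery state is needed. Existence of left limits is implied
  by continuity of the paths.\<close>

definition hunt_process ::
  "'q topology \<Rightarrow> 'w measure \<Rightarrow> (real \<Rightarrow> 'w measure) \<Rightarrow> (real \<Rightarrow> 'w \<Rightarrow> 'q) \<Rightarrow> ('q \<Rightarrow> 'w measure) \<Rightarrow> bool" where
  "hunt_process Q \<AA> F \<eta> P \<longleftrightarrow>
     (let \<B> = borel_sets_of Q; F' = extend_filtration \<AA> F in
     \<comment> \<open>right-continuous filtration to which the process is adapted\<close>
     filtration (space \<AA>) F' \<and>
     (\<forall>t\<ge>0. sets (F t) = (\<Inter>s\<in>{t<..}. sets (F s))) \<and>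
     (\<forall>t\<ge>0. \<eta> t \<in> F t \<rightarrow>\<^sub>M \<B>) \<and>
     \<comment> \<open>continuous paths\<close>
     (\<forall>\<omega>\<in>space \<AA>. continuous_map (top_of_set {0..}) Q (\<lambda>t. \<eta> t \<omega>)) \<and>
     \<comment> \<open>normal family of laws, universally measurable in the starting point\<close>
     (\<forall>v\<in>topspace Q. prob_space (P v) \<and> sets (P v) = sets \<AA> \<and> (AE \<omega> in P v. \<eta> 0 \<omega> = v)) \<and>
     (\<forall>B\<in>process_events Q \<AA> \<eta>. (\<lambda>v. emeasure (P v) B) \<in> borel_measurable \<B>) \<and>
     (\<forall>B\<in>sets \<AA>. \<forall>\<rho>. prob_space \<rho> \<and> sets \<rho> = sets \<B> \<longrightarrow>
        (\<lambda>v. emeasure (P v) B) \<in> borel_measurable (completion \<rho>)) \<and>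
     \<comment> \<open>Markov property\<close>
     (\<forall>v\<in>topspace Q. \<forall>s\<ge>0. \<forall>t\<ge>0. \<forall>B\<in>sets (F s). \<forall>C\<in>sets \<B>.
        emeasure (P v) {\<omega> \<in> B. \<eta> (s + t) \<omega> \<in> C} =
        (\<integral>\<^sup>+\<omega>\<in>B. emeasure (P (\<eta> s \<omega>)) {\<omega>' \<in> space \<AA>. \<eta> t \<omega>' \<in> C} \<partial>P v)) \<and>
     \<comment> \<open>strong Markov property\<close>
     (\<forall>v\<in>topspace Q. \<forall>\<tau>. stopping_time F' \<tau> \<longrightarrow>
        (\<forall>t\<ge>0. \<forall>B\<in>sets (filtration.pre_sigma (space \<AA>) F' \<tau>). \<forall>C\<in>sets \<B>.
           emeasure (P v) {\<omega> \<in> B. \<tau> \<omega> < \<top> \<and> \<eta> (enn2real (\<tau> \<omega>) + t) \<omega> \<in> C} =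
           (\<integral>\<^sup>+\<omega>\<in>{\<omega> \<in> B. \<tau> \<omega> < \<top>}.
              emeasure (P (\<eta> (enn2real (\<tau> \<omega>)) \<omega>)) {\<omega>' \<in> space \<AA>. \<eta> t \<omega>' \<in> C} \<partial>P v))) \<and>
     \<comment> \<open>quasi-left-continuity\<close>
     (\<forall>v\<in>topspace Q. \<forall>\<tau>. (\<forall>k::nat. stopping_time F' (\<tau> k)) \<and>
        (\<forall>\<omega>\<in>space \<AA>. incseq (\<lambda>k. \<tau> k \<omega>)) \<longrightarrow>
        (AE \<omega> in P v. (SUP k. \<tau> k \<omega>) < \<top> \<longrightarrow>
           limitin Q (\<lambda>k. \<eta> (enn2real (\<tau> k \<omega>)) \<omega>) (\<eta> (enn2real (SUP k. \<tau> k \<omega>)) \<omega>) sequentially)))"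

definition process_resolvent ::
  "(real \<Rightarrow> 'w \<Rightarrow> 'q) \<Rightarrow> ('q \<Rightarrow> 'w measure) \<Rightarrow> real \<Rightarrow> ('q \<Rightarrow> real) \<Rightarrow> 'q \<Rightarrow> real" where
  "process_resolvent \<eta> P a f v =
     (LINT s:{0<..}|lborel. exp (- a * s) * (\<integral>\<omega>. f (\<eta> s \<omega>) \<partial>P v))"

text \<open>The points at which the double integral above converges absolutely.\<close>

definition process_resolvent_dom ::
  "'q topology \<Rightarrow> (real \<Rightarrow> 'w \<Rightarrow> 'q) \<Rightarrow> ('q \<Rightarrow> 'w measure) \<Rightarrow> real \<Rightarrow> ('q \<Rightarrow> real) \<Rightarrow> 'q set" where
  "process_resolvent_dom Q \<eta> P a f = {v \<in> topspace Q.
     (\<integral>\<^sup>+s\<in>{0<..}. ennreal (exp (- a * s)) * (\<integral>\<^sup>+\<omega>. ennreal \<bar>f (\<eta> s \<omega>)\<bar> \<partial>P v) \<partial>lborel) < \<top>}"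

definition properly_associated ::
  "'q topology \<Rightarrow> 'q measure \<Rightarrow> (real \<Rightarrow> ('q \<Rightarrow> real) \<Rightarrow> 'q \<Rightarrow> real) \<Rightarrow>
   (real \<Rightarrow> 'w \<Rightarrow> 'q) \<Rightarrow> ('q \<Rightarrow> 'w measure) \<Rightarrow> bool" where
  "properly_associated Q \<mu> T \<eta> P \<longleftrightarrow> (\<forall>f\<in>L2 \<mu>. \<forall>a>0.
     quasi_continuous Q \<mu> T (process_resolvent_dom Q \<eta> P a f) (process_resolvent \<eta> P a f) \<and>
     (\<exists>h. is_resolvent \<mu> T a f h \<and> (AE v in \<mu>. process_resolvent \<eta> P a f v = h v)))"

text \<open>The law with initial distribution \<open>\<mu>\<close>. The completion accounts for the merely universal
  measurability of \<open>v \<mapsto> P\<^sub>v(B)\<close>.\<close>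

definition initial_law :: "'w measure \<Rightarrow> 'q measure \<Rightarrow> ('q \<Rightarrow> 'w measure) \<Rightarrow> 'w measure" where
  "initial_law \<AA> \<mu> P =
     measure_of (space \<AA>) (sets \<AA>) (\<lambda>B. \<integral>\<^sup>+v. emeasure (P v) B \<partial>completion \<mu>)"

end

theory Submission
  imports Defs
begin

text \<open>Hypocoercivity forces \<open>T\<^sub>s\<close> to preserve the mean value. By association, \<open>(p\<^sub>r g, w) = (T\<^sub>r g, w)\<close> for
  almost every \<open>r\<close>, where \<open>p\<^sub>r\<close> denotes the transition operators of the process, because both sides
  have the same Laplace transform; taking \<open>w = 1\<close> shows that \<open>\<mu>\<close> is an invariant measure. For a
  bounded function \<open>g\<close> of mean zero the Markov property then gives
  \<open>\<bar>E (g(\<eta>\<^sub>s) g(\<eta>\<^sub>u))\<bar> \<le> \<kappa>1 exp (- \<kappa>2 \<bar>u - s\<bar>) \<parallel>g\<parallel>\<^sup>2\<close> for almost every \<open>u\<close>, and integrating over \<open>[0,t)\<^sup>2\<close>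
  bounds the second moment of the time integral. Truncation extends the estimate to \<open>L\<^sup>2\<close>. The
  geometry enters only through the total mass of \<open>\<mu>\<close> and through the topology of the state space,
  which has to be regular enough for continuous paths to be jointly measurable.\<close>

section \<open>The space \<open>L\<^sup>2\<close>\<close>

text \<open>Association in the resolvent sense sees the transition operators only through Laplace
  transforms, hence at almost every time and after pairing with test functions. The double time
  integral of correlations tolerates a null set of lags; stationarity is upgraded to every time,
  because it identifies the law of the process at the earlier of two given times. Bounded functions
  keep the transition integrals finite at every starting point and make Fubini applicable; the
  passage to \<open>L2\<close> rests on the crude bound \<open>t * L2norm \<mu> f\<close>, which
  uses stationarity but no decay. A further obstacle is measurability:
  \<open>emeasure (P v) B\<close> is Borel in \<open>v\<close> for events of the process and only
  universally measurable for general events. The argument therefore runs on the sigma-algebra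
  generated by the process and is pulled back at the end. Constant: the integral of
  \<open>exp (- \<kappa>2 * \<bar>u - s\<bar>)\<close> over \<open>u\<close> is at most
  \<open>2 / \<kappa>2 * (1 - exp (- t * \<kappa>2))\<close>; the factor \<open>\<kappa>1\<close>,
  the outer length \<open>t\<close> and division by the square of \<open>t\<close> give the estimate
  with \<open>1 / sqrt t\<close>, so the factor 2 in the claim is slack.\<close>

lemma L2_measurable: "f \<in> L2 M \<Longrightarrow> f \<in> borel_measurable M"
  by (simp add: L2_def)

lemma L2_integrable_power2: "f \<in> L2 M \<Longrightarrow> integrable M (\<lambda>x. (f x)\<^sup>2)"
  by (simp add: L2_def)

lemma L2_integrable_mult:
  assumes "f \<in> L2 M" "g \<in> L2 M"
  shows "integrable M (\<lambda>x. f x * g x)"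
proof (rule Bochner_Integration.integrable_bound[where f="\<lambda>x. (f x)\<^sup>2 + (g x)\<^sup>2"])
  show "AE x in M. norm (f x * g x) \<le> norm ((f x)\<^sup>2 + (g x)\<^sup>2)"
  proof (intro AE_I2)
    fix x
    have "0 \<le> (\<bar>f x\<bar> - \<bar>g x\<bar>)\<^sup>2" by simp
    then have "2 * \<bar>f x * g x\<bar> \<le> (f x)\<^sup>2 + (g x)\<^sup>2"
      by (simp add: power2_diff abs_mult)
    then show "norm (f x * g x) \<le> norm ((f x)\<^sup>2 + (g x)\<^sup>2)"
      by simp
  qed
qed (use assms in \<open>auto simp: L2_def\<close>)

lemma L2_lincomb:
  assumes "f \<in> L2 M" "g \<in> L2 M"
  shows "(\<lambda>x. a * f x + b * g x) \<in> L2 M"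
proof -
  have "(\<lambda>x. (a * f x + b * g x)\<^sup>2) = (\<lambda>x. a\<^sup>2 * (f x)\<^sup>2 + b\<^sup>2 * (g x)\<^sup>2 + 2 * a * b * (f x * g x))"
    by (auto simp: power2_eq_square algebra_simps)
  then show ?thesis
    using assms L2_integrable_mult[OF assms] by (auto simp: L2_def)
qed

lemma L2_diff: "f \<in> L2 M \<Longrightarrow> g \<in> L2 M \<Longrightarrow> (\<lambda>x. f x - g x) \<in> L2 M"
  using L2_lincomb[of f M g 1 "-1"] by simp

lemma L2_scale: "f \<in> L2 M \<Longrightarrow> (\<lambda>x. c * f x) \<in> L2 M"
  using L2_lincomb[of f M f c 0] by simp

lemma (in finite_measure) bounded_in_L2:
  assumes "f \<in> borel_measurable M" "\<And>x. x \<in> space M \<Longrightarrow> \<bar>f x\<bar> \<le> C"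
  shows "f \<in> L2 M"
proof -
  have "integrable M (\<lambda>x. (f x)\<^sup>2)"
  proof (rule integrable_const_bound[where B="C\<^sup>2"])
    show "AE x in M. norm ((f x)\<^sup>2) \<le> C\<^sup>2"
      using assms(2) by (intro AE_I2) (metis abs_ge_zero norm_power power_mono real_norm_def)
  qed (use assms(1) in auto)
  then show ?thesis using assms(1) by (simp add: L2_def)
qed

lemma (in finite_measure) L2_const: "(\<lambda>_. c) \<in> L2 M"
  by (rule bounded_in_L2[where C="\<bar>c\<bar>"]) auto

lemma (in finite_measure) L2_integrable: "f \<in> L2 M \<Longrightarrow> integrable M f"
  using L2_integrable_mult[OF _ L2_const[of 1], of f] by simp

lemma L2norm_nonneg [simp]: "0 \<le> L2norm M f"
  by (simp add: L2norm_def)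

lemma L2norm_power2: "(L2norm M f)\<^sup>2 = (\<integral>x. (f x)\<^sup>2 \<partial>M)"
  by (simp add: L2norm_def)

lemma L2norm_scale: "L2norm M (\<lambda>x. c * f x) = \<bar>c\<bar> * L2norm M f"
  by (simp add: L2norm_def power_mult_distrib real_sqrt_mult)

lemma L2norm_cong_AE:
  assumes "f \<in> borel_measurable M" "g \<in> borel_measurable M" "AE x in M. f x = g x"
  shows "L2norm M f = L2norm M g"
proof -
  have "(\<integral>x. (f x)\<^sup>2 \<partial>M) = (\<integral>x. (g x)\<^sup>2 \<partial>M)"
    by (rule integral_cong_AE) (use assms in auto)
  then show ?thesis by (simp add: L2norm_def)
qed

text \<open>Discriminant argument for the nonnegative quadratic form \<open>quad\<close>, the
  squared norm of \<open>a f + b g\<close>.\<close>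

lemma L2_Cauchy_Schwarz:
  assumes f: "f \<in> L2 M" and g: "g \<in> L2 M"
  shows "\<bar>\<integral>x. f x * g x \<partial>M\<bar> \<le> L2norm M f * L2norm M g"
proof -
  define A B D where "A = (\<integral>x. (f x)\<^sup>2 \<partial>M)" and "B = (\<integral>x. (g x)\<^sup>2 \<partial>M)"
    and "D = (\<integral>x. f x * g x \<partial>M)"
  have quad: "0 \<le> a\<^sup>2 * A + b\<^sup>2 * B + 2 * a * b * D" for a b
  proof -
    have "0 \<le> (\<integral>x. (a * f x + b * g x)\<^sup>2 \<partial>M)" by simp
    also have "(\<lambda>x. (a * f x + b * g x)\<^sup>2) = (\<lambda>x. a\<^sup>2 * (f x)\<^sup>2 + b\<^sup>2 * (g x)\<^sup>2 + 2 * a * b * (f x * g x))"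
      by (auto simp: power2_eq_square algebra_simps)
    also have "(\<integral>x. a\<^sup>2 * (f x)\<^sup>2 + b\<^sup>2 * (g x)\<^sup>2 + 2 * a * b * (f x * g x) \<partial>M) =
        a\<^sup>2 * A + b\<^sup>2 * B + 2 * a * b * D"
      using f g L2_integrable_mult[OF f g] by (simp add: L2_def A_def B_def D_def)
    finally show ?thesis .
  qed
  have nn: "0 \<le> A" "0 \<le> B" by (simp_all add: A_def B_def)
  \<comment> \<open>Up to scaling, \<open>(B, -D)\<close> and \<open>(-D, A)\<close> minimise the
    form along one variable; leaving them unnormalised avoids dividing by \<open>A\<close> or
    \<open>B\<close>, which may vanish.\<close>
  have 1: "0 \<le> B * (A * B - D\<^sup>2)" "0 \<le> A * (A * B - D\<^sup>2)"
    using quad[of B "-D"] quad[of "-D" A] by (simp_all add: power2_eq_square algebra_simps)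
  have "D\<^sup>2 \<le> A * B"
  proof (cases "A = 0 \<and> B = 0")
    case True
    then show ?thesis using quad[of 1 1] quad[of 1 "-1"] by simp
  next
    case False
    then have "0 < A \<or> 0 < B" using nn by auto
    then show ?thesis using 1 by (auto simp: zero_le_mult_iff)
  qed
  then have "sqrt (D\<^sup>2) \<le> sqrt (A * B)" by (rule real_sqrt_le_mono)
  then show ?thesis by (simp add: L2norm_def A_def B_def D_def real_sqrt_mult)
qed

lemma L2norm_triangle:
  assumes f: "f \<in> L2 M" and g: "g \<in> L2 M"
  shows "L2norm M (\<lambda>x. f x + g x) \<le> L2norm M f + L2norm M g"
proof (rule power2_le_imp_le)
  have "(L2norm M (\<lambda>x. f x + g x))\<^sup>2 = (\<integral>x. (f x)\<^sup>2 + (g x)\<^sup>2 + 2 * (f x * g x) \<partial>M)"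
    unfolding L2norm_power2 by (simp add: power2_eq_square algebra_simps)
  also have "\<dots> = (L2norm M f)\<^sup>2 + (L2norm M g)\<^sup>2 + 2 * (\<integral>x. f x * g x \<partial>M)"
    using f g L2_integrable_mult[OF f g] by (simp add: L2_def L2norm_power2)
  also have "\<dots> \<le> (L2norm M f + L2norm M g)\<^sup>2"
    using L2_Cauchy_Schwarz[OF f g] by (simp add: power2_sum)
  finally show "(L2norm M (\<lambda>x. f x + g x))\<^sup>2 \<le> (L2norm M f + L2norm M g)\<^sup>2" .
qed simp

section \<open>Uniqueness of the Laplace transform\<close>

lemma set_integrable_exp_neg:
  "0 < a \<Longrightarrow> set_integrable lborel {0<..} (\<lambda>s::real. exp (- a * s))"
  using integrable_I0i_exp_mscale[of a] by (simp add: mult.commute)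

text \<open>With \<open>x = exp (- s)\<close> the transform at \<open>a = 1, 2, ...\<close> becomes
  the moment sequence of a weight on the unit interval. Vanishing moments annihilate polynomials,
  hence continuous functions by Stone-Weierstrass, hence indicators of half-lines, and these
  determine the weight almost everywhere.\<close>

lemma Laplace_zero_imp_AE_zero:
  fixes \<phi> :: "real \<Rightarrow> real"
  assumes [measurable]: "\<phi> \<in> borel_measurable borel"
    and bd: "\<And>s. 0 < s \<Longrightarrow> \<bar>\<phi> s\<bar> \<le> C"
    and lap: "\<And>a. 0 < a \<Longrightarrow> (LINT s:{0<..}|lborel. exp (- a * s) * \<phi> s) = 0"
  shows "AE s in lborel. 0 < s \<longrightarrow> \<phi> s = 0"
proof -
  \<comment> \<open>One factor \<open>exp (- s)\<close> is reserved for integrability; the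
    \<open>i\<close>-th moment of \<open>\<rho>\<close> is then the transform at
    \<open>i + 1\<close>, a positive argument even for \<open>i = 0\<close>.\<close>
  define \<rho> where "\<rho> s = indicator {0<..} s * (exp (- s) * \<phi> s)" for s
  have [measurable]: "\<rho> \<in> borel_measurable borel" unfolding \<rho>_def by measurable
  have e1: "integrable lborel (\<lambda>s::real. indicator {0<..} s * exp (- s))"
    using set_integrable_exp_neg[of 1] by (simp add: set_integrable_def)
  have int: "integrable lborel (\<lambda>s. \<rho> s * K s)"
    if [measurable]: "K \<in> borel_measurable borel" and K: "\<And>s. 0 < s \<Longrightarrow> \<bar>K s\<bar> \<le> c" for K c
  proof (rule Bochner_Integration.integrable_bound[where f="\<lambda>s. (\<bar>C\<bar> * \<bar>c\<bar>) * (indicator {0<..} s * exp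
      (- s))"])
    show "integrable lborel (\<lambda>s. (\<bar>C\<bar> * \<bar>c\<bar>) * (indicator {0<..} s * exp (- s)))"
      using e1 by (intro integrable_mult_right)
    show "AE s in lborel. norm (\<rho> s * K s) \<le> norm ((\<bar>C\<bar> * \<bar>c\<bar>) * (indicator {0<..} s * exp (- s)))"
    proof (intro AE_I2)
      fix s :: real
      show "norm (\<rho> s * K s) \<le> norm ((\<bar>C\<bar> * \<bar>c\<bar>) * (indicator {0<..} s * exp (- s)))"
      proof (cases "0 < s")
        case True
        have "\<bar>\<phi> s\<bar> * \<bar>K s\<bar> \<le> \<bar>C\<bar> * \<bar>c\<bar>"
          using bd[OF True] K[OF True] by (intro mult_mono) auto
        then show ?thesis using True by (simp add: \<rho>_def abs_mult algebra_simps)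
      qed (simp add: \<rho>_def)
    qed
  qed simp
  have poly: "(\<integral>s. \<rho> s * q (exp (- s)) \<partial>lborel) = 0" if poly_q: "real_polynomial_function q" for q
  proof -
    obtain a n where q: "q = (\<lambda>x. \<Sum>i\<le>n. a i * x ^ i)"
      using poly_q unfolding real_polynomial_function_iff_sum by auto
    have m: "(\<integral>s. \<rho> s * (exp (- s)) ^ i \<partial>lborel) = 0" for i
    proof -
      have e: "exp (- (real i + 1) * s) = exp (- s) * exp (- s) ^ i" for s
        by (simp add: exp_of_nat_mult[symmetric] exp_add[symmetric] left_diff_distrib)
      have "(\<integral>s. \<rho> s * (exp (- s)) ^ i \<partial>lborel) =
          (LINT s:{0<..}|lborel. exp (- (real i + 1) * s) * \<phi> s)"
        unfolding set_lebesgue_integral_def e \<rho>_def by (simp add: mult_ac)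
      also have "\<dots> = 0" by (rule lap) simp
      finally show ?thesis .
    qed
    have i: "integrable lborel (\<lambda>s. \<rho> s * (exp (- s)) ^ i)" for i
      by (rule int[where c=1]) (auto simp: power_le_one)
    have "(\<integral>s. \<rho> s * q (exp (- s)) \<partial>lborel) = (\<integral>s. (\<Sum>i\<le>n. a i * (\<rho> s * (exp (- s)) ^ i)) \<partial>lborel)"
      unfolding q by (simp add: sum_distrib_left algebra_simps)
    also have "\<dots> = (\<Sum>i\<le>n. a i * (\<integral>s. \<rho> s * (exp (- s)) ^ i \<partial>lborel))"
      using i by (subst Bochner_Integration.integral_sum) auto
    finally show ?thesis using m by simp
  qed
  have cont: "(\<integral>s. \<rho> s * K (exp (- s)) \<partial>lborel) = 0"
    if K: "continuous_on UNIV K" for K :: "real \<Rightarrow> real"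
  proof -
    have [measurable]: "K \<in> borel_measurable borel" using K by (rule borel_measurable_continuous_onI)
    have compK: "bounded (K ` {0..1})"
      by (intro compact_imp_bounded compact_continuous_image continuous_on_subset[OF K]) auto
    then obtain c where c: "\<forall>x\<in>{0..1}. \<bar>K x\<bar> \<le> c"
      unfolding bounded_iff by auto
    have iK: "integrable lborel (\<lambda>s. \<rho> s * K (exp (- s)))"
      by (rule int[where c=c]) (use c in auto)
    have "\<bar>\<integral>s. \<rho> s * K (exp (- s)) \<partial>lborel\<bar> \<le> e * (\<integral>s. \<bar>\<rho> s\<bar> \<partial>lborel)" if e: "0 < e" for e
    proof -
      obtain q where q: "real_polynomial_function q" "\<And>x. x \<in> {0..1} \<Longrightarrow> \<bar>K x - q x\<bar> < e"
        using Stone_Weierstrass_real_polynomial_function[of "{0..1}" K e] e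
          continuous_on_subset[OF K] by auto
      have cq: "continuous_on UNIV q"
        using q(1) by (intro continuous_on_polymonial_function) (simp add: real_polynomial_function_eq)
      then have [measurable]: "q \<in> borel_measurable borel" by (rule borel_measurable_continuous_onI)
      have "bounded (q ` {0..1})"
        by (intro compact_imp_bounded compact_continuous_image continuous_on_subset[OF cq]) auto
      then obtain d where d: "\<forall>x\<in>{0..1}. \<bar>q x\<bar> \<le> d"
        unfolding bounded_iff by auto
      have iq: "integrable lborel (\<lambda>s. \<rho> s * q (exp (- s)))"
        by (rule int[where c=d]) (use d in auto)
      have "(\<integral>s. \<rho> s * K (exp (- s)) \<partial>lborel) = (\<integral>s. \<rho> s * K (exp (- s)) - \<rho> s * q (exp (- s)) \<partial>lborel)"
        using iK iq poly[OF q(1)] by simp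
      also have "\<bar>\<dots>\<bar> \<le> (\<integral>s. \<bar>\<rho> s * K (exp (- s)) - \<rho> s * q (exp (- s))\<bar> \<partial>lborel)"
        by (rule integral_abs_bound)
      also have "\<dots> \<le> (\<integral>s. e * \<bar>\<rho> s\<bar> \<partial>lborel)"
      proof (rule integral_mono)
        show "integrable lborel (\<lambda>s. \<bar>\<rho> s * K (exp (- s)) - \<rho> s * q (exp (- s))\<bar>)"
          using iK iq by auto
        show "integrable lborel (\<lambda>s. e * \<bar>\<rho> s\<bar>)" using int[of "\<lambda>_. 1" 1] by auto
        show "\<bar>\<rho> s * K (exp (- s)) - \<rho> s * q (exp (- s))\<bar> \<le> e * \<bar>\<rho> s\<bar>" for s
        proof (cases "0 < s")
          case True
          then have "\<bar>K (exp (- s)) - q (exp (- s))\<bar> \<le> e" using q(2)[of "exp (- s)"] by auto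
          then have "\<bar>\<rho> s\<bar> * \<bar>K (exp (- s)) - q (exp (- s))\<bar> \<le> \<bar>\<rho> s\<bar> * e"
            by (intro mult_left_mono) auto
          then show ?thesis by (simp add: right_diff_distrib[symmetric] abs_mult mult.commute)
        qed (simp add: \<rho>_def)
      qed
      finally show ?thesis by simp
    qed
    then have le: "\<bar>\<integral>s. \<rho> s * K (exp (- s)) \<partial>lborel\<bar> \<le> e * (\<integral>s. \<bar>\<rho> s\<bar> \<partial>lborel)" if "0 < e" for e
      using that .
    have "\<bar>\<integral>s. \<rho> s * K (exp (- s)) \<partial>lborel\<bar> \<le> 0"
    proof (rule field_le_epsilon)
      fix e :: real assume "0 < e"
      define I where "I = (\<integral>s. \<bar>\<rho> s\<bar> \<partial>lborel)"
      have "0 \<le> I" by (simp add: I_def)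
      then have "e / (I + 1) * I \<le> e" using \<open>0 < e\<close> by (simp add: field_simps)
      then show "\<bar>\<integral>s. \<rho> s * K (exp (- s)) \<partial>lborel\<bar> \<le> 0 + e"
        using le[of "e / (I + 1)"] \<open>0 < e\<close> \<open>0 \<le> I\<close> unfolding I_def[symmetric] by simp
    qed
    then show ?thesis by simp
  qed
  have tail: "(\<integral>s. \<rho> s * indicator {y<..} s \<partial>lborel) = 0" for y
  proof -
    \<comment> \<open>Continuous ramps in \<open>x = exp (- s)\<close>: zero for
      \<open>s \<le> y\<close>, and increasing to one in \<open>n\<close> for
      \<open>s > y\<close>.\<close>
    define K where "K n x = min 1 (real n * max 0 (exp (- y) - x))" for n x
    have "(\<lambda>n. \<integral>s. \<rho> s * K n (exp (- s)) \<partial>lborel) \<longlonglongrightarrow> (\<integral>s. \<rho> s * indicator {y<..} s \<partial>lborel)"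
    proof (rule integral_dominated_convergence[where w="\<lambda>s. \<bar>\<rho> s\<bar>"])
      show "integrable lborel (\<lambda>s. \<bar>\<rho> s\<bar>)" using int[of "\<lambda>_. 1" 1] by auto
      show "AE s in lborel. (\<lambda>n. \<rho> s * K n (exp (- s))) \<longlonglongrightarrow> \<rho> s * indicator {y<..} s"
      proof (intro AE_I2 tendsto_mult tendsto_const)
        fix s
        show "(\<lambda>n. K n (exp (- s))) \<longlonglongrightarrow> indicator {y<..} s"
        proof (cases "y < s")
          case True
          define d where "d = exp (- y) - exp (- s)"
          have "0 < d" using True by (simp add: d_def)
          have "\<forall>\<^sub>F n in sequentially. K n (exp (- s)) = 1"
            using eventually_ge_at_top[of "nat \<lceil>1 / d\<rceil>"]
          proof eventually_elim
            case (elim n)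
            then have "1 / d \<le> real n" by linarith
            then have "1 \<le> real n * d" using \<open>0 < d\<close> by (simp add: field_simps)
            then show ?case using \<open>0 < d\<close> by (simp add: K_def d_def)
          qed
          then show ?thesis using True by (simp add: tendsto_eventually)
        next
          case False
          then show ?thesis by (simp add: K_def)
        qed
      qed
      show "AE s in lborel. norm (\<rho> s * K n (exp (- s))) \<le> \<bar>\<rho> s\<bar>" for n
      proof (intro AE_I2)
        fix s
        have "0 \<le> real n * max 0 (exp (- y) - exp (- s))" by simp
        then have "\<bar>K n (exp (- s))\<bar> \<le> 1" by (simp add: K_def)
        then show "norm (\<rho> s * K n (exp (- s))) \<le> \<bar>\<rho> s\<bar>"
          by (simp add: abs_mult mult_left_le)
      qed
    qed (auto simp: K_def)
    moreover have "(\<integral>s. \<rho> s * K n (exp (- s)) \<partial>lborel) = 0" for n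
      by (rule cont) (auto simp: K_def intro!: continuous_intros)
    ultimately show ?thesis by (simp add: LIMSEQ_const_iff)
  qed
  have i\<rho>: "integrable lborel \<rho>" using int[of "\<lambda>_. 1" 1] by auto
  \<comment> \<open>As \<open>ennreal\<close> cuts off negative values, the densities are the
    positive and the negative part of \<open>\<rho>\<close>; the vanishing half-line integrals make
    the two measures agree on every \<open>{y<..}\<close>.\<close>
  define M1 M2 where "M1 = density lborel (\<lambda>s. ennreal (\<rho> s))" and "M2
      = density lborel (\<lambda>s. ennreal (- \<rho> s))"
  have em: "emeasure (density lborel (\<lambda>s. ennreal (r s))) {y<..}
      = ennreal (\<integral>s. max 0 (r s) * indicator {y<..} s \<partial>lborel)"
    if "integrable lborel r" for r :: "real \<Rightarrow> real" and y
  proof -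
    have [measurable]: "r \<in> borel_measurable lborel" using that by auto
    have "ennreal (r s) * indicator {y<..} s = ennreal (max 0 (r s) * indicator {y<..} s)" for s
      by (cases "0 \<le> r s") (auto simp: ennreal_neg split: split_indicator)
    then have "emeasure (density lborel (\<lambda>s. ennreal (r s))) {y<..}
        = (\<integral>\<^sup>+s. ennreal (max 0 (r s) * indicator {y<..} s) \<partial>lborel)"
      by (simp add: emeasure_density)
    also have "\<dots> = ennreal (\<integral>s. max 0 (r s) * indicator {y<..} s \<partial>lborel)"
      using that by (intro nn_integral_eq_integral integrable_real_mult_indicator integrable_max) auto
    finally show ?thesis .
  qed
  have "M1 = M2"
  proof (rule measure_eqI_lessThan)
    fix y
    show "emeasure M1 {y<..} < \<infinity>" using em[OF i\<rho>] by (simp add: M1_def)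
    have "(\<integral>s. max 0 (\<rho> s) * indicator {y<..} s \<partial>lborel) - (\<integral>s. max 0 (- \<rho> s) * indicator {y<..} s \<partial>lborel)
      = (\<integral>s. max 0 (\<rho> s) * indicator {y<..} s - max 0 (- \<rho> s) * indicator {y<..} s \<partial>lborel)"
      using i\<rho> by (intro Bochner_Integration.integral_diff[symmetric] integrable_real_mult_indicator
          integrable_max) auto
    also have "\<dots> = (\<integral>s. \<rho> s * indicator {y<..} s \<partial>lborel)"
      by (rule Bochner_Integration.integral_cong) (auto simp: max_def split: split_indicator)
    finally show "emeasure M1 {y<..} = emeasure M2 {y<..}"
      using tail[of y] em[OF i\<rho>] em[of "\<lambda>s. - \<rho> s"] i\<rho> by (simp add: M1_def M2_def)
  qed (auto simp: M1_def M2_def)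
  then have "AE s in lborel. ennreal (\<rho> s) = ennreal (- \<rho> s)"
    unfolding M1_def M2_def by (subst (asm) sigma_finite_measure.density_unique_iff[OF
        sigma_finite_lborel]) auto
  then show ?thesis
  proof (rule AE_mp, intro AE_I2 impI)
    fix s :: real assume "ennreal (\<rho> s) = ennreal (- \<rho> s)" "0 < s"
    then have "\<rho> s = 0"
      by (cases "0 \<le> \<rho> s") (auto simp: ennreal_neg)
    then show "\<phi> s = 0" using \<open>0 < s\<close> by (simp add: \<rho>_def)
  qed
qed

section \<open>Markov processes associated with a semigroup on \<open>L\<^sup>2\<close>\<close>

lemma (in pair_sigma_finite) Fubini_integral_finite:
  fixes f :: "'a \<Rightarrow> 'b \<Rightarrow> real"
  assumes "finite_measure M1" "finite_measure M2"
    and [measurable]: "case_prod f \<in> borel_measurable (M1 \<Otimes>\<^sub>M M2)"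
    and bd: "\<And>x y. x \<in> space M1 \<Longrightarrow> y \<in> space M2 \<Longrightarrow> \<bar>f x y\<bar> \<le> C"
  shows "(\<integral>y. (\<integral>x. f x y \<partial>M1) \<partial>M2) = (\<integral>x. (\<integral>y. f x y \<partial>M2) \<partial>M1)"
proof (rule Fubini_integral)
  interpret A: finite_measure M1 by fact
  interpret B: finite_measure M2 by fact
  interpret P: finite_measure "M1 \<Otimes>\<^sub>M M2"
    by (rule finite_measure_pair_measure) unfold_locales
  show "integrable (M1 \<Otimes>\<^sub>M M2) (case_prod f)"
    by (rule P.integrable_const_bound[where B=C]) (use bd in \<open>auto simp: space_pair_measure\<close>)
qed

text \<open>Positive and negative part are treated by the measurability of nonnegative kernel
  integrals; the bound \<open>C\<close> keeps both finite, so that their difference is the Bochner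
  integral.\<close>

lemma measurable_integral_prob_kernel:
  fixes g :: "'a \<Rightarrow> 'b \<Rightarrow> real"
  assumes g [measurable]: "(\<lambda>(x, y). g x y) \<in> borel_measurable (M \<Otimes>\<^sub>M N)"
    and L: "L \<in> M \<rightarrow>\<^sub>M prob_algebra N"
    and bd: "\<And>x y. x \<in> space M \<Longrightarrow> y \<in> space N \<Longrightarrow> \<bar>g x y\<bar> \<le> C"
  shows "(\<lambda>x. \<integral>y. g x y \<partial>L x) \<in> borel_measurable M"
proof -
  note L' = measurable_prob_algebraD[OF L]
  have "(\<lambda>x. enn2real (\<integral>\<^sup>+y. ennreal (g x y) \<partial>L x) - enn2real (\<integral>\<^sup>+y. ennreal (- g x y) \<partial>L x))
      \<in> borel_measurable M"
    by (intro borel_measurable_diff borel_measurable_enn2real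
          nn_integral_measurable_subprob_algebra2[OF _ L']) measurable
  moreover have "(\<integral>y. g x y \<partial>L x) =
      enn2real (\<integral>\<^sup>+y. ennreal (g x y) \<partial>L x) - enn2real (\<integral>\<^sup>+y. ennreal (- g x y) \<partial>L x)"
    if x: "x \<in> space M" for x
  proof (rule real_lebesgue_integral_def)
    have Lx: "sets (L x) = sets N" "prob_space (L x)"
      using measurable_space[OF L x] by (auto simp: space_prob_algebra)
    interpret prob_space "L x" by fact
    have [measurable]: "g x \<in> borel_measurable (L x)"
      unfolding measurable_cong_sets[OF Lx(1) refl] using x by measurable
    show "integrable (L x) (g x)"
      by (rule integrable_const_bound[where B=C])
        (use bd[OF x] sets_eq_imp_space_eq[OF Lx(1)] in auto)
  qed
  ultimately show ?thesis by (subst measurable_cong) auto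
qed

text \<open>The rule for nonnegative integrals is applied to \<open>G + C\<close>; the constant
  cancels because every measure involved has total mass one.\<close>

lemma integral_bind_prob_kernel:
  fixes G :: "'b \<Rightarrow> real"
  assumes "prob_space M" and L: "L \<in> M \<rightarrow>\<^sub>M prob_algebra N"
    and G [measurable]: "G \<in> borel_measurable N"
    and bd: "\<And>y. y \<in> space N \<Longrightarrow> \<bar>G y\<bar> \<le> C"
  shows "(\<integral>y. G y \<partial>(M \<bind> L)) = (\<integral>x. (\<integral>y. G y \<partial>L x) \<partial>M)"
proof -
  interpret M: prob_space M by fact
  note L' = measurable_prob_algebraD[OF L]
  have Lx: "sets (L x) = sets N" "prob_space (L x)" if "x \<in> space M" for x
    using measurable_space[OF L that] by (auto simp: space_prob_algebra)
  have sb: "sets (M \<bind> L) = sets N" by (rule sets_bind[OF Lx(1)]) (auto simp: M.not_empty)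
  interpret B: prob_space "M \<bind> L"
    by (rule M.prob_space_bind[OF _ L']) (use Lx in auto)
  have Gb [measurable]: "G \<in> borel_measurable (M \<bind> L)" by (simp add: measurable_cong_sets[OF sb refl])
  have iB: "integrable (M \<bind> L) G"
    by (rule B.integrable_const_bound[where B=C]) (use bd sets_eq_imp_space_eq[OF sb] in auto)
  have iL: "integrable (L x) G" if "x \<in> space M" for x
  proof -
    interpret prob_space "L x" by (rule Lx[OF that])
    have "G \<in> borel_measurable (L x)"
      unfolding measurable_cong_sets[OF Lx(1)[OF that] refl] by (rule G)
    then show ?thesis
      by (intro integrable_const_bound[where B=C])
        (use bd sets_eq_imp_space_eq[OF Lx(1)[OF that]] in auto)
  qed
  have meas: "(\<lambda>x. \<integral>y. G y \<partial>L x) \<in> borel_measurable M"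
    by (rule measurable_integral_prob_kernel[OF _ L]) (use bd in auto)
  have bdL: "\<bar>\<integral>y. G y \<partial>L x\<bar> \<le> C" if x: "x \<in> space M" for x
  proof -
    interpret prob_space "L x" by (rule Lx[OF x])
    have "\<bar>\<integral>y. G y \<partial>L x\<bar> \<le> (\<integral>y. \<bar>G y\<bar> \<partial>L x)" by (rule integral_abs_bound)
    also have "\<dots> \<le> (\<integral>y. C \<partial>L x)"
      by (rule integral_mono)
        (use iL[OF x] bd sets_eq_imp_space_eq[OF Lx(1)[OF x]] in auto)
    finally show ?thesis by (simp add: prob_space)
  qed
  have iM: "integrable M (\<lambda>x. \<integral>y. G y \<partial>L x)"
    by (rule M.integrable_const_bound[where B=C]) (use bdL meas in auto)
  have "ennreal (\<integral>y. G y + C \<partial>(M \<bind> L)) = (\<integral>\<^sup>+y. ennreal (G y + C) \<partial>(M \<bind> L))"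
  proof (rule nn_integral_eq_integral[symmetric])
    show "AE y in M \<bind> L. 0 \<le> G y + C"
      using bd sets_eq_imp_space_eq[OF sb] by (intro AE_I2) (force simp: abs_le_iff)
  qed (use iB in auto)
  also have "\<dots> = (\<integral>\<^sup>+x. (\<integral>\<^sup>+y. ennreal (G y + C) \<partial>L x) \<partial>M)"
    by (rule nn_integral_bind[OF _ L']) measurable
  also have "\<dots> = (\<integral>\<^sup>+x. ennreal ((\<integral>y. G y \<partial>L x) + C) \<partial>M)"
  proof (rule nn_integral_cong)
    fix x assume x: "x \<in> space M"
    interpret prob_space "L x" by (rule Lx[OF x])
    have "(\<integral>\<^sup>+y. ennreal (G y + C) \<partial>L x) = ennreal (\<integral>y. G y + C \<partial>L x)"
    proof (rule nn_integral_eq_integral)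
      show "AE y in L x. 0 \<le> G y + C"
        using bd sets_eq_imp_space_eq[OF Lx(1)[OF x]] by (intro AE_I2) (force simp: abs_le_iff)
    qed (use iL[OF x] in auto)
    then show "(\<integral>\<^sup>+y. ennreal (G y + C) \<partial>L x) = ennreal ((\<integral>y. G y \<partial>L x) + C)"
      using iL[OF x] by (simp add: prob_space)
  qed
  also have "\<dots> = ennreal (\<integral>x. (\<integral>y. G y \<partial>L x) + C \<partial>M)"
  proof (rule nn_integral_eq_integral)
    show "AE x in M. 0 \<le> (\<integral>y. G y \<partial>L x) + C"
      using bdL by (intro AE_I2) (force simp: abs_le_iff)
  qed (use iM in auto)
  finally have eq: "ennreal (\<integral>y. G y + C \<partial>(M \<bind> L)) = ennreal (\<integral>x. (\<integral>y. G y \<partial>L x) + C \<partial>M)" .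
  have "0 \<le> (\<integral>y. G y + C \<partial>(M \<bind> L))"
    by (rule integral_nonneg_AE, intro AE_I2)
      (use bd sets_eq_imp_space_eq[OF sb] in \<open>force simp: abs_le_iff\<close>)
  moreover have "0 \<le> (\<integral>x. (\<integral>y. G y \<partial>L x) + C \<partial>M)"
    by (rule integral_nonneg_AE, intro AE_I2) (use bdL in \<open>force simp: abs_le_iff\<close>)
  ultimately have "(\<integral>y. G y + C \<partial>(M \<bind> L)) = (\<integral>x. (\<integral>y. G y \<partial>L x) + C \<partial>M)"
    using eq by simp
  then show ?thesis using iB iM by (simp add: B.prob_space M.prob_space)
qed

text \<open>The geometry-free core of the argument. Correlations involve two times, so the Markov
  property is phrased with an event at time \<open>s\<close> and one at time \<open>s + r\<close>.
  \<open>K\<close> takes values in the probability measures on \<open>N\<close> and can thus be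
  mixed over \<open>\<mu>\<close> by \<open>bind\<close>; joint measurability of \<open>X\<close> is
  what Fubini in time and path requires.\<close>

locale L2_Markov_process = prob_space \<mu> for \<mu> :: "'q measure" +
  fixes N :: "'w measure" and K :: "'q \<Rightarrow> 'w measure" and X :: "real \<Rightarrow> 'w \<Rightarrow> 'q"
    and T :: "real \<Rightarrow> ('q \<Rightarrow> real) \<Rightarrow> 'q \<Rightarrow> real" and \<kappa>1 \<kappa>2 :: real
  assumes K: "K \<in> \<mu> \<rightarrow>\<^sub>M prob_algebra N"
    and X: "(\<lambda>(s, \<omega>). X s \<omega>) \<in> borel \<Otimes>\<^sub>M N \<rightarrow>\<^sub>M \<mu>"
    and markov: "\<And>v s r C C'. v \<in> space \<mu> \<Longrightarrow> 0 \<le> s \<Longrightarrow> 0 \<le> r \<Longrightarrow> C \<in> sets \<mu> \<Longrightarrow> C' \<in> sets \<mu> \<Longrightarrow>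
          emeasure (K v) {\<omega> \<in> space N. X s \<omega> \<in> C \<and> X (s + r) \<omega> \<in> C'} =
          (\<integral>\<^sup>+\<omega>. indicator C (X s \<omega>) * emeasure (K (X s \<omega>)) {\<omega>' \<in> space N. X r \<omega>' \<in> C'} \<partial>K v)"
    and semigroup: "contraction_semigroup \<mu> T"
    and kappa: "0 < \<kappa>1" "0 < \<kappa>2"
    and hypocoercive: "\<And>h s. h \<in> L2 \<mu> \<Longrightarrow> 0 \<le> s \<Longrightarrow>
          L2norm \<mu> (\<lambda>v. T s h v - L2_inner \<mu> h (\<lambda>_. 1))
            \<le> \<kappa>1 * exp (- \<kappa>2 * s) * L2norm \<mu> (\<lambda>v. h v - L2_inner \<mu> h (\<lambda>_. 1))"
    and resolvent: "\<And>f a. f \<in> L2 \<mu> \<Longrightarrow> 0 < a \<Longrightarrow>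
          \<exists>h. is_resolvent \<mu> T a f h \<and> (AE v in \<mu>. process_resolvent X K a f v = h v)"
begin

lemma X_s [measurable]: "X s \<in> N \<rightarrow>\<^sub>M \<mu>"
  using measurable_compose[OF measurable_Pair1' X, of s] by simp

lemma X_meas [measurable (raw)]:
  assumes "f \<in> M \<rightarrow>\<^sub>M borel" "g \<in> M \<rightarrow>\<^sub>M N"
  shows "(\<lambda>x. X (f x) (g x)) \<in> M \<rightarrow>\<^sub>M \<mu>"
  using measurable_compose[OF measurable_Pair[OF assms] X] by simp

lemma X_space: "\<omega> \<in> space N \<Longrightarrow> X s \<omega> \<in> space \<mu>"
  using measurable_space[OF X_s] .

lemma K_sets: "v \<in> space \<mu> \<Longrightarrow> sets (K v) = sets N"
  and K_prob: "v \<in> space \<mu> \<Longrightarrow> prob_space (K v)"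
  using measurable_space[OF K] by (auto simp: space_prob_algebra)

lemma K_space: "v \<in> space \<mu> \<Longrightarrow> space (K v) = space N"
  using K_sets sets_eq_imp_space_eq by blast

definition law :: "'w measure" where "law = \<mu> \<bind> K"

text \<open>The transition operators of the process as pointwise defined functions. They are applied
  to bounded \<open>h\<close>, for which the integral exists at every starting point.\<close>

definition trans :: "real \<Rightarrow> ('q \<Rightarrow> real) \<Rightarrow> 'q \<Rightarrow> real" where
  "trans r h v = (\<integral>\<omega>. h (X r \<omega>) \<partial>K v)"

lemma sets_law [measurable_cong]: "sets law = sets N"
  unfolding law_def by (rule sets_bind[OF K_sets]) (auto simp: not_empty)

lemma space_law: "space law = space N"
  using sets_law sets_eq_imp_space_eq by blast

lemma prob_space_law: "prob_space law"
  unfolding law_def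
  by (rule prob_space_bind[OF _ measurable_prob_algebraD[OF K]]) (use K_prob in auto)

sublocale law: prob_space law by (rule prob_space_law)

subsection \<open>The semigroup\<close>

lemma T_L2: "0 \<le> s \<Longrightarrow> h \<in> L2 \<mu> \<Longrightarrow> T s h \<in> L2 \<mu>"
  and T_contract: "0 \<le> s \<Longrightarrow> h \<in> L2 \<mu> \<Longrightarrow> L2norm \<mu> (T s h) \<le> L2norm \<mu> h"
  and T_add: "0 \<le> s \<Longrightarrow> 0 \<le> r \<Longrightarrow> h \<in> L2 \<mu> \<Longrightarrow> AE x in \<mu>. T (s + r) h x = T s (T r h) x"
  and T_cont0: "h \<in> L2 \<mu> \<Longrightarrow> ((\<lambda>t. L2norm \<mu> (\<lambda>x. T t h x - h x)) \<longlongrightarrow> 0) (at_right 0)"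
  using semigroup unfolding contraction_semigroup_def by blast+

lemma T_lincomb: "0 \<le> s \<Longrightarrow> h \<in> L2 \<mu> \<Longrightarrow> g \<in> L2 \<mu> \<Longrightarrow>
    AE x in \<mu>. T s (\<lambda>y. a * h y + b * g y) x = a * T s h x + b * T s g x"
  using semigroup unfolding contraction_semigroup_def by blast

lemma T_diff: "0 \<le> s \<Longrightarrow> h \<in> L2 \<mu> \<Longrightarrow> g \<in> L2 \<mu> \<Longrightarrow>
    AE x in \<mu>. T s (\<lambda>y. h y - g y) x = T s h x - T s g x"
  using T_lincomb[of s h g 1 "-1"] by simp

text \<open>\<open>T (s + r) h - T s h\<close> is \<open>T s\<close> applied to
  \<open>T r h - h\<close>, so contractivity spreads the modulus of continuity at 0 uniformly over
  all times.\<close>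

lemma T_modulus:
  assumes s: "0 \<le> s" "0 \<le> r" and h: "h \<in> L2 \<mu>"
  shows "L2norm \<mu> (\<lambda>x. T (s + r) h x - T s h x) \<le> L2norm \<mu> (\<lambda>x. T r h x - h x)"
proof -
  have r: "T r h \<in> L2 \<mu>" by (intro T_L2 s h)
  have "L2norm \<mu> (\<lambda>x. T (s + r) h x - T s h x) = L2norm \<mu> (T s (\<lambda>x. T r h x - h x))"
  proof (rule L2norm_cong_AE)
    show "AE x in \<mu>. T (s + r) h x - T s h x = T s (\<lambda>x. T r h x - h x) x"
      using T_add[OF s h] T_diff[OF s(1) r h] by eventually_elim simp
    show "(\<lambda>x. T (s + r) h x - T s h x) \<in> borel_measurable \<mu>"
      using s h by (intro L2_measurable L2_diff T_L2) auto
    show "T s (\<lambda>x. T r h x - h x) \<in> borel_measurable \<mu>"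
      using s h by (intro L2_measurable L2_diff T_L2) auto
  qed
  also have "\<dots> \<le> L2norm \<mu> (\<lambda>x. T r h x - h x)"
    using s h by (intro T_contract L2_diff T_L2) auto
  finally show ?thesis .
qed

text \<open>Supplies the Borel measurability in time that the uniqueness theorem for Laplace
  transforms asks for.\<close>

lemma continuous_on_T_inner:
  assumes h: "h \<in> L2 \<mu>" and w: "w \<in> L2 \<mu>"
  shows "continuous_on {0..} (\<lambda>s. L2_inner \<mu> (T s h) w)"
proof -
  have step: "\<bar>L2_inner \<mu> (T (s + r) h) w - L2_inner \<mu> (T s h) w\<bar>
      \<le> L2norm \<mu> (\<lambda>x. T r h x - h x) * L2norm \<mu> w" if "0 \<le> s" "0 \<le> r" for s r
  proof -
    have L: "T (s + r) h \<in> L2 \<mu>" "T s h \<in> L2 \<mu>" using that h by (auto intro: T_L2)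
    have "L2_inner \<mu> (T (s + r) h) w - L2_inner \<mu> (T s h) w = (\<integral>x. (T (s + r) h x - T s h x) * w x \<partial>\<mu>)"
      using L2_integrable_mult[OF L(1) w] L2_integrable_mult[OF L(2) w]
      by (simp add: L2_inner_def left_diff_distrib)
    also have "\<bar>\<dots>\<bar> \<le> L2norm \<mu> (\<lambda>x. T (s + r) h x - T s h x) * L2norm \<mu> w"
      by (intro L2_Cauchy_Schwarz L2_diff L w)
    also have "\<dots> \<le> L2norm \<mu> (\<lambda>x. T r h x - h x) * L2norm \<mu> w"
      by (intro mult_right_mono T_modulus that h) auto
    finally show ?thesis .
  qed
  show ?thesis
    unfolding continuous_on_iff
  proof (intro ballI allI impI)
    fix s e :: real assume s: "s \<in> {0..}" and e: "0 < e"
    \<comment> \<open>The added 1 keeps \<open>e / W\<close> meaningful when \<open>w\<close>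
      vanishes.\<close>
    define W where "W = L2norm \<mu> w + 1"
    have W: "0 < W" using L2norm_nonneg[of \<mu> w] unfolding W_def by linarith
    have "\<forall>\<^sub>F r in at_right 0. L2norm \<mu> (\<lambda>x. T r h x - h x) < e / W"
      using order_tendstoD(2)[OF T_cont0[OF h], of "e / W"] e W by simp
    then obtain d where d: "0 < d" "\<And>r. 0 < r \<Longrightarrow> r < d \<Longrightarrow> L2norm \<mu> (\<lambda>x. T r h x - h x) < e / W"
      unfolding eventually_at_right_field by auto
    have small: "\<bar>L2_inner \<mu> (T (s + r) h) w - L2_inner \<mu> (T s h) w\<bar> < e"
      if "0 \<le> s" "0 < r" "r < d" for s r
    proof -
      have "\<bar>L2_inner \<mu> (T (s + r) h) w - L2_inner \<mu> (T s h) w\<bar>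
          \<le> L2norm \<mu> (\<lambda>x. T r h x - h x) * L2norm \<mu> w"
        using step that by simp
      also have "\<dots> \<le> L2norm \<mu> (\<lambda>x. T r h x - h x) * W"
        by (intro mult_left_mono) (auto simp: W_def)
      also have "\<dots> < e" using d(2)[OF that(2,3)] W by (simp add: field_simps)
      finally show ?thesis .
    qed
    show "\<exists>d>0. \<forall>s'\<in>{0..}. dist s' s < d \<longrightarrow> dist (L2_inner \<mu> (T s' h) w) (L2_inner \<mu> (T s h) w) < e"
    proof (intro exI[of _ d] conjI ballI impI d(1))
      fix s' assume s': "s' \<in> {0..}" "dist s' s < d"
      \<comment> \<open>For \<open>s' < s\<close> the increment is taken from \<open>s'\<close>
        upwards; the modulus does not depend on the base point.\<close>
      consider "s' = s" | "s < s'" | "s' < s" by linarith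
      then show "dist (L2_inner \<mu> (T s' h) w) (L2_inner \<mu> (T s h) w) < e"
      proof cases
        case 2 then show ?thesis using small[of s "s' - s"] s s' by (simp add: dist_real_def)
      next
        case 3 then show ?thesis using small[of s' "s - s'"] s s'
            by (simp add: dist_real_def abs_minus_commute)
      qed (use e in simp)
    qed
  qed
qed

lemma L2norm_const: "L2norm \<mu> (\<lambda>_. c) = \<bar>c\<bar>"
  by (simp add: L2norm_def prob_space)

lemma L2_inner_one: "L2_inner \<mu> h (\<lambda>_. 1) = (\<integral>x. h x \<partial>\<mu>)"
  by (simp add: L2_inner_def)

text \<open>Both \<open>T\<^sub>s\<^sub>+\<^sub>r h\<close> and \<open>T\<^sub>r (T\<^sub>s h)\<close> converge to their mean values as \<open>r\<close> tends to infinity.\<close>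

lemma integral_T:
  assumes s: "0 \<le> s" and h: "h \<in> L2 \<mu>"
  shows "(\<integral>x. T s h x \<partial>\<mu>) = (\<integral>x. h x \<partial>\<mu>)"
proof -
  define a b where "a = (\<integral>x. h x \<partial>\<mu>)" and "b = (\<integral>x. T s h x \<partial>\<mu>)"
  define A B where "A = L2norm \<mu> (\<lambda>v. h v - a)" and "B = L2norm \<mu> (\<lambda>v. T s h v - b)"
  have Ts: "T s h \<in> L2 \<mu>" by (intro T_L2 s h)
  have bnd: "\<bar>a - b\<bar> \<le> \<kappa>1 * exp (- \<kappa>2 * r) * (A + B)" if r: "0 \<le> r" for r
  proof -
    have L: "T (s + r) h \<in> L2 \<mu>" "T r (T s h) \<in> L2 \<mu>" using s r h Ts by (auto intro: T_L2)
    \<comment> \<open>On a probability space a constant has norm equal to its modulus, and by the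
      semigroup law the two evolved functions cancel almost everywhere.\<close>
    have "\<bar>a - b\<bar> = L2norm \<mu> (\<lambda>v. a - b)" by (simp add: L2norm_const)
    also have "\<dots> = L2norm \<mu> (\<lambda>v. (T r (T s h) v - b) + (-1) * (T (s + r) h v - a))"
    proof (rule L2norm_cong_AE)
      show "AE v in \<mu>. a - b = T r (T s h) v - b + (-1) * (T (s + r) h v - a)"
        using T_add[OF r s h] by eventually_elim (simp add: add.commute)
      show "(\<lambda>v. T r (T s h) v - b + (-1) * (T (s + r) h v - a)) \<in> borel_measurable \<mu>"
        using L2_measurable[OF L(1)] L2_measurable[OF L(2)] by measurable
    qed simp
    also have "\<dots> \<le> L2norm \<mu> (\<lambda>v. T r (T s h) v - b) + L2norm \<mu> (\<lambda>v. (-1) * (T (s + r) h v - a))"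
      by (intro L2norm_triangle L2_scale L2_diff L L2_const)
    also have "L2norm \<mu> (\<lambda>v. (-1) * (T (s + r) h v - a)) = L2norm \<mu> (\<lambda>v. T (s + r) h v - a)"
      by (simp only: L2norm_scale)
    also have "L2norm \<mu> (\<lambda>v. T r (T s h) v - b) \<le> \<kappa>1 * exp (- \<kappa>2 * r) * B"
      using hypocoercive[OF Ts r] by (simp add: L2_inner_one b_def B_def)
    also have "L2norm \<mu> (\<lambda>v. T (s + r) h v - a) \<le> \<kappa>1 * exp (- \<kappa>2 * (s + r)) * A"
      using hypocoercive[OF h, of "s + r"] s r by (simp add: L2_inner_one a_def A_def)
    also have "\<dots> \<le> \<kappa>1 * exp (- \<kappa>2 * r) * A"
      using s kappa by (intro mult_right_mono mult_left_mono) (auto simp: A_def)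
    finally show ?thesis by (simp add: distrib_left algebra_simps)
  qed
  have "((\<lambda>r. \<kappa>1 * exp (- \<kappa>2 * r) * (A + B)) \<longlongrightarrow> \<kappa>1 * 0 * (A + B)) at_top"
    using kappa(2)
    by (intro tendsto_intros filterlim_compose[OF exp_at_bot] filterlim_tendsto_neg_mult_at_bot[OF
        tendsto_const])
      (auto intro: filterlim_ident)
  then have "\<bar>a - b\<bar> \<le> \<kappa>1 * 0 * (A + B)"
    by (rule tendsto_lowerbound[OF _ eventually_mono[OF eventually_ge_at_top[of 0] bnd]]) auto
  then show ?thesis by (simp add: a_def b_def)
qed

subsection \<open>Transition operators\<close>

lemma trans_measurable:
  assumes [measurable]: "h \<in> borel_measurable \<mu>" and bd: "\<And>v. v \<in> space \<mu> \<Longrightarrow> \<bar>h v\<bar> \<le> C"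
  shows "(\<lambda>(s, v). trans s h v) \<in> borel_measurable (borel \<Otimes>\<^sub>M \<mu>)"
proof -
  have "(\<lambda>x. \<integral>\<omega>. h (X (fst x) \<omega>) \<partial>K (snd x)) \<in> borel_measurable (borel \<Otimes>\<^sub>M \<mu>)"
  proof (rule measurable_integral_prob_kernel[where N=N and C=C])
    show "(\<lambda>x. K (snd x)) \<in> borel \<Otimes>\<^sub>M \<mu> \<rightarrow>\<^sub>M prob_algebra N"
      using K by measurable
    show "(\<lambda>(x, \<omega>). h (X (fst x) \<omega>)) \<in> borel_measurable ((borel \<Otimes>\<^sub>M \<mu>) \<Otimes>\<^sub>M N)"
      by measurable
  qed (use bd X_space in auto)
  then show ?thesis by (simp add: trans_def split_beta')
qed

lemma trans_measurable1:
  assumes "h \<in> borel_measurable \<mu>" and "\<And>v. v \<in> space \<mu> \<Longrightarrow> \<bar>h v\<bar> \<le> C"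
  shows "trans s h \<in> borel_measurable \<mu>"
  using measurable_compose[OF measurable_Pair1' trans_measurable[OF assms], of s] by simp

lemma integrable_K:
  fixes h :: "'q \<Rightarrow> real"
  assumes [measurable]: "h \<in> borel_measurable \<mu>" and bd: "\<And>v. v \<in> space \<mu> \<Longrightarrow> \<bar>h v\<bar> \<le> C"
    and v: "v \<in> space \<mu>"
  shows "integrable (K v) (\<lambda>\<omega>. h (X r \<omega>))"
proof -
  interpret Kv: prob_space "K v" by (rule K_prob[OF v])
  have [measurable]: "(\<lambda>\<omega>. h (X r \<omega>)) \<in> borel_measurable (K v)"
    unfolding measurable_cong_sets[OF K_sets[OF v] refl] by measurable
  show ?thesis
    by (rule Kv.integrable_const_bound[where B=C]) (use bd X_space K_space[OF v] in auto)
qed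

lemma trans_bound:
  assumes h: "h \<in> borel_measurable \<mu>" and bd: "\<And>v. v \<in> space \<mu> \<Longrightarrow> \<bar>h v\<bar> \<le> C" and v: "v \<in> space \<mu>"
  shows "\<bar>trans s h v\<bar> \<le> C"
proof -
  interpret Kv: prob_space "K v" by (rule K_prob[OF v])
  have "\<bar>trans s h v\<bar> \<le> (\<integral>\<omega>. \<bar>h (X s \<omega>)\<bar> \<partial>K v)"
    unfolding trans_def by (rule integral_abs_bound)
  also have "\<dots> \<le> (\<integral>\<omega>. C \<partial>K v)"
    by (rule integral_mono) (use integrable_K[OF h bd v] bd X_space K_space[OF v] in auto)
  finally show ?thesis by (simp add: Kv.prob_space)
qed

lemma integral_law_X:
  assumes [measurable]: "h \<in> borel_measurable \<mu>" and bd: "\<And>v. v \<in> space \<mu> \<Longrightarrow> \<bar>h v\<bar> \<le> C"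
  shows "(\<integral>\<omega>. h (X s \<omega>) \<partial>law) = (\<integral>v. trans s h v \<partial>\<mu>)"
  unfolding law_def trans_def
  by (rule integral_bind_prob_kernel[OF prob_space_axioms K, where C=C]) (use bd X_space in auto)

text \<open>On rectangles this is the Markov property integrated over the initial distribution;
  rectangles form an intersection-stable generator and the masses are finite. As an identity of
  measures it applies to arbitrary functions of the pair.\<close>

lemma law_pair:
  assumes s: "0 \<le> s" and r: "0 \<le> r"
  shows "distr law (\<mu> \<Otimes>\<^sub>M \<mu>) (\<lambda>\<omega>. (X s \<omega>, X (s + r) \<omega>)) =
    distr law \<mu> (X s) \<bind> (\<lambda>v. distr (K v) (\<mu> \<Otimes>\<^sub>M \<mu>) (\<lambda>\<omega>. (v, X r \<omega>)))"
proof -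
  let ?J1 = "distr law (\<mu> \<Otimes>\<^sub>M \<mu>) (\<lambda>\<omega>. (X s \<omega>, X (s + r) \<omega>))"
  let ?D = "distr law \<mu> (X s)"
  let ?L = "\<lambda>v. distr (K v) (\<mu> \<Otimes>\<^sub>M \<mu>) (\<lambda>\<omega>. (v, X r \<omega>))"
  interpret D: prob_space ?D by (rule law.prob_space_distr) measurable
  interpret J: prob_space ?J1 by (rule law.prob_space_distr) measurable
  have Lm: "?L \<in> \<mu> \<rightarrow>\<^sub>M prob_algebra (\<mu> \<Otimes>\<^sub>M \<mu>)"
    by (rule measurable_distr_prob_space2[OF K]) measurable
  then have Lm': "?L \<in> ?D \<rightarrow>\<^sub>M subprob_algebra (\<mu> \<Otimes>\<^sub>M \<mu>)"
    by (auto dest: measurable_prob_algebraD)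
  have sb: "sets (?D \<bind> ?L) = sets (\<mu> \<Otimes>\<^sub>M \<mu>)"
    by (rule sets_bind) (auto simp: not_empty)
  have rect: "emeasure ?J1 (C \<times> C') = emeasure (?D \<bind> ?L) (C \<times> C')"
    if C [measurable]: "C \<in> sets \<mu>" "C' \<in> sets \<mu>" for C C'
  proof -
    have E [measurable]: "{\<omega> \<in> space N. X s \<omega> \<in> C \<and> X (s + r) \<omega> \<in> C'} \<in> sets N" by measurable
    have em: "(\<lambda>v. emeasure (K v) {\<omega>' \<in> space N. X r \<omega>' \<in> C'}) \<in> borel_measurable \<mu>"
      using measurable_prob_algebraD[OF K] by measurable
    have "emeasure ?J1 (C \<times> C') = emeasure law {\<omega> \<in> space N. X s \<omega> \<in> C \<and> X (s + r) \<omega> \<in> C'}"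
      by (subst emeasure_distr) (auto simp: space_law intro!: arg_cong[where f="emeasure law"])
    also have "\<dots> = (\<integral>\<^sup>+v. emeasure (K v) {\<omega> \<in> space N. X s \<omega> \<in> C \<and> X (s + r) \<omega> \<in> C'} \<partial>\<mu>)"
      unfolding law_def by (rule emeasure_bind[OF not_empty measurable_prob_algebraD[OF K] E])
    also have "\<dots> = (\<integral>\<^sup>+v. (\<integral>\<^sup>+\<omega>. indicator C (X s \<omega>) * emeasure (K (X s \<omega>)) {\<omega>' \<in> space N. X r \<omega>'
        \<in> C'} \<partial>K v) \<partial>\<mu>)"
      by (intro nn_integral_cong markov s r C)
    also have "\<dots> = (\<integral>\<^sup>+\<omega>. indicator C (X s \<omega>) * emeasure (K (X s \<omega>)) {\<omega>' \<in> space N. X r \<omega>' \<in> C'} \<partial>law)"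
      unfolding law_def
      by (rule nn_integral_bind[symmetric, OF _ measurable_prob_algebraD[OF K]])
        (intro borel_measurable_times_ennreal measurable_compose[OF X_s em], measurable)
    also have "\<dots> = (\<integral>\<^sup>+v. indicator C v * emeasure (K v) {\<omega>' \<in> space N. X r \<omega>' \<in> C'} \<partial>?D)"
      by (subst nn_integral_distr) (auto intro!: borel_measurable_times_ennreal em)
    also have "\<dots> = (\<integral>\<^sup>+v. emeasure (?L v) (C \<times> C') \<partial>?D)"
    proof (rule nn_integral_cong)
      fix v assume "v \<in> space ?D"
      then have v: "v \<in> space \<mu>" by simp
      have m: "(\<lambda>\<omega>. (v, X r \<omega>)) \<in> K v \<rightarrow>\<^sub>M \<mu> \<Otimes>\<^sub>M \<mu>"
        unfolding measurable_cong_sets[OF K_sets[OF v] refl] using v by measurable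
      show "indicator C v * emeasure (K v) {\<omega>' \<in> space N. X r \<omega>' \<in> C'} = emeasure (?L v) (C \<times> C')"
      proof -
        have "(\<lambda>\<omega>. (v, X r \<omega>)) -` (C \<times> C') \<inter> space N =
            (if v \<in> C then {\<omega>' \<in> space N. X r \<omega>' \<in> C'} else {})" by auto
        then show ?thesis by (subst emeasure_distr[OF m]) (auto simp: K_space[OF v])
      qed
    qed
    also have "\<dots> = emeasure (?D \<bind> ?L) (C \<times> C')"
      by (rule emeasure_bind[symmetric, OF _ Lm']) (auto simp: not_empty)
    finally show ?thesis .
  qed
  show ?thesis
  proof (rule measure_eqI_generator_eq[OF Int_stable_pair_measure_generator[of \<mu> \<mu>],
        where \<Omega>="space \<mu> \<times> space \<mu>" and A="\<lambda>_. space \<mu> \<times> space \<mu>"])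
    show "{a \<times> b |a b. a \<in> sets \<mu> \<and> b \<in> sets \<mu>} \<subseteq> Pow (space \<mu> \<times> space \<mu>)"
      using sets.sets_into_space by fastforce
    show "sets ?J1 = sigma_sets (space \<mu> \<times> space \<mu>) {a \<times> b |a b. a \<in> sets \<mu> \<and> b \<in> sets \<mu>}"
      by (simp add: sets_pair_measure)
    show "sets (?D \<bind> ?L) = sigma_sets (space \<mu> \<times> space \<mu>) {a \<times> b |a b. a \<in> sets \<mu> \<and> b \<in> sets \<mu>}"
      by (simp add: sb sets_pair_measure)
    show "emeasure ?J1 (space \<mu> \<times> space \<mu>) \<noteq> \<infinity>" by simp
  qed (use rect in auto)
qed

text \<open>Functional form of the Markov property: under \<open>bind\<close> the first coordinate
  is frozen at \<open>v\<close>, so \<open>f v\<close> leaves the inner integral and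
  \<open>trans r g v\<close> remains.\<close>

lemma integral_law_pair:
  assumes s: "0 \<le> s" and r: "0 \<le> r"
    and f [measurable]: "f \<in> borel_measurable \<mu>" and bf: "\<And>v. v \<in> space \<mu> \<Longrightarrow> \<bar>f v\<bar> \<le> B"
    and g [measurable]: "g \<in> borel_measurable \<mu>" and bg: "\<And>v. v \<in> space \<mu> \<Longrightarrow> \<bar>g v\<bar> \<le> C"
  shows "(\<integral>\<omega>. f (X s \<omega>) * g (X (s + r) \<omega>) \<partial>law) = (\<integral>\<omega>. f (X s \<omega>) * trans r g (X s \<omega>) \<partial>law)"
proof -
  let ?D = "distr law \<mu> (X s)"
  let ?L = "\<lambda>v. distr (K v) (\<mu> \<Otimes>\<^sub>M \<mu>) (\<lambda>\<omega>. (v, X r \<omega>))"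
  have Lm: "?L \<in> \<mu> \<rightarrow>\<^sub>M prob_algebra (\<mu> \<Otimes>\<^sub>M \<mu>)"
    by (rule measurable_distr_prob_space2[OF K]) measurable
  have t [measurable]: "trans r g \<in> borel_measurable \<mu>" by (rule trans_measurable1[OF g bg])
  have "(\<integral>\<omega>. f (X s \<omega>) * g (X (s + r) \<omega>) \<partial>law) =
      (\<integral>x. f (fst x) * g (snd x) \<partial>distr law (\<mu> \<Otimes>\<^sub>M \<mu>) (\<lambda>\<omega>. (X s \<omega>, X (s + r) \<omega>)))"
    by (subst integral_distr) auto
  also have "\<dots> = (\<integral>x. f (fst x) * g (snd x) \<partial>(?D \<bind> ?L))"
    by (simp only: law_pair[OF s r])
  also have "\<dots> = (\<integral>v. (\<integral>x. f (fst x) * g (snd x) \<partial>?L v) \<partial>?D)"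
  proof (rule integral_bind_prob_kernel[where C="B * C"])
    show "prob_space ?D" by (rule law.prob_space_distr) measurable
    show "?L \<in> ?D \<rightarrow>\<^sub>M prob_algebra (\<mu> \<Otimes>\<^sub>M \<mu>)" using Lm by simp
    fix y assume "y \<in> space (\<mu> \<Otimes>\<^sub>M \<mu>)"
    then have "\<bar>f (fst y)\<bar> \<le> B" "\<bar>g (snd y)\<bar> \<le> C" using bf bg by (auto simp: space_pair_measure)
    then show "\<bar>f (fst y) * g (snd y)\<bar> \<le> B * C"
      unfolding abs_mult by (intro mult_mono) auto
  qed measurable
  also have "\<dots> = (\<integral>v. f v * trans r g v \<partial>?D)"
  proof (rule Bochner_Integration.integral_cong[OF refl])
    fix v assume "v \<in> space ?D"
    then have v: "v \<in> space \<mu>" by simp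
    have m: "(\<lambda>\<omega>. (v, X r \<omega>)) \<in> K v \<rightarrow>\<^sub>M \<mu> \<Otimes>\<^sub>M \<mu>"
      unfolding measurable_cong_sets[OF K_sets[OF v] refl] using v by measurable
    show "(\<integral>x. f (fst x) * g (snd x) \<partial>?L v) = f v * trans r g v"
      by (subst integral_distr[OF m]) (auto simp: trans_def)
  qed
  also have "\<dots> = (\<integral>\<omega>. f (X s \<omega>) * trans r g (X s \<omega>) \<partial>law)"
    by (subst integral_distr) auto
  finally show ?thesis .
qed

end

section \<open>Finite measures on the time axis\<close>

definition exp_measure :: "real \<Rightarrow> real measure" where
  "exp_measure a = density lborel (\<lambda>s. ennreal (indicator {0<..} s * exp (- a * s)))"

lemma sets_exp_measure [measurable_cong]: "sets (exp_measure a) = sets borel"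
  by (simp add: exp_measure_def)

lemma finite_exp_measure:
  assumes "0 < a"
  shows "finite_measure (exp_measure a)"
proof
  have "integrable lborel (\<lambda>s. indicator {0<..} s * exp (- a * s))"
    using set_integrable_exp_neg[OF assms] by (simp add: set_integrable_def)
  then have "(\<integral>\<^sup>+s. ennreal (indicator {0<..} s * exp (- a * s)) \<partial>lborel)
      = ennreal (\<integral>s. indicator {0<..} s * exp (- a * s) \<partial>lborel)"
    by (rule nn_integral_eq_integral) simp
  then show "emeasure (exp_measure a) (space (exp_measure a)) \<noteq> \<infinity>"
    by (simp add: exp_measure_def emeasure_density)
qed

lemma integral_exp_measure:
  fixes \<phi> :: "real \<Rightarrow> real"
  assumes [measurable]: "\<phi> \<in> borel_measurable borel"
  shows "(\<integral>s. \<phi> s \<partial>exp_measure a) = (LINT s:{0<..}|lborel. exp (- a * s) * \<phi> s)"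
  unfolding exp_measure_def set_lebesgue_integral_def
  by (subst integral_density) (auto simp: mult.assoc)

text \<open>Like \<open>exp_measure\<close>, this encodes a set integral as integration against a
  finite measure on the whole line, so that Fubini and Cauchy-Schwarz for finite measures apply
  directly.\<close>

definition window_measure :: "real \<Rightarrow> real measure" where
  "window_measure t = density lborel (indicator {0..<t})"

lemma sets_window_measure [measurable_cong]: "sets (window_measure t) = sets borel"
  by (simp add: window_measure_def)

lemma space_window_measure: "space (window_measure t) = UNIV"
  by (simp add: window_measure_def)

lemma emeasure_window_measure: "0 \<le> t \<Longrightarrow> emeasure (window_measure t) UNIV = ennreal t"
  by (simp add: window_measure_def emeasure_density)

lemma finite_window_measure: "0 \<le> t \<Longrightarrow> finite_measure (window_measure t)"
  by (rule finite_measureI) (simp add: space_window_measure emeasure_window_measure)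

lemma AE_window_measure: "(AE s in window_measure t. P s) \<longleftrightarrow> (AE s in lborel. s \<in> {0..<t} \<longrightarrow> P s)"
  unfolding window_measure_def by (subst AE_density) (auto simp: indicator_def)

lemma integral_window_measure:
  fixes \<phi> :: "real \<Rightarrow> real"
  assumes [measurable]: "\<phi> \<in> borel_measurable borel"
  shows "(\<integral>s. \<phi> s \<partial>window_measure t) = (LINT s:{0..<t}|lborel. \<phi> s)"
  unfolding window_measure_def set_lebesgue_integral_def ennreal_indicator[symmetric]
  by (subst integral_density) auto

lemma integrable_window_measure:
  fixes \<phi> :: "real \<Rightarrow> real"
  assumes [measurable]: "\<phi> \<in> borel_measurable borel"
  shows "integrable (window_measure t) \<phi> \<longleftrightarrow> set_integrable lborel {0..<t} \<phi>"
  unfolding window_measure_def set_integrable_def ennreal_indicator[symmetric]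
  by (subst integrable_density) auto

text \<open>The exact value is \<open>(2 - exp (- \<kappa> * (t - s)) - exp (- \<kappa> * s)) /
  \<kappa>\<close>, and each exponential is at least \<open>exp (- t * \<kappa>)\<close>. The
  resulting bound is uniform in \<open>s\<close>, which allows integrating it over the second time
  variable.\<close>

lemma integral_exp_abs_le:
  fixes \<kappa> s t :: real
  assumes \<kappa>: "0 < \<kappa>" and s: "0 \<le> s" "s \<le> t"
  shows "(LINT u:{0..<t}|lborel. exp (- \<kappa> * \<bar>u - s\<bar>)) \<le> 2 / \<kappa> * (1 - exp (- t * \<kappa>))"
proof -
  have d1: "DERIV (\<lambda>u. - exp (- \<kappa> * (u - s)) / \<kappa>) u :> exp (- \<kappa> * (u - s))"
    and d2: "DERIV (\<lambda>u. exp (- \<kappa> * (s - u)) / \<kappa>) u :> exp (- \<kappa> * (s - u))" for u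
    using \<kappa> by (auto intro!: derivative_eq_intros)
  have 1: "integrable lborel (\<lambda>u. exp (- \<kappa> * (u - s)) * indicator {s..t} u)"
    by (rule integrable_FTC_Icc_nonneg[OF _ d1]) (use s in auto)
  have i1: "(\<integral>u. exp (- \<kappa> * (u - s)) * indicator {s..t} u \<partial>lborel) = - exp (- \<kappa> * (t - s)) / \<kappa>
      - (- exp (- \<kappa> * (s - s)) / \<kappa>)"
    by (rule integral_FTC_Icc_nonneg[OF _ d1]) (use s in auto)
  have 2: "integrable lborel (\<lambda>u. exp (- \<kappa> * (s - u)) * indicator {0..s} u)"
    by (rule integrable_FTC_Icc_nonneg[OF _ d2]) (use s in auto)
  have i2: "(\<integral>u. exp (- \<kappa> * (s - u)) * indicator {0..s} u \<partial>lborel) = exp (- \<kappa> * (s - s)) / \<kappa>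
      - exp (- \<kappa> * (s - 0)) / \<kappa>"
    by (rule integral_FTC_Icc_nonneg[OF _ d2]) (use s in auto)
  \<comment> \<open>The closed pieces overlap in the single point \<open>s\<close>, so their sum
    dominates the integrand everywhere and nothing is lost in the integral.\<close>
  have "(LINT u:{0..<t}|lborel. exp (- \<kappa> * \<bar>u - s\<bar>))
      \<le> (\<integral>u. exp (- \<kappa> * (u - s)) * indicator {s..t} u + exp (- \<kappa> * (s - u)) * indicator {0..s} u \<partial>lborel)"
    unfolding set_lebesgue_integral_def
  proof (rule integral_mono)
    show "integrable lborel (\<lambda>u. indicator {0..<t} u *\<^sub>R exp (- \<kappa> * \<bar>u - s\<bar>))"
      by (rule Bochner_Integration.integrable_bound[OF Bochner_Integration.integrable_add[OF 1 2]])
        (auto split: split_indicator simp: abs_if)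
    show "indicator {0..<t} u *\<^sub>R exp (- \<kappa> * \<bar>u - s\<bar>)
        \<le> exp (- \<kappa> * (u - s)) * indicator {s..t} u + exp (- \<kappa> * (s - u)) * indicator {0..s} u" for u
      by (auto split: split_indicator simp: abs_if)
  qed (use 1 2 in auto)
  also have "\<dots> = (1 - exp (- \<kappa> * (t - s))) / \<kappa> + (1 - exp (- \<kappa> * s)) / \<kappa>"
    by (subst Bochner_Integration.integral_add[OF 1 2], unfold i1 i2) (simp add: diff_divide_distrib)
  also have "\<dots> \<le> (1 - exp (- t * \<kappa>)) / \<kappa> + (1 - exp (- t * \<kappa>)) / \<kappa>"
    using \<kappa> s by (intro add_mono divide_right_mono diff_left_mono) (auto simp: mult.commute algebra_simps)
  finally show ?thesis by simp
qed

section \<open>Identification with the semigroup and invariance of the measure\<close>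

context L2_Markov_process
begin

lemma integral_mult_trans_measurable:
  fixes w g :: "'q \<Rightarrow> real"
  assumes [measurable]: "w \<in> borel_measurable \<mu>" "g \<in> borel_measurable \<mu>"
    and bg: "\<And>v. v \<in> space \<mu> \<Longrightarrow> \<bar>g v\<bar> \<le> C"
  shows "(\<lambda>s. \<integral>v. w v * trans s g v \<partial>\<mu>) \<in> borel_measurable borel"
proof -
  have [measurable]: "(\<lambda>x. trans (fst x) g (snd x)) \<in> borel_measurable (borel \<Otimes>\<^sub>M \<mu>)"
    using trans_measurable[of g C] bg by (simp add: split_beta')
  show ?thesis
    by (rule borel_measurable_lebesgue_integral) measurable
qed

text \<open>Both sides have the same Laplace transform in \<open>r\<close>, namely the resolvent tested against \<open>w\<close>.\<close>

lemma AE_trans_eq_T: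
  assumes w [measurable]: "w \<in> borel_measurable \<mu>" and bw: "\<And>v. v \<in> space \<mu> \<Longrightarrow> \<bar>w v\<bar> \<le> B"
    and g [measurable]: "g \<in> borel_measurable \<mu>" and bg: "\<And>v. v \<in> space \<mu> \<Longrightarrow> \<bar>g v\<bar> \<le> C"
  shows "AE r in lborel. 0 < r \<longrightarrow> (\<integral>v. w v * trans r g v \<partial>\<mu>) = L2_inner \<mu> (T r g) w"
proof -
  have wL: "w \<in> L2 \<mu>" by (rule bounded_in_L2[OF w bw])
  have gL: "g \<in> L2 \<mu>" by (rule bounded_in_L2[OF g bg])
  have tm [measurable]: "(\<lambda>x. trans (fst x) g (snd x)) \<in> borel_measurable (borel \<Otimes>\<^sub>M \<mu>)"
    using trans_measurable[of g C] bg by (simp add: split_beta')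
  have [measurable]: "(\<lambda>x. trans (snd x) g (fst x)) \<in> borel_measurable (\<mu> \<Otimes>\<^sub>M borel)"
    using measurable_compose[OF measurable_pair_swap' tm] by (simp add: split_beta')
  define \<alpha> where "\<alpha> r = (\<integral>v. w v * trans r g v \<partial>\<mu>)" for r
  \<comment> \<open>The pairing is known to be continuous, hence Borel, on nonnegative times;
    outside them it is replaced by 0.\<close>
  define \<beta> where "\<beta> r = indicator {0<..} r *\<^sub>R L2_inner \<mu> (T r g) w" for r
  have [measurable]: "\<alpha> \<in> borel_measurable borel"
    unfolding \<alpha>_def by (rule integral_mult_trans_measurable[OF w g bg])
  have [measurable]: "\<beta> \<in> borel_measurable borel"
    unfolding \<beta>_def
    by (intro borel_measurable_continuous_on_indicator continuous_on_subset[OF continuous_on_T_inner[OF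
        gL wL]]) auto
  have prodb: "\<bar>w v * trans r g v\<bar> \<le> B * C" if "v \<in> space \<mu>" for r v
    unfolding abs_mult using bw[OF that] trans_bound[OF g bg that] by (intro mult_mono) auto
  have \<alpha>b: "\<bar>\<alpha> r\<bar> \<le> B * C" for r
  proof -
    have [measurable]: "trans r g \<in> borel_measurable \<mu>" by (rule trans_measurable1[OF g bg])
    have "integrable \<mu> (\<lambda>v. w v * trans r g v)"
      by (rule integrable_const_bound[where B="B * C"]) (use prodb in auto)
    then have "(\<integral>v. \<bar>w v * trans r g v\<bar> \<partial>\<mu>) \<le> (\<integral>v. B * C \<partial>\<mu>)"
      by (intro integral_mono) (use prodb in auto)
    then show ?thesis
      unfolding \<alpha>_def by (intro order_trans[OF integral_abs_bound]) (simp add: prob_space)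
  qed
  have \<beta>b: "\<bar>\<beta> r\<bar> \<le> L2norm \<mu> g * L2norm \<mu> w" for r
  proof (cases "0 < r")
    case True
    have "\<bar>L2_inner \<mu> (T r g) w\<bar> \<le> L2norm \<mu> (T r g) * L2norm \<mu> w"
      unfolding L2_inner_def using True by (intro L2_Cauchy_Schwarz T_L2 gL wL) auto
    also have "\<dots> \<le> L2norm \<mu> g * L2norm \<mu> w"
      using True by (intro mult_right_mono T_contract gL) auto
    finally show ?thesis using True by (simp add: \<beta>_def)
  qed (simp add: \<beta>_def)
  have "AE r in lborel. 0 < r \<longrightarrow> \<alpha> r - \<beta> r = 0"
  proof (rule Laplace_zero_imp_AE_zero[where C="B * C + L2norm \<mu> g * L2norm \<mu> w"])
    show "\<bar>\<alpha> r - \<beta> r\<bar> \<le> B * C + L2norm \<mu> g * L2norm \<mu> w" for r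
      using \<alpha>b[of r] \<beta>b[of r] by linarith
    fix a :: real assume a: "0 < a"
    interpret E: finite_measure "exp_measure a" by (rule finite_exp_measure[OF a])
    interpret P: pair_sigma_finite "exp_measure a" \<mu> ..
    obtain h where h: "is_resolvent \<mu> T a g h" "AE v in \<mu>. process_resolvent X K a g v = h v"
      using resolvent[OF gL a] by blast
    have hL: "h \<in> L2 \<mu>" using h(1) by (simp add: is_resolvent_def)
    have R: "process_resolvent X K a g v = (\<integral>s. trans s g v \<partial>exp_measure a)" if v: "v \<in> space \<mu>" for v
    proof -
      have "(\<lambda>s. trans s g v) \<in> borel_measurable borel"
        using measurable_compose[OF measurable_Pair2'[OF v] trans_measurable[OF g bg]] by simp
      from integral_exp_measure[OF this, of a] show ?thesis
        by (simp add: process_resolvent_def trans_def)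
    qed
    \<comment> \<open>Fubini moves the time integral inside, where it is the resolvent of the
      process at \<open>v\<close>; association replaces it by \<open>h\<close> for almost every
      \<open>v\<close>.\<close>
    have "(\<integral>s. \<alpha> s \<partial>exp_measure a) = (\<integral>v. (\<integral>s. w v * trans s g v \<partial>exp_measure a) \<partial>\<mu>)"
      unfolding \<alpha>_def
      by (rule P.Fubini_integral_finite[symmetric, where C="B * C"])
        (use prodb in \<open>auto intro!: E.finite_measure_axioms finite_measure_axioms\<close>)
    also have "\<dots> = (\<integral>v. h v * w v \<partial>\<mu>)"
    proof (rule integral_cong_AE)
      show "(\<lambda>v. \<integral>s. w v * trans s g v \<partial>exp_measure a) \<in> borel_measurable \<mu>"
        by (rule E.borel_measurable_lebesgue_integral) measurable
      show "(\<lambda>v. h v * w v) \<in> borel_measurable \<mu>" using L2_measurable[OF hL] by measurable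
      show "AE v in \<mu>. (\<integral>s. w v * trans s g v \<partial>exp_measure a) = h v * w v"
        using h(2) AE_space by eventually_elim (simp add: R mult.commute)
    qed
    also have "\<dots> = (LINT s:{0<..}|lborel. exp (- a * s) * L2_inner \<mu> (T s g) w)"
      using h(1) wL by (simp add: is_resolvent_def L2_inner_def)
    also have "\<dots> = (LINT s:{0<..}|lborel. exp (- a * s) * \<beta> s)"
      by (rule set_lebesgue_integral_cong) (auto simp: \<beta>_def)
    also have "\<dots> = (\<integral>s. \<beta> s \<partial>exp_measure a)"
      by (rule integral_exp_measure[symmetric]) measurable
    finally have eq: "(\<integral>s. \<alpha> s \<partial>exp_measure a) = (\<integral>s. \<beta> s \<partial>exp_measure a)" .
    have "(LINT s:{0<..}|lborel. exp (- a * s) * (\<alpha> s - \<beta> s)) = (\<integral>s. \<alpha> s - \<beta> s \<partial>exp_measure a)"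
      by (rule integral_exp_measure[symmetric]) measurable
    also have "\<dots> = (\<integral>s. \<alpha> s \<partial>exp_measure a) - (\<integral>s. \<beta> s \<partial>exp_measure a)"
    proof (rule Bochner_Integration.integral_diff)
      show "integrable (exp_measure a) \<alpha>"
        by (rule E.integrable_const_bound[where B="B * C"]) (use \<alpha>b in auto)
      show "integrable (exp_measure a) \<beta>"
        by (rule E.integrable_const_bound[where B="L2norm \<mu> g * L2norm \<mu> w"]) (use \<beta>b in auto)
    qed
    finally show "(LINT s:{0<..}|lborel. exp (- a * s) * (\<alpha> s - \<beta> s)) = 0" using eq by simp
  qed measurable
  then show ?thesis by eventually_elim (auto simp: \<alpha>_def \<beta>_def)
qed

text \<open>Chapman-Kolmogorov averaged over the initial distribution: the two-time formula with the
  constant 1 as first factor.\<close>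

lemma integral_trans_add:
  assumes s: "0 \<le> s" and r: "0 \<le> r"
    and g [measurable]: "g \<in> borel_measurable \<mu>" and bg: "\<And>v. v \<in> space \<mu> \<Longrightarrow> \<bar>g v\<bar> \<le> C"
  shows "(\<integral>v. trans (s + r) g v \<partial>\<mu>) = (\<integral>v. trans s (trans r g) v \<partial>\<mu>)"
proof -
  have t: "trans r g \<in> borel_measurable \<mu>" by (rule trans_measurable1[OF g bg])
  have "(\<integral>\<omega>. g (X (s + r) \<omega>) \<partial>law) = (\<integral>\<omega>. trans r g (X s \<omega>) \<partial>law)"
    using integral_law_pair[OF s r _ _ g bg, of "\<lambda>_. 1" 1] by simp
  then show ?thesis
    by (simp add: integral_law_X[OF g bg] integral_law_X[OF t trans_bound[OF g bg]])
qed

lemma AE_integral_trans: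
  assumes g: "g \<in> borel_measurable \<mu>" and bg: "\<And>v. v \<in> space \<mu> \<Longrightarrow> \<bar>g v\<bar> \<le> C"
  shows "AE r in lborel. 0 < r \<longrightarrow> (\<integral>v. trans r g v \<partial>\<mu>) = (\<integral>v. g v \<partial>\<mu>)"
proof -
  have "AE r in lborel. 0 < r \<longrightarrow> (\<integral>v. 1 * trans r g v \<partial>\<mu>) = L2_inner \<mu> (T r g) (\<lambda>_. 1)"
    by (rule AE_trans_eq_T[OF _ _ g bg, where B=1]) auto
  then show ?thesis
    by eventually_elim (simp add: L2_inner_one integral_T bounded_in_L2[OF g bg])
qed

text \<open>Stationarity at almost all times extends to all times \<open>s\<close>: choose \<open>r\<close> such that it holds at
  time \<open>r\<close> for \<open>trans s g\<close> and at time \<open>r + s\<close> for \<open>g\<close>.\<close>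

lemma integral_trans:
  assumes s: "0 \<le> s"
    and g [measurable]: "g \<in> borel_measurable \<mu>" and bg: "\<And>v. v \<in> space \<mu> \<Longrightarrow> \<bar>g v\<bar> \<le> C"
  shows "(\<integral>v. trans s g v \<partial>\<mu>) = (\<integral>v. g v \<partial>\<mu>)"
proof -
  have t: "trans s g \<in> borel_measurable \<mu>" by (rule trans_measurable1[OF g bg])
  have [measurable]: "(\<lambda>r. \<integral>v. trans r g v \<partial>\<mu>) \<in> borel_measurable borel"
    using integral_mult_trans_measurable[OF _ g bg, of "\<lambda>_. 1"] by simp
  have 0: "AE r in lborel. 0 < r \<longrightarrow> (\<integral>v. trans r g v \<partial>\<mu>) = (\<integral>v. g v \<partial>\<mu>)"
    by (rule AE_integral_trans[OF g bg])
  have 1: "AE r in lborel. 0 < r \<longrightarrow> (\<integral>v. trans r (trans s g) v \<partial>\<mu>) = (\<integral>v. trans s g v \<partial>\<mu>)"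
    by (rule AE_integral_trans[OF t trans_bound[OF g bg]])
  \<comment> \<open>Translations of the time axis preserve null sets.\<close>
  have 2: "AE r in lborel. 0 < s + 1 * r \<longrightarrow> (\<integral>v. trans (s + 1 * r) g v \<partial>\<mu>) = (\<integral>v. g v \<partial>\<mu>)"
    by (rule AE_borel_affine[OF _ _ 0]) auto
  have AE: "AE r in lborel. 0 < (r::real) \<longrightarrow> (\<integral>v. trans s g v \<partial>\<mu>) = (\<integral>v. g v \<partial>\<mu>)"
    using 1 2
  proof eventually_elim
    case (elim r)
    show ?case
    proof
      assume r: "0 < r"
      have "(\<integral>v. trans s g v \<partial>\<mu>) = (\<integral>v. trans r (trans s g) v \<partial>\<mu>)" using elim r by simp
      also have "\<dots> = (\<integral>v. trans (r + s) g v \<partial>\<mu>)"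
        by (rule integral_trans_add[symmetric, OF _ s g bg]) (use r in auto)
      also have "\<dots> = (\<integral>v. g v \<partial>\<mu>)" using elim r s by (simp add: add.commute)
      finally show "(\<integral>v. trans s g v \<partial>\<mu>) = (\<integral>v. g v \<partial>\<mu>)" .
    qed
  qed
  \<comment> \<open>An assertion free of \<open>r\<close> that holds for almost every positive
    \<open>r\<close> is true, since the positive half-line is not a null set.\<close>
  have notAE: "\<not> (AE r in lborel. \<not> (0::real) < r)"
  proof
    assume "AE r in lborel. \<not> (0::real) < r"
    then have "emeasure lborel {r \<in> space lborel. (0::real) < r} = 0"
      by (rule emeasure_eq_0_AE)
    moreover have "emeasure lborel {0<..<1::real} \<le> emeasure lborel {r \<in> space lborel. (0::real) < r}"
      by (rule emeasure_mono) auto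
    ultimately show False by simp
  qed
  show ?thesis
  proof (rule ccontr)
    assume "(\<integral>v. trans s g v \<partial>\<mu>) \<noteq> (\<integral>v. g v \<partial>\<mu>)"
    with AE have "AE r in lborel. \<not> (0::real) < r" by simp
    with notAE show False by contradiction
  qed
qed

text \<open>As an identity of image measures, invariance extends by change of variables beyond the
  bounded functions of \<open>integral_trans\<close>, in particular to the square of an
  \<open>L2\<close> function.\<close>

lemma distr_law_X:
  assumes s: "0 \<le> s"
  shows "distr law \<mu> (X s) = \<mu>"
proof (rule measure_eqI)
  fix C assume "C \<in> sets (distr law \<mu> (X s))"
  then have C [measurable]: "C \<in> sets \<mu>" by simp
  have "measure (distr law \<mu> (X s)) C = (\<integral>v. indicator C v \<partial>distr law \<mu> (X s))"
    by simp
  also have "\<dots> = (\<integral>\<omega>. indicator C (X s \<omega>) \<partial>law)"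
    by (rule integral_distr) auto
  also have "\<dots> = (\<integral>v. trans s (indicator C) v \<partial>\<mu>)"
    by (rule integral_law_X[where C=1]) (auto simp: indicator_def)
  also have "\<dots> = (\<integral>v. indicator C v \<partial>\<mu>)"
    by (rule integral_trans[OF s, where C=1]) (auto simp: indicator_def)
  finally have eq: "measure (distr law \<mu> (X s)) C = measure \<mu> C"
    by simp
  interpret D: prob_space "distr law \<mu> (X s)" by (rule law.prob_space_distr) measurable
  from eq show "emeasure (distr law \<mu> (X s)) C = emeasure \<mu> C"
    by (simp add: D.emeasure_eq_measure emeasure_eq_measure)
qed simp

lemma integral_law_X':
  fixes h :: "'q \<Rightarrow> real"
  assumes "0 \<le> s" "h \<in> borel_measurable \<mu>"
  shows "(\<integral>\<omega>. h (X s \<omega>) \<partial>law) = (\<integral>v. h v \<partial>\<mu>)"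
  using integral_distr[of "X s" law \<mu> h] assms by (simp add: distr_law_X)

lemma nn_integral_law_X:
  assumes "0 \<le> s" "h \<in> borel_measurable \<mu>"
  shows "(\<integral>\<^sup>+\<omega>. h (X s \<omega>) \<partial>law) = (\<integral>\<^sup>+v. h v \<partial>\<mu>)"
  using nn_integral_distr[of "X s" law \<mu> h] assms by (simp add: distr_law_X)

subsection \<open>Decay of correlations\<close>

text \<open>The Markov property at the earlier time and stationarity reduce the correlation to a
  function \<open>\<psi>\<close> of the lag. For almost every lag \<open>\<psi> r\<close> is the
  pairing of \<open>T r g\<close> with \<open>g\<close>, which Cauchy-Schwarz and hypocoercivity
  bound because \<open>g\<close> has mean zero.\<close>

lemma AE_correlation_le:
  assumes g [measurable]: "g \<in> borel_measurable \<mu>" and bg: "\<And>v. v \<in> space \<mu> \<Longrightarrow> \<bar>g v\<bar> \<le> C"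
    and mean: "(\<integral>v. g v \<partial>\<mu>) = 0" and s: "0 \<le> s"
  shows "AE u in lborel. 0 \<le> u \<longrightarrow>
    \<bar>\<integral>\<omega>. g (X s \<omega>) * g (X u \<omega>) \<partial>law\<bar> \<le> \<kappa>1 * (L2norm \<mu> g)\<^sup>2 * exp (- \<kappa>2 * \<bar>u - s\<bar>)"
proof -
  define \<psi> where "\<psi> r = (\<integral>v. g v * trans r g v \<partial>\<mu>)" for r
  have [measurable]: "\<psi> \<in> borel_measurable borel"
    unfolding \<psi>_def by (rule integral_mult_trans_measurable[OF g g bg])
  have gL: "g \<in> L2 \<mu>" by (rule bounded_in_L2[OF g bg])
  have corr: "(\<integral>\<omega>. g (X s \<omega>) * g (X (s + r) \<omega>) \<partial>law) = \<psi> r" if "0 \<le> s" "0 \<le> r" for s r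
  proof -
    have t [measurable]: "trans r g \<in> borel_measurable \<mu>" by (rule trans_measurable1[OF g bg])
    have "(\<integral>\<omega>. g (X s \<omega>) * g (X (s + r) \<omega>) \<partial>law) = (\<integral>\<omega>. g (X s \<omega>) * trans r g (X s \<omega>) \<partial>law)"
      by (rule integral_law_pair[OF that g bg g bg])
    also have "\<dots> = \<psi> r"
      unfolding \<psi>_def by (rule integral_law_X'[OF that(1), of "\<lambda>v. g v * trans r g v"]) measurable
    finally show ?thesis .
  qed
  have assoc: "AE r in lborel. 0 < r \<longrightarrow> \<psi> r = L2_inner \<mu> (T r g) g"
    unfolding \<psi>_def by (rule AE_trans_eq_T[OF g bg g bg])
  have dec: "AE r in lborel. 0 < r \<longrightarrow> \<bar>\<psi> r\<bar> \<le> \<kappa>1 * (L2norm \<mu> g)\<^sup>2 * exp (- \<kappa>2 * r)"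
    using assoc
  proof eventually_elim
    case (elim r)
    show ?case
    proof
      assume r: "0 < r"
      have "\<bar>\<psi> r\<bar> \<le> L2norm \<mu> (T r g) * L2norm \<mu> g"
        using elim r L2_Cauchy_Schwarz[OF T_L2[OF _ gL] gL, of r] by (simp add: L2_inner_def)
      also have "\<dots> \<le> (\<kappa>1 * exp (- \<kappa>2 * r) * L2norm \<mu> g) * L2norm \<mu> g"
        using hypocoercive[OF gL, of r] r by (intro mult_right_mono) (simp_all add: L2_inner_one mean)
      finally show "\<bar>\<psi> r\<bar> \<le> \<kappa>1 * (L2norm \<mu> g)\<^sup>2 * exp (- \<kappa>2 * r)"
        by (simp add: power2_eq_square mult_ac)
    qed
  qed
  \<comment> \<open>The null set of exceptional lags is pulled back along \<open>u - s\<close> and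
    \<open>s - u\<close>. The resulting null sets of times \<open>u\<close> depend on
    \<open>s\<close>, which is fixed beforehand.\<close>
  have 1: "AE u in lborel. 0 < - s + 1 * u \<longrightarrow> \<bar>\<psi> (- s + 1 * u)\<bar> \<le> \<kappa>1 * (L2norm \<mu> g)\<^sup>2 * exp (- \<kappa>2 * (- s
      + 1 * u))"
    by (rule AE_borel_affine[OF _ _ dec]) auto
  have 2: "AE u in lborel. 0 < s + (-1) * u \<longrightarrow> \<bar>\<psi> (s + (-1) * u)\<bar> \<le> \<kappa>1 * (L2norm \<mu> g)\<^sup>2 * exp (- \<kappa>2 * (s
      + (-1) * u))"
    by (rule AE_borel_affine[OF _ _ dec]) auto
  show ?thesis
    \<comment> \<open>The point \<open>u = s\<close> is discarded because the decay is known for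
      strictly positive lags only.\<close>
    using 1 2 AE_lborel_singleton[of s]
  proof eventually_elim
    case (elim u)
    show ?case
    proof
      assume u: "0 \<le> u"
      show "\<bar>\<integral>\<omega>. g (X s \<omega>) * g (X u \<omega>) \<partial>law\<bar> \<le> \<kappa>1 * (L2norm \<mu> g)\<^sup>2 * exp (- \<kappa>2 * \<bar>u - s\<bar>)"
      proof (cases "s < u")
        case True
        then show ?thesis using elim(1) corr[OF s, of "u - s"] by (simp add: algebra_simps)
      next
        case False
        then have "u < s" using elim(3) by simp
        then show ?thesis using elim(2) corr[OF u, of "s - u"] by (simp add: algebra_simps)
      qed
    qed
  qed
qed

subsection \<open>Time averages\<close>

lemma integral_interval_X_measurable:
  fixes f :: "'q \<Rightarrow> real"
  assumes t: "0 \<le> t" and [measurable]: "f \<in> borel_measurable \<mu>"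
  shows "(\<lambda>\<omega>. \<integral>s. f (X s \<omega>) \<partial>window_measure t) \<in> borel_measurable law"
proof -
  interpret I: finite_measure "window_measure t" by (rule finite_window_measure[OF t])
  show ?thesis by (rule I.borel_measurable_lebesgue_integral) measurable
qed

text \<open>Two applications of Fubini write the second moment as the double time integral of the
  correlations \<open>c s u\<close>; the inner integral over \<open>u\<close> is bounded by the same
  \<open>B\<close> for every \<open>s\<close> in the window, and the outer one contributes the
  length \<open>t\<close>.\<close>

lemma L2norm_time_integral_bounded:
  assumes t: "0 < t"
    and g [measurable]: "g \<in> borel_measurable \<mu>" and bg: "\<And>v. v \<in> space \<mu> \<Longrightarrow> \<bar>g v\<bar> \<le> C"
    and mean: "(\<integral>v. g v \<partial>\<mu>) = 0"
  shows "L2norm law (\<lambda>\<omega>. \<integral>s. g (X s \<omega>) \<partial>window_measure t)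
    \<le> sqrt (t * (2 * \<kappa>1 / \<kappa>2 * (1 - exp (- t * \<kappa>2)))) * L2norm \<mu> g"
proof -
  let ?I = "window_measure t"
  interpret I: finite_measure ?I by (rule finite_window_measure) (use t in auto)
  interpret P: pair_sigma_finite ?I law ..
  have mI: "measure ?I (space ?I) = t"
    using t emeasure_window_measure[of t] by (simp add: measure_def space_window_measure)
  define c where "c s u = (\<integral>\<omega>. g (X s \<omega>) * g (X u \<omega>) \<partial>law)" for s u
  define V where "V = (L2norm \<mu> g)\<^sup>2"
  define B where "B = \<kappa>1 * V * (2 / \<kappa>2 * (1 - exp (- t * \<kappa>2)))"
  have V: "0 \<le> V" by (simp add: V_def)
  have prodb: "\<bar>g (X s \<omega>) * g (X u \<omega>)\<bar> \<le> C * C" if "\<omega> \<in> space N" for s u \<omega>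
    \<comment> \<open>The constant \<open>C\<close> is not assumed nonnegative; its sign is read off
      from the bound at one point of the path.\<close>
    unfolding abs_mult using bg[OF X_space[OF that]] order_trans[OF abs_ge_zero bg[OF X_space[OF that,
        of 0]]]
    by (intro mult_mono) auto
  have [measurable]: "(\<lambda>x. c (fst x) (snd x)) \<in> borel_measurable (borel \<Otimes>\<^sub>M borel)"
    unfolding c_def by (rule law.borel_measurable_lebesgue_integral) measurable
  have [measurable]: "c s \<in> borel_measurable borel" for s
    unfolding c_def by (rule law.borel_measurable_lebesgue_integral) measurable
  have cb: "\<bar>c s u\<bar> \<le> C * C" for s u
  proof -
    have "integrable law (\<lambda>\<omega>. g (X s \<omega>) * g (X u \<omega>))"
      by (rule law.integrable_const_bound[where B="C * C"]) (use prodb in \<open>auto simp: space_law\<close>)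
    then have "(\<integral>\<omega>. \<bar>g (X s \<omega>) * g (X u \<omega>)\<bar> \<partial>law) \<le> (\<integral>\<omega>. C * C \<partial>law)"
      by (intro integral_mono) (use prodb in \<open>auto simp: space_law\<close>)
    then show ?thesis
      unfolding c_def by (intro order_trans[OF integral_abs_bound]) (simp add: law.prob_space)
  qed
  have inner: "(\<integral>u. c s u \<partial>?I) \<le> B" if s: "s \<in> {0..<t}" for s
  proof -
    have "(\<integral>u. c s u \<partial>?I) \<le> (\<integral>u. \<kappa>1 * V * exp (- \<kappa>2 * \<bar>u - s\<bar>) \<partial>?I)"
    proof (rule integral_mono_AE)
      show "integrable ?I (c s)"
        by (rule I.integrable_const_bound[where B="C * C"]) (use cb in auto)
      show "integrable ?I (\<lambda>u. \<kappa>1 * V * exp (- \<kappa>2 * \<bar>u - s\<bar>))"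
        by (rule I.integrable_const_bound[where B="\<kappa>1 * V"])
          (use kappa V in \<open>auto simp: abs_mult intro!: mult_left_le\<close>)
      have "AE u in lborel. 0 \<le> u \<longrightarrow> \<bar>c s u\<bar> \<le> \<kappa>1 * V * exp (- \<kappa>2 * \<bar>u - s\<bar>)"
        unfolding c_def V_def by (rule AE_correlation_le[OF g bg mean]) (use s in auto)
      then show "AE u in ?I. c s u \<le> \<kappa>1 * V * exp (- \<kappa>2 * \<bar>u - s\<bar>)"
        unfolding AE_window_measure by eventually_elim auto
    qed
    also have "\<dots> = \<kappa>1 * V * (LINT u:{0..<t}|lborel. exp (- \<kappa>2 * \<bar>u - s\<bar>))"
      by (simp add: integral_window_measure)
    also have "\<dots> \<le> B"
      unfolding B_def using kappa V s by (intro mult_left_mono integral_exp_abs_le) auto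
    finally show ?thesis .
  qed
  have m1 [measurable]: "(\<lambda>\<omega>. \<integral>u. g (X u \<omega>) \<partial>?I) \<in> borel_measurable N"
    using integral_interval_X_measurable[of t g] t by simp
  have Gb: "\<bar>\<integral>u. g (X u \<omega>) \<partial>?I\<bar> \<le> C * t" if w: "\<omega> \<in> space N" for \<omega>
  proof -
    have [measurable]: "(\<lambda>u. g (X u \<omega>)) \<in> borel_measurable borel" using w by measurable
    have "integrable ?I (\<lambda>u. g (X u \<omega>))"
      by (rule I.integrable_const_bound[where B=C]) (use bg X_space[OF w] in auto)
    then have "(\<integral>u. \<bar>g (X u \<omega>)\<bar> \<partial>?I) \<le> (\<integral>u. C \<partial>?I)"
      by (intro integral_mono) (use bg X_space[OF w] in auto)
    then show ?thesis
      by (intro order_trans[OF integral_abs_bound]) (simp add: mI mult.commute)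
  qed
  have "(\<integral>\<omega>. (\<integral>s. g (X s \<omega>) \<partial>?I)\<^sup>2 \<partial>law) = (\<integral>\<omega>. (\<integral>s. g (X s \<omega>) * (\<integral>u. g (X u \<omega>) \<partial>?I) \<partial>?I) \<partial>law)"
    by (simp add: power2_eq_square)
  also have "\<dots> = (\<integral>s. (\<integral>\<omega>. g (X s \<omega>) * (\<integral>u. g (X u \<omega>) \<partial>?I) \<partial>law) \<partial>?I)"
  proof (rule P.Fubini_integral_finite[where C="C * (C * t)"])
    show "\<bar>g (X s \<omega>) * (\<integral>u. g (X u \<omega>) \<partial>?I)\<bar> \<le> C * (C * t)" if "\<omega> \<in> space law" for s \<omega>
      unfolding abs_mult using that bg[OF X_space] Gb
      by (intro mult_mono) (auto simp: space_law intro: order_trans[OF abs_ge_zero])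
  qed (auto intro: I.finite_measure_axioms law.finite_measure_axioms)
  also have "\<dots> = (\<integral>s. (\<integral>\<omega>. (\<integral>u. g (X s \<omega>) * g (X u \<omega>) \<partial>?I) \<partial>law) \<partial>?I)"
    by simp
  also have "\<dots> = (\<integral>s. (\<integral>u. c s u \<partial>?I) \<partial>?I)"
    unfolding c_def
    by (intro Bochner_Integration.integral_cong refl P.Fubini_integral_finite[where C="C * C"])
      (auto intro: I.finite_measure_axioms law.finite_measure_axioms simp: prodb space_law)
  also have "\<dots> \<le> (\<integral>s. B \<partial>?I)"
  proof (rule integral_mono_AE)
    have "\<bar>\<integral>u. c s u \<partial>?I\<bar> \<le> C * C * t" for s
    proof -
      have "integrable ?I (c s)"
        by (rule I.integrable_const_bound[where B="C * C"]) (use cb in auto)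
      then have "(\<integral>u. \<bar>c s u\<bar> \<partial>?I) \<le> (\<integral>u. C * C \<partial>?I)"
        by (intro integral_mono) (use cb in auto)
      then show ?thesis
        by (intro order_trans[OF integral_abs_bound]) (simp add: mI mult_ac)
    qed
    moreover have "(\<lambda>s. \<integral>u. c s u \<partial>?I) \<in> borel_measurable ?I"
      by (rule I.borel_measurable_lebesgue_integral) (simp add: split_beta')
    ultimately show "integrable ?I (\<lambda>s. \<integral>u. c s u \<partial>?I)"
      by (intro I.integrable_const_bound[where B="C * C * t"]) auto
    show "AE s in ?I. (\<integral>u. c s u \<partial>?I) \<le> B"
      unfolding AE_window_measure using inner by auto
  qed simp
  also have "\<dots> = t * (2 * \<kappa>1 / \<kappa>2 * (1 - exp (- t * \<kappa>2))) * V"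
    by (simp add: mI B_def)
  finally have "sqrt (\<integral>\<omega>. (\<integral>s. g (X s \<omega>) \<partial>?I)\<^sup>2 \<partial>law) \<le> sqrt (t * (2 * \<kappa>1 / \<kappa>2 * (1 - exp (- t * \<kappa>2))) * V)"
    by (rule real_sqrt_le_mono)
  also have "\<dots> = sqrt (t * (2 * \<kappa>1 / \<kappa>2 * (1 - exp (- t * \<kappa>2)))) * L2norm \<mu> g"
    by (simp only: V_def real_sqrt_mult[of _ "(L2norm \<mu> g)\<^sup>2"] real_sqrt_abs abs_of_nonneg L2norm_nonneg)
  finally show ?thesis by (simp only: L2norm_def[of law])
qed

text \<open>Cauchy-Schwarz in time against the constant 1 gives one factor \<open>t\<close>,
  stationarity and Fubini the other. The time integral is thereby a bounded operator from
  \<open>L2 \<mu>\<close> to \<open>L2 law\<close>, which makes sense of it for unbounded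
  \<open>f\<close> and controls the error of truncation.\<close>

lemma L2_time_integral:
  assumes t: "0 < t" and f: "f \<in> L2 \<mu>"
  shows "AE \<omega> in law. integrable (window_measure t) (\<lambda>s. f (X s \<omega>))" (is ?int)
    and "(\<lambda>\<omega>. \<integral>s. f (X s \<omega>) \<partial>window_measure t) \<in> L2 law" (is ?L2)
    and "L2norm law (\<lambda>\<omega>. \<integral>s. f (X s \<omega>) \<partial>window_measure t) \<le> t * L2norm \<mu> f" (is ?norm)
proof -
  let ?I = "window_measure t" and ?F = "\<lambda>\<omega>. \<integral>s. f (X s \<omega>) \<partial>window_measure t"
  interpret I: finite_measure ?I by (rule finite_window_measure) (use t in auto)
  interpret P: pair_sigma_finite ?I law ..
  have mI: "measure ?I (space ?I) = t"
    using t emeasure_window_measure[of t] by (simp add: measure_def space_window_measure)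
  have f' [measurable]: "f \<in> borel_measurable \<mu>" by (rule L2_measurable[OF f])
  have Fm [measurable]: "?F \<in> borel_measurable law"
    by (rule integral_interval_X_measurable) (use t in auto)
  have "(\<integral>\<^sup>+\<omega>. (\<integral>\<^sup>+s. ennreal ((f (X s \<omega>))\<^sup>2) \<partial>?I) \<partial>law) = (\<integral>\<^sup>+s. (\<integral>\<^sup>+\<omega>. ennreal ((f (X s \<omega>))\<^sup>2) \<partial>law) \<partial>?I)"
    by (rule P.Fubini') measurable
  also have "\<dots> = (\<integral>\<^sup>+s. ennreal ((L2norm \<mu> f)\<^sup>2) \<partial>?I)"
  proof (rule nn_integral_cong_AE)
    have "(\<integral>\<^sup>+v. ennreal ((f v)\<^sup>2) \<partial>\<mu>) = ennreal ((L2norm \<mu> f)\<^sup>2)"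
      unfolding L2norm_power2 by (rule nn_integral_eq_integral[OF L2_integrable_power2[OF f]]) simp
    then show "AE s in ?I. (\<integral>\<^sup>+\<omega>. ennreal ((f (X s \<omega>))\<^sup>2) \<partial>law) = ennreal ((L2norm \<mu> f)\<^sup>2)"
      unfolding AE_window_measure by (auto simp: nn_integral_law_X[where h="\<lambda>v. ennreal ((f v)\<^sup>2)"])
  qed
  also have "\<dots> = ennreal (t * (L2norm \<mu> f)\<^sup>2)"
    using t emeasure_window_measure[of t]
    by (simp add: space_window_measure ennreal_mult' mult.commute)
  finally have total: "(\<integral>\<^sup>+\<omega>. (\<integral>\<^sup>+s. ennreal ((f (X s \<omega>))\<^sup>2) \<partial>?I) \<partial>law) = ennreal (t * (L2norm \<mu> f)\<^sup>2)" .
  have mm [measurable]: "(\<lambda>\<omega>. \<integral>\<^sup>+s. ennreal ((f (X s \<omega>))\<^sup>2) \<partial>?I) \<in> borel_measurable law"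
    by (rule I.borel_measurable_nn_integral) measurable
  \<comment> \<open>A finite expectation leaves almost every path with a square integrable time
    function; on the finite window this implies integrability.\<close>
  have "AE \<omega> in law. (\<integral>\<^sup>+s. ennreal ((f (X s \<omega>))\<^sup>2) \<partial>?I) \<noteq> \<infinity>"
    by (rule nn_integral_PInf_AE[OF mm]) (simp add: total)
  then have AE_L2: "AE \<omega> in law. (\<lambda>s. f (X s \<omega>)) \<in> L2 ?I \<and> ennreal ((?F \<omega>)\<^sup>2)
      \<le> ennreal t * (\<integral>\<^sup>+s. ennreal ((f (X s \<omega>))\<^sup>2) \<partial>?I)"
    using AE_space
  proof eventually_elim
    case (elim \<omega>)
    then have w: "\<omega> \<in> space N" by (simp add: space_law)
    have [measurable]: "(\<lambda>s. f (X s \<omega>)) \<in> borel_measurable borel" using w by measurable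
    have L: "(\<lambda>s. f (X s \<omega>)) \<in> L2 ?I"
      unfolding L2_def using elim(1) by (auto intro!: integrableI_bounded simp: top.not_eq_extremum)
    have "\<bar>?F \<omega>\<bar> \<le> L2norm ?I (\<lambda>s. f (X s \<omega>)) * L2norm ?I (\<lambda>_. 1)"
      using L2_Cauchy_Schwarz[OF L I.L2_const[of 1]] by simp
    then have "(?F \<omega>)\<^sup>2 \<le> (L2norm ?I (\<lambda>s. f (X s \<omega>)) * L2norm ?I (\<lambda>_. 1))\<^sup>2"
      by (metis abs_ge_zero power2_abs power_mono)
    also have "\<dots> = t * (\<integral>s. (f (X s \<omega>))\<^sup>2 \<partial>?I)"
      by (simp add: power_mult_distrib L2norm_power2 mI)
    finally have "ennreal ((?F \<omega>)\<^sup>2) \<le> ennreal t * ennreal (\<integral>s. (f (X s \<omega>))\<^sup>2 \<partial>?I)"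
      using t by (simp add: ennreal_mult'[symmetric] ennreal_leI)
    also have "ennreal (\<integral>s. (f (X s \<omega>))\<^sup>2 \<partial>?I) = (\<integral>\<^sup>+s. ennreal ((f (X s \<omega>))\<^sup>2) \<partial>?I)"
      by (rule nn_integral_eq_integral[symmetric, OF L2_integrable_power2[OF L]]) simp
    finally show ?case using L by simp
  qed
  show ?int using AE_L2 by eventually_elim (simp add: I.L2_integrable)
  have "(\<integral>\<^sup>+\<omega>. ennreal ((?F \<omega>)\<^sup>2) \<partial>law) \<le> (\<integral>\<^sup>+\<omega>. ennreal t * (\<integral>\<^sup>+s. ennreal ((f (X s \<omega>))\<^sup>2) \<partial>?I) \<partial>law)"
    by (rule nn_integral_mono_AE) (use AE_L2 in eventually_elim, auto)
  also have "\<dots> = ennreal t * ennreal (t * (L2norm \<mu> f)\<^sup>2)"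
    by (simp add: nn_integral_cmult total)
  also have "\<dots> = ennreal ((t * L2norm \<mu> f)\<^sup>2)"
    using t by (simp add: ennreal_mult'[symmetric] power2_eq_square mult_ac)
  finally have le: "(\<integral>\<^sup>+\<omega>. ennreal ((?F \<omega>)\<^sup>2) \<partial>law) \<le> ennreal ((t * L2norm \<mu> f)\<^sup>2)" .
  have iF: "integrable law (\<lambda>\<omega>. (?F \<omega>)\<^sup>2)"
  proof (rule integrableI_bounded)
    show "(\<integral>\<^sup>+\<omega>. ennreal (norm ((?F \<omega>)\<^sup>2)) \<partial>law) < \<infinity>"
      using le by (simp add: le_less_trans)
  qed measurable
  then show ?L2 by (simp add: L2_def)
  have "ennreal (\<integral>\<omega>. (?F \<omega>)\<^sup>2 \<partial>law) \<le> ennreal ((t * L2norm \<mu> f)\<^sup>2)"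
    using le nn_integral_eq_integral[OF iF] by simp
  then have "(L2norm law ?F)\<^sup>2 \<le> (t * L2norm \<mu> f)\<^sup>2"
    by (simp add: L2norm_power2)
  then show ?norm
    by (rule power2_le_imp_le) (use t in simp)
qed

lemma L2norm_integral_le:
  assumes "f \<in> L2 \<mu>"
  shows "\<bar>\<integral>v. f v \<partial>\<mu>\<bar> \<le> L2norm \<mu> f"
  using L2_Cauchy_Schwarz[OF assms L2_const[of 1]] by (simp add: L2norm_const)

lemma truncation_tendsto:
  assumes f: "f \<in> L2 \<mu>"
  shows "(\<lambda>n. L2norm \<mu> (\<lambda>v. f v - max (- real n) (min (real n) (f v)))) \<longlonglongrightarrow> 0"
proof -
  have f' [measurable]: "f \<in> borel_measurable \<mu>" by (rule L2_measurable[OF f])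
  have "(\<lambda>n. \<integral>v. (f v - max (- real n) (min (real n) (f v)))\<^sup>2 \<partial>\<mu>) \<longlonglongrightarrow> (\<integral>v. 0 \<partial>\<mu>)"
  proof (rule integral_dominated_convergence[where w="\<lambda>v. (f v)\<^sup>2"])
    show "integrable \<mu> (\<lambda>v. (f v)\<^sup>2)" by (rule L2_integrable_power2[OF f])
    show "AE v in \<mu>. (\<lambda>n. (f v - max (- real n) (min (real n) (f v)))\<^sup>2) \<longlonglongrightarrow> 0"
    proof (intro AE_I2 tendsto_eventually)
      fix v
      show "\<forall>\<^sub>F n in sequentially. (f v - max (- real n) (min (real n) (f v)))\<^sup>2 = 0"
        using eventually_ge_at_top[of "nat \<lceil>\<bar>f v\<bar>\<rceil>"]
      proof eventually_elim
        case (elim n)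
        then have "\<bar>f v\<bar> \<le> real n" by linarith
        then show ?case by (auto simp: max_def min_def)
      qed
    qed
    show "AE v in \<mu>. norm ((f v - max (- real n) (min (real n) (f v)))\<^sup>2) \<le> (f v)\<^sup>2" for n
    proof (intro AE_I2)
      fix v
      have "\<bar>f v - max (- real n) (min (real n) (f v))\<bar> \<le> \<bar>f v\<bar>"
        by (auto simp: max_def min_def)
      then show "norm ((f v - max (- real n) (min (real n) (f v)))\<^sup>2) \<le> (f v)\<^sup>2"
        by (simp add: abs_le_square_iff)
    qed
  qed measurable
  then have "(\<lambda>n. sqrt (\<integral>v. (f v - max (- real n) (min (real n) (f v)))\<^sup>2 \<partial>\<mu>)) \<longlonglongrightarrow> sqrt 0"
    by (intro tendsto_real_sqrt) simp
  then show ?thesis by (simp add: L2norm_def)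
qed

text \<open>Truncation destroys the vanishing mean, so \<open>h n\<close> is recentred by
  \<open>c n\<close>. The recentred truncation obeys the bound with decay, the remainder the crude
  one, and the remainder is of size \<open>2 * e n\<close>, which tends to 0.\<close>

lemma L2norm_time_integral:
  assumes t: "0 < t" and f: "f \<in> L2 \<mu>" and mean: "(\<integral>v. f v \<partial>\<mu>) = 0"
  shows "L2norm law (\<lambda>\<omega>. \<integral>s. f (X s \<omega>) \<partial>window_measure t)
    \<le> sqrt (t * (2 * \<kappa>1 / \<kappa>2 * (1 - exp (- t * \<kappa>2)))) * L2norm \<mu> f" (is "?l \<le> ?B * _")
proof -
  have f' [measurable]: "f \<in> borel_measurable \<mu>" by (rule L2_measurable[OF f])
  define h where "h n v = max (- real n) (min (real n) (f v))" for n v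
  define c where "c n = (\<integral>v. h n v \<partial>\<mu>)" for n
  define e where "e n = L2norm \<mu> (\<lambda>v. f v - h n v)" for n
  have B: "0 \<le> ?B" using t kappa by simp
  have hm [measurable]: "h n \<in> borel_measurable \<mu>" for n unfolding h_def by measurable
  have hb: "\<bar>h n v\<bar> \<le> real n" for n v by (auto simp: h_def)
  have hL: "h n \<in> L2 \<mu>" for n by (rule bounded_in_L2[where C="real n"]) (use hb in auto)
  have cL: "(\<lambda>v. h n v - c n) \<in> L2 \<mu>" for n by (intro L2_diff hL L2_const)
  \<comment> \<open>As \<open>f\<close> has mean zero, the mean of the truncation is minus the mean
    of the truncation error and hence is no larger than its norm.\<close>
  have "c n = - (\<integral>v. f v - h n v \<partial>\<mu>)" for n
    using L2_integrable[OF f] L2_integrable[OF hL[of n]] mean by (simp add: c_def)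
  then have ce: "\<bar>c n\<bar> \<le> e n" for n
    using L2norm_integral_le[OF L2_diff[OF f hL[of n]]] by (simp add: e_def)
  have d: "L2norm \<mu> (\<lambda>v. f v - (h n v - c n)) \<le> 2 * e n" for n
  proof -
    have "L2norm \<mu> (\<lambda>v. f v - (h n v - c n)) = L2norm \<mu> (\<lambda>v. (f v - h n v) + c n)"
      by (simp add: algebra_simps)
    also have "\<dots> \<le> e n + \<bar>c n\<bar>"
      using L2norm_triangle[OF L2_diff[OF f hL[of n]] L2_const[of "c n"]] by (simp add: e_def L2norm_const)
    finally show ?thesis using ce[of n] by simp
  qed
  have "?l \<le> ?B * (L2norm \<mu> f + 2 * e n) + t * (2 * e n)" for n
  proof -
    have dL: "(\<lambda>v. f v - (h n v - c n)) \<in> L2 \<mu>" by (intro L2_diff f cL)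
    note A = L2_time_integral[OF t cL[of n]] and D = L2_time_integral[OF t dL]
    have "?l = L2norm law (\<lambda>\<omega>. (\<integral>s. h n (X s \<omega>) - c n \<partial>window_measure t) + (\<integral>s. f (X s \<omega>) - (h n (X s \<omega>)
        - c n) \<partial>window_measure t))"
    proof (rule L2norm_cong_AE)
      show "AE \<omega> in law. (\<integral>s. f (X s \<omega>) \<partial>window_measure t) =
          (\<integral>s. h n (X s \<omega>) - c n \<partial>window_measure t) + (\<integral>s. f (X s \<omega>) - (h n (X s \<omega>)
              - c n) \<partial>window_measure t)"
        using A(1) D(1)
      proof eventually_elim
        case (elim \<omega>)
        show ?case using Bochner_Integration.integral_add[OF elim] by simp
      qed
    qed (use L2_measurable[OF A(2)] L2_measurable[OF D(2)] L2_measurable[OF L2_time_integral(2)[OF t f]]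
        in measurable)
    also have "\<dots> \<le> L2norm law (\<lambda>\<omega>. \<integral>s. h n (X s \<omega>) - c n \<partial>window_measure t)
        + L2norm law (\<lambda>\<omega>. \<integral>s. f (X s \<omega>) - (h n (X s \<omega>) - c n) \<partial>window_measure t)"
      by (rule L2norm_triangle[OF A(2) D(2)])
    also have "\<dots> \<le> ?B * L2norm \<mu> (\<lambda>v. h n v - c n) + t * (2 * e n)"
    proof (rule add_mono)
      show "L2norm law (\<lambda>\<omega>. \<integral>s. h n (X s \<omega>) - c n \<partial>window_measure t) \<le> ?B * L2norm \<mu> (\<lambda>v. h n v - c n)"
      proof (rule L2norm_time_integral_bounded[OF t, where C="real n + \<bar>c n\<bar>"])
        show "\<bar>h n v - c n\<bar> \<le> real n + \<bar>c n\<bar>" for v using hb[of n v] by linarith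
        show "(\<integral>v. h n v - c n \<partial>\<mu>) = 0"
          using L2_integrable[OF hL[of n]] by (simp add: c_def prob_space)
      qed measurable
      show "L2norm law (\<lambda>\<omega>. \<integral>s. f (X s \<omega>) - (h n (X s \<omega>) - c n) \<partial>window_measure t) \<le> t * (2 * e n)"
        using D(3) mult_left_mono[OF d[of n], of t] t by linarith
    qed
    also have "L2norm \<mu> (\<lambda>v. h n v - c n) = L2norm \<mu> (\<lambda>v. f v + (-1) * (f v - (h n v - c n)))"
      by simp
    also have "\<dots> \<le> L2norm \<mu> f + 2 * e n"
      using L2norm_triangle[OF f L2_scale[OF dL, of "-1"]] d[of n]
      unfolding L2norm_scale by simp
    finally show ?thesis using B by (simp add: mult_left_mono)
  qed
  moreover have "(\<lambda>n. ?B * (L2norm \<mu> f + 2 * e n) + t * (2 * e n)) \<longlonglongrightarrow> ?B * (L2norm \<mu> f + 2 * 0)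
      + t * (2 * 0)"
    using truncation_tendsto[OF f] unfolding e_def h_def by (intro tendsto_intros)
  ultimately have "?l \<le> ?B * (L2norm \<mu> f + 2 * 0) + t * (2 * 0)"
    by (intro LIMSEQ_le_const[of _ "?B * (L2norm \<mu> f + 2 * 0) + t * (2 * 0)"]) auto
  then show ?thesis by simp
qed

text \<open>The mean is moved under the time integral, where the window turns \<open>c\<close> into
  \<open>t * c\<close>; the estimate for centred functions then yields
  \<open>sqrt (t * E) / t\<close>, which is \<open>sqrt E / sqrt t\<close>.\<close>

theorem time_average_estimate:
  assumes t: "0 < t" and f: "f \<in> L2 \<mu>"
  shows "AE \<omega> in law. set_integrable lborel {0..<t} (\<lambda>s. f (X s \<omega>))" (is ?int)
    and "(\<lambda>\<omega>. 1 / t * (LINT s:{0..<t}|lborel. f (X s \<omega>)) - (\<integral>v. f v \<partial>\<mu>)) \<in> L2 law" (is ?L2)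
    and "L2norm law (\<lambda>\<omega>. 1 / t * (LINT s:{0..<t}|lborel. f (X s \<omega>)) - (\<integral>v. f v \<partial>\<mu>))
      \<le> 2 / sqrt t * sqrt (2 * \<kappa>1 / \<kappa>2 * (1 - exp (- t * \<kappa>2))) * L2norm \<mu> (\<lambda>v. f v
          - (\<integral>v. f v \<partial>\<mu>))" (is ?norm)
proof -
  let ?I = "window_measure t"
  define c where "c = (\<integral>v. f v \<partial>\<mu>)"
  define E where "E = 2 * \<kappa>1 / \<kappa>2 * (1 - exp (- t * \<kappa>2))"
  have E: "0 \<le> E" using t kappa by (simp add: E_def)
  interpret I: finite_measure ?I by (rule finite_window_measure) (use t in auto)
  have mI: "measure ?I (space ?I) = t"
    using t emeasure_window_measure[of t] by (simp add: measure_def space_window_measure)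
  have f' [measurable]: "f \<in> borel_measurable \<mu>" by (rule L2_measurable[OF f])
  have path [measurable]: "(\<lambda>s. f (X s \<omega>)) \<in> borel_measurable borel" if "\<omega> \<in> space N" for \<omega>
    using that by measurable
  have conv: "(LINT s:{0..<t}|lborel. f (X s \<omega>)) = (\<integral>s. f (X s \<omega>) \<partial>?I)" if "\<omega> \<in> space law" for \<omega>
    using that by (intro integral_window_measure[symmetric] path) (simp add: space_law)
  show ?int
    using L2_time_integral(1)[OF t f] AE_space
    by eventually_elim (simp add: integrable_window_measure path space_law)
  have "(\<lambda>\<omega>. 1 / t * (\<integral>s. f (X s \<omega>) \<partial>?I) - c) \<in> L2 law"
    by (intro L2_diff L2_scale L2_time_integral t f law.L2_const)
  also have "?this \<longleftrightarrow> (\<lambda>\<omega>. 1 / t * (LINT s:{0..<t}|lborel. f (X s \<omega>)) - c) \<in> L2 law"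
    unfolding L2_def
    by (auto simp: conv cong: measurable_cong Bochner_Integration.integrable_cong)
  finally have L2': "(\<lambda>\<omega>. 1 / t * (LINT s:{0..<t}|lborel. f (X s \<omega>)) - c) \<in> L2 law" .
  then show ?L2 by (simp add: c_def)
  have L0: "(\<lambda>v. f v - c) \<in> L2 \<mu>" by (intro L2_diff f L2_const)
  have "L2norm law (\<lambda>\<omega>. 1 / t * (LINT s:{0..<t}|lborel. f (X s \<omega>)) - c) =
      L2norm law (\<lambda>\<omega>. 1 / t * (\<integral>s. f (X s \<omega>) - c \<partial>?I))"
  proof (rule L2norm_cong_AE)
    show "AE \<omega> in law. 1 / t * (LINT s:{0..<t}|lborel. f (X s \<omega>)) - c = 1 / t * (\<integral>s. f (X s \<omega>) - c \<partial>?I)"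
      using L2_time_integral(1)[OF t f] AE_space
      by eventually_elim (use t in \<open>simp add: conv mI field_simps\<close>)
  qed (use L2_measurable[OF L2'] L2_measurable[OF L2_time_integral(2)[OF t L0]] in measurable)
  also have "\<dots> = 1 / t * L2norm law (\<lambda>\<omega>. \<integral>s. f (X s \<omega>) - c \<partial>?I)"
    unfolding L2norm_scale using t by simp
  also have "\<dots> \<le> 1 / t * (sqrt (t * E) * L2norm \<mu> (\<lambda>v. f v - c))"
    unfolding E_def
    by (intro mult_left_mono L2norm_time_integral[OF t L0])
      (use t L2_integrable[OF f] in \<open>auto simp: c_def prob_space\<close>)
  also have "\<dots> = 1 / sqrt t * sqrt E * L2norm \<mu> (\<lambda>v. f v - c)"
    using t by (simp add: real_sqrt_mult field_simps real_div_sqrt)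
  \<comment> \<open>The preceding line is already half the stated bound; the factor 2 is introduced
    only here.\<close>
  also have "\<dots> \<le> 2 / sqrt t * sqrt E * L2norm \<mu> (\<lambda>v. f v - c)"
    using t E by (intro mult_right_mono divide_right_mono) auto
  finally show ?norm by (simp add: c_def E_def)
qed

end

section \<open>Measurability of processes with continuous paths\<close>

text \<open>The closed sets between \<open>B k\<close> and \<open>U\<close> catch limits: a sequence
  that is eventually in \<open>B k\<close> can only converge to points of \<open>C k\<close>, hence
  of \<open>U\<close>. In this form the property passes to subspaces and can be verified in
  charts.\<close>

definition countably_regular :: "'q topology \<Rightarrow> bool" where
  "countably_regular Q \<longleftrightarrow> (\<forall>U. openin Q U \<longrightarrow>
     (\<exists>B C. (\<forall>k::nat. openin Q (B k) \<and> closedin Q (C k) \<and> B k \<subseteq> C k \<and> C k \<subseteq> U) \<and> U = (\<Union>k. B k)))"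

lemma space_borel_sets_of [simp]: "space (borel_sets_of Q) = topspace Q"
  by (simp add: borel_sets_of_def openin_subset subset_iff space_measure_of_conv)

lemma sets_borel_sets_of: "sets (borel_sets_of Q) = sigma_sets (topspace Q) {U. openin Q U}"
  unfolding borel_sets_of_def by (rule sets_measure_of) (auto dest: openin_subset)

lemma borel_sets_of_open: "openin Q U \<Longrightarrow> U \<in> sets (borel_sets_of Q)"
  by (auto simp: sets_borel_sets_of)

lemma nat_ceiling_div_tendsto:
  assumes "0 \<le> (s::real)"
  shows "(\<lambda>n. real (nat \<lceil>real (Suc n) * s\<rceil>) / real (Suc n)) \<longlonglongrightarrow> s"
proof (rule tendsto_sandwich)
  show "\<forall>\<^sub>F n in sequentially. s \<le> real (nat \<lceil>real (Suc n) * s\<rceil>) / real (Suc n)"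
  proof (intro always_eventually allI)
    fix n
    have "real (Suc n) * s \<le> real (nat \<lceil>real (Suc n) * s\<rceil>)" by linarith
    then show "s \<le> real (nat \<lceil>real (Suc n) * s\<rceil>) / real (Suc n)"
      by (simp add: field_simps)
  qed
  show "\<forall>\<^sub>F n in sequentially. real (nat \<lceil>real (Suc n) * s\<rceil>) / real (Suc n) \<le> s + 1 / real (Suc n)"
  proof (intro always_eventually allI)
    fix n
    have "0 \<le> real (Suc n) * s" using assms by simp
    then have "real (nat \<lceil>real (Suc n) * s\<rceil>) \<le> real (Suc n) * s + 1" by linarith
    then have "real (nat \<lceil>real (Suc n) * s\<rceil>) / real (Suc n) \<le> (real (Suc n) * s + 1) / real (Suc n)"
      by (rule divide_right_mono) simp
    then show "real (nat \<lceil>real (Suc n) * s\<rceil>) / real (Suc n) \<le> s + 1 / real (Suc n)"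
      by (simp add: add_divide_distrib)
  qed
  have "(\<lambda>n. s + 1 / real (Suc n)) \<longlonglongrightarrow> s + 0"
    by (intro tendsto_intros LIMSEQ_Suc lim_1_over_n)
  then show "(\<lambda>n. s + 1 / real (Suc n)) \<longlonglongrightarrow> s" by simp
qed simp

text \<open>The process is approximated by its values at the times \<open>j / n\<close>; countable regularity of the
  state space takes the place of metrisability.\<close>

lemma continuous_paths_jointly_measurable:
  fixes \<eta> :: "real \<Rightarrow> 'w \<Rightarrow> 'q"
  assumes reg: "countably_regular Q"
    and \<eta> [measurable]: "\<And>s. 0 \<le> s \<Longrightarrow> \<eta> s \<in> N \<rightarrow>\<^sub>M borel_sets_of Q"
    and path: "\<And>\<omega>. \<omega> \<in> space N \<Longrightarrow> continuous_map (top_of_set {0..}) Q (\<lambda>t. \<eta> t \<omega>)"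
  shows "(\<lambda>(s, \<omega>). \<eta> (max 0 s) \<omega>) \<in> borel \<Otimes>\<^sub>M N \<rightarrow>\<^sub>M borel_sets_of Q"
proof -
  \<comment> \<open>Times are rounded up to a grid of mesh \<open>1 / Suc n\<close>, which is
    defined also for \<open>n = 0\<close>; clamping by \<open>max 0\<close> confines them to the
    half-line on which paths are continuous.\<close>
  define j where "j n s = nat \<lceil>real (Suc n) * max 0 s\<rceil>" for n and s :: real
  define \<tau> where "\<tau> n s = real (j n s) / real (Suc n)" for n and s :: real
  define Y where "Y n x = \<eta> (\<tau> n (fst x)) (snd x)" for n and x :: "real \<times> 'w"
  have \<tau>: "(\<lambda>n. \<tau> n s) \<longlonglongrightarrow> max 0 s" for s
    unfolding \<tau>_def j_def by (rule nat_ceiling_div_tendsto) simp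
  have \<tau>0: "0 \<le> \<tau> n s" for n s by (simp add: \<tau>_def)
  have Ym [measurable]: "Y n \<in> borel \<Otimes>\<^sub>M N \<rightarrow>\<^sub>M borel_sets_of Q" for n
  proof -
    have "(\<lambda>x. \<eta> (real (j n (fst x)) / real (Suc n)) (snd x)) \<in> borel \<Otimes>\<^sub>M N \<rightarrow>\<^sub>M borel_sets_of Q"
    proof (rule measurable_compose_countable[where f="\<lambda>i x. \<eta> (real i / real (Suc n)) (snd x)"])
      show "(\<lambda>x. \<eta> (real i / real (Suc n)) (snd x)) \<in> borel \<Otimes>\<^sub>M N \<rightarrow>\<^sub>M borel_sets_of Q" for i
        by (rule measurable_compose[OF measurable_snd \<eta>]) simp
      show "(\<lambda>x. j n (fst x)) \<in> borel \<Otimes>\<^sub>M N \<rightarrow>\<^sub>M count_space UNIV"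
        unfolding j_def by measurable
    qed
    then show ?thesis by (simp add: Y_def[abs_def] \<tau>_def)
  qed
  have conv: "\<forall>\<^sub>F n in sequentially. \<eta> (\<tau> n s) \<omega> \<in> V"
    if w: "\<omega> \<in> space N" and V: "openin Q V" "\<eta> (max 0 s) \<omega> \<in> V" for V s \<omega>
  proof -
    have "openin (top_of_set {0..}) {t \<in> {0..}. \<eta> t \<omega> \<in> V}"
      using openin_continuous_map_preimage[OF path[OF w] V(1)] by simp
    then obtain W where W: "open W" "{t \<in> {0..}. \<eta> t \<omega> \<in> V} = {0..} \<inter> W"
      unfolding openin_open by (elim exE conjE)
    have W_iff: "u \<in> W \<longleftrightarrow> \<eta> u \<omega> \<in> V" if "0 \<le> u" for u
      using W(2) that unfolding set_eq_iff by auto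
    have "max 0 s \<in> W" using V(2) W_iff by simp
    then have "\<forall>\<^sub>F n in sequentially. \<tau> n s \<in> W" using \<tau> W(1) by (metis topological_tendstoD)
    then show ?thesis
      by eventually_elim (simp add: W_iff \<tau>0)
  qed
  show ?thesis
    unfolding borel_sets_of_def
  proof (rule measurable_measure_of)
    show "{U. openin Q U} \<subseteq> Pow (topspace Q)" by (auto dest: openin_subset)
    show "(\<lambda>(s, \<omega>). \<eta> (max 0 s) \<omega>) \<in> space (borel \<Otimes>\<^sub>M N) \<rightarrow> topspace Q"
      using measurable_space[OF \<eta>] by (fastforce simp: space_pair_measure)
    fix U assume "U \<in> {U. openin Q U}"
    then obtain B C where BC: "\<And>k::nat. openin Q (B k)" "\<And>k. closedin Q (C k)" "\<And>k. B k \<subseteq> C k"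
        "\<And>k. C k \<subseteq> U" "U = (\<Union>k. B k)"
      using reg unfolding countably_regular_def by (metis mem_Collect_eq)
    \<comment> \<open>A point of \<open>U\<close> lies in some open \<open>B k\<close>, so the
      approximants are eventually there; conversely approximants that are eventually in
      \<open>B k\<close> force the limit into the closed \<open>C k\<close>, as otherwise they would
      eventually lie in its open complement.\<close>
    have "(\<lambda>(s, \<omega>). \<eta> (max 0 s) \<omega>) -` U \<inter> space (borel \<Otimes>\<^sub>M N) =
        (\<Union>k. \<Union>m. \<Inter>n\<in>{m..}. Y n -` B k \<inter> space (borel \<Otimes>\<^sub>M N))" (is "?L = ?R")
    proof (rule set_eqI)
      fix x :: "real \<times> 'w"
      obtain s \<omega> where x: "x = (s, \<omega>)" by fastforce
      show "x \<in> ?L \<longleftrightarrow> x \<in> ?R"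
      proof
        assume "x \<in> ?L"
        then have w: "\<omega> \<in> space N" and U: "\<eta> (max 0 s) \<omega> \<in> U" by (auto simp: x space_pair_measure)
        obtain k where k: "\<eta> (max 0 s) \<omega> \<in> B k" using U BC(5) by auto
        obtain m where "\<And>n. m \<le> n \<Longrightarrow> \<eta> (\<tau> n s) \<omega> \<in> B k"
          using conv[OF w BC(1) k] by (auto simp: eventually_sequentially)
        then show "x \<in> ?R" using w by (auto simp: x Y_def space_pair_measure)
      next
        assume "x \<in> ?R"
        then obtain k m where m: "\<And>n. m \<le> n \<Longrightarrow> \<eta> (\<tau> n s) \<omega> \<in> B k" and w: "\<omega> \<in> space N"
          by (fastforce simp: x Y_def space_pair_measure)
        have "\<eta> (max 0 s) \<omega> \<in> C k"
        proof (rule ccontr)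
          assume "\<eta> (max 0 s) \<omega> \<notin> C k"
          moreover have "\<eta> (max 0 s) \<omega> \<in> topspace Q"
            using measurable_space[OF \<eta> w, of "max 0 s"] by simp
          ultimately have "\<forall>\<^sub>F n in sequentially. \<eta> (\<tau> n s) \<omega> \<in> topspace Q - C k"
            using BC(2)[of k] by (intro conv[OF w]) (auto simp: closedin_def)
          then obtain m' where "\<And>n. m' \<le> n \<Longrightarrow> \<eta> (\<tau> n s) \<omega> \<notin> C k"
            by (auto simp: eventually_sequentially)
          then show False using m[of "max m m'"] BC(3)[of k]
              by (meson max.cobounded1 max.cobounded2 subsetD)
        qed
        then show "x \<in> ?L" using BC(4) w by (auto simp: x space_pair_measure)
      qed
    qed
    also have "\<dots> \<in> sets (borel \<Otimes>\<^sub>M N)"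
      by (intro sets.countable_UN sets.countable_INT' image_subsetI measurable_sets[OF Ym]
          borel_sets_of_open BC)
        auto
    finally show "(\<lambda>(s, \<omega>). \<eta> (max 0 s) \<omega>) -` U \<inter> space (borel \<Otimes>\<^sub>M N) \<in> sets (borel \<Otimes>\<^sub>M N)" .
  qed
qed

section \<open>Hunt processes\<close>

text \<open>Instantiates the abstract setting after coarsening the sample space to the events
  generated by the process, on which the family of laws is a Borel kernel, and transports the result
  back along the identity map.\<close>

lemma hunt_time_average_estimate:
  fixes f :: "'q \<Rightarrow> real" and \<AA> :: "'w measure"
  assumes prob: "prob_space \<mu>" and sets_\<mu>: "sets \<mu> = sets (borel_sets_of Q)"
    and reg: "countably_regular Q"
    and semigroup: "contraction_semigroup \<mu> T"
    and kappa: "0 < \<kappa>1" "0 < \<kappa>2"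
    and hypocoercive: "\<And>h s. h \<in> L2 \<mu> \<Longrightarrow> 0 \<le> s \<Longrightarrow>
          L2norm \<mu> (\<lambda>v. T s h v - L2_inner \<mu> h (\<lambda>_. 1))
            \<le> \<kappa>1 * exp (- \<kappa>2 * s) * L2norm \<mu> (\<lambda>v. h v - L2_inner \<mu> h (\<lambda>_. 1))"
    and hunt: "hunt_process Q \<AA> F \<eta> P"
    and assoc: "properly_associated Q \<mu> T \<eta> P"
    and f: "f \<in> L2 \<mu>" and t: "0 < t"
  shows "(AE \<omega> in initial_law \<AA> \<mu> P. set_integrable lborel {0..<t} (\<lambda>s. f (\<eta> s \<omega>))) \<and>
         (\<lambda>\<omega>. 1 / t * (LINT s:{0..<t}|lborel. f (\<eta> s \<omega>)) - (\<integral>v. f v \<partial>\<mu>)) \<in> L2 (initial_law \<AA> \<mu> P) \<and>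
         L2norm (initial_law \<AA> \<mu> P)
             (\<lambda>\<omega>. 1 / t * (LINT s:{0..<t}|lborel. f (\<eta> s \<omega>)) - (\<integral>v. f v \<partial>\<mu>))
           \<le> 2 / sqrt t * sqrt (2 * \<kappa>1 / \<kappa>2 * (1 - exp (- t * \<kappa>2)))
              * L2norm \<mu> (\<lambda>v. f v - (\<integral>v. f v \<partial>\<mu>))"
proof -
  interpret \<mu>: prob_space \<mu> by fact
  have space_\<mu>: "space \<mu> = topspace Q"
    using sets_eq_imp_space_eq[OF sets_\<mu>] by simp
  have filt: "filtration (space \<AA>) (extend_filtration \<AA> F)"
    and adapted: "\<And>s. 0 \<le> s \<Longrightarrow> \<eta> s \<in> F s \<rightarrow>\<^sub>M borel_sets_of Q"
    and path: "\<And>\<omega>. \<omega> \<in> space \<AA> \<Longrightarrow> continuous_map (top_of_set {0..}) Q (\<lambda>t. \<eta> t \<omega>)"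
    and P_prob: "\<And>v. v \<in> topspace Q \<Longrightarrow> prob_space (P v)"
    and P_sets: "\<And>v. v \<in> topspace Q \<Longrightarrow> sets (P v) = sets \<AA>"
    and P_borel: "\<And>B. B \<in> process_events Q \<AA> \<eta> \<Longrightarrow> (\<lambda>v. emeasure (P v) B)
        \<in> borel_measurable (borel_sets_of Q)"
    and P_univ: "\<And>B \<rho>. B \<in> sets \<AA> \<Longrightarrow> prob_space \<rho> \<Longrightarrow> sets \<rho> = sets (borel_sets_of Q) \<Longrightarrow>
        (\<lambda>v. emeasure (P v) B) \<in> borel_measurable (completion \<rho>)"
    and markov: "\<And>v s r B C. v \<in> topspace Q \<Longrightarrow> 0 \<le> s \<Longrightarrow> 0 \<le> r \<Longrightarrow> B \<in> sets (F s) \<Longrightarrow>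
        C \<in> sets (borel_sets_of Q) \<Longrightarrow>
        emeasure (P v) {\<omega> \<in> B. \<eta> (s + r) \<omega> \<in> C} =
        (\<integral>\<^sup>+\<omega>\<in>B. emeasure (P (\<eta> s \<omega>)) {\<omega>' \<in> space \<AA>. \<eta> r \<omega>' \<in> C} \<partial>P v)"
    using hunt unfolding hunt_process_def Let_def by blast+
  have ext_F: "extend_filtration \<AA> F (ennreal s) = F s" if "0 \<le> s" for s
    using that by (simp add: extend_filtration_def)
  have ext_top: "extend_filtration \<AA> F \<top> = \<AA>"
    by (simp add: extend_filtration_def)
  have space_F: "space (F s) = space \<AA>" if "0 \<le> s" for s
    using filtration.space_F[OF filt, of "ennreal s"] ext_F[OF that] by simp
  have sets_F: "sets (F s) \<subseteq> sets \<AA>" if "0 \<le> s" for s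
    using filtration.sets_F_mono[OF filt, of "ennreal s" \<top>] ext_F[OF that] ext_top by simp
  \<comment> \<open>For these events \<open>hunt_process\<close> grants Borel measurability in the
    starting point, which is what \<open>prob_algebra\<close> demands of a kernel.\<close>
  define N where "N = sigma (space \<AA>) {\<eta> s -` C \<inter> space \<AA> | s C. 0 \<le> s \<and> C \<in> sets (borel_sets_of Q)}"
  have gen_sub: "{\<eta> s -` C \<inter> space \<AA> | s C. 0 \<le> s \<and> C \<in> sets (borel_sets_of Q)} \<subseteq> Pow (space \<AA>)" by auto
  have sets_N: "sets N = process_events Q \<AA> \<eta>"
    unfolding N_def process_events_def by (rule sets_measure_of[OF gen_sub])
  have space_N: "space N = space \<AA>"
    unfolding N_def by (rule space_measure_of[OF gen_sub])
  have NA: "sets N \<subseteq> sets \<AA>"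
    unfolding sets_N process_events_def
  proof (rule sets.sigma_sets_subset, safe)
    fix s :: real and C assume "0 \<le> s" "C \<in> sets (borel_sets_of Q)"
    then show "\<eta> s -` C \<inter> space \<AA> \<in> sets \<AA>"
      using measurable_sets[OF adapted] space_F sets_F by fastforce
  qed
  have \<eta>N: "\<eta> s \<in> N \<rightarrow>\<^sub>M borel_sets_of Q" if "0 \<le> s" for s
  proof (rule measurableI)
    show "\<eta> s \<omega> \<in> space (borel_sets_of Q)" if "\<omega> \<in> space N" for \<omega>
      using measurable_space[OF adapted[OF \<open>0 \<le> s\<close>], of \<omega>] that space_F[OF \<open>0 \<le> s\<close>] by (simp add: space_N)
    show "\<eta> s -` C \<inter> space N \<in> sets N" if "C \<in> sets (borel_sets_of Q)" for C
      unfolding sets_N process_events_def space_N using that \<open>0 \<le> s\<close> by blast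
  qed
  have idN: "(\<lambda>\<omega>. \<omega>) \<in> M \<rightarrow>\<^sub>M N" if "sets M = sets \<AA>" for M
    using NA that sets_eq_imp_space_eq[OF that] sets.sets_into_space
    by (intro measurableI) (auto simp: space_N Int_absorb2)
  \<comment> \<open>Negative times are sent to 0, because \<open>\<eta>\<close> is specified on
    nonnegative times whereas the abstract process is indexed by the whole line. \<open>K v\<close>
    below is \<open>P v\<close> restricted to the coarser sigma-algebra.\<close>
  define X where "X s = \<eta> (max 0 s)" for s :: real
  define K where "K v = distr (P v) N (\<lambda>\<omega>. \<omega>)" for v
  have emK: "emeasure (K v) B = emeasure (P v) B" if "v \<in> topspace Q" "B \<in> sets N" for v B
    unfolding K_def using that NA P_sets[OF that(1)] sets_eq_imp_space_eq[OF P_sets[OF that(1)]]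
    by (subst emeasure_distr[OF idN]) (auto simp: Int_absorb2 dest: sets.sets_into_space)
  have nnK: "(\<integral>\<^sup>+\<omega>. G \<omega> \<partial>K v) = (\<integral>\<^sup>+\<omega>. G \<omega> \<partial>P v)"
    if "v \<in> topspace Q" "G \<in> borel_measurable N" for v and G :: "'w \<Rightarrow> ennreal"
    unfolding K_def by (rule nn_integral_distr[OF idN]) (use that P_sets in auto)
  have K_meas: "K \<in> \<mu> \<rightarrow>\<^sub>M prob_algebra N"
  proof (rule measurable_prob_algebraI)
    show pK: "prob_space (K v)" if "v \<in> space \<mu>" for v
      unfolding K_def using that P_prob P_sets space_\<mu>
      by (intro prob_space.prob_space_distr idN) auto
    show "K \<in> \<mu> \<rightarrow>\<^sub>M subprob_algebra N"
    proof (rule measurable_subprob_algebra)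
      show "subprob_space (K v)" if "v \<in> space \<mu>" for v
        using pK[OF that] by (rule prob_space_imp_subprob_space)
      show "sets (K v) = sets N" for v by (simp add: K_def)
      fix B assume B: "B \<in> sets N"
      have "(\<lambda>v. emeasure (P v) B) \<in> borel_measurable \<mu>"
        using P_borel B by (simp add: sets_N measurable_cong_sets[OF sets_\<mu> refl])
      then show "(\<lambda>v. emeasure (K v) B) \<in> borel_measurable \<mu>"
        by (rule measurable_cong[THEN iffD1, rotated]) (simp add: emK B space_\<mu>)
    qed
  qed
  have X_meas: "(\<lambda>(s, \<omega>). X s \<omega>) \<in> borel \<Otimes>\<^sub>M N \<rightarrow>\<^sub>M \<mu>"
    using continuous_paths_jointly_measurable[OF reg \<eta>N path]
    by (simp add: space_N X_def measurable_cong_sets[OF refl sets_\<mu>])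
  have f': "f \<in> borel_measurable \<mu>" by (rule L2_measurable[OF f])
  have X_s: "X s \<in> N \<rightarrow>\<^sub>M \<mu>" for s
    unfolding X_def using \<eta>N[of "max 0 s"] by (simp add: measurable_cong_sets[OF refl sets_\<mu>])
  interpret L2_Markov_process \<mu> N K X T \<kappa>1 \<kappa>2
  proof
    show "K \<in> \<mu> \<rightarrow>\<^sub>M prob_algebra N" by (rule K_meas)
    show "(\<lambda>(s, \<omega>). X s \<omega>) \<in> borel \<Otimes>\<^sub>M N \<rightarrow>\<^sub>M \<mu>" by (rule X_meas)
    show "contraction_semigroup \<mu> T" "0 < \<kappa>1" "0 < \<kappa>2" by fact+
    show "L2norm \<mu> (\<lambda>v. T s h v - L2_inner \<mu> h (\<lambda>_. 1))
            \<le> \<kappa>1 * exp (- \<kappa>2 * s) * L2norm \<mu> (\<lambda>v. h v - L2_inner \<mu> h (\<lambda>_. 1))"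
      if "h \<in> L2 \<mu>" "0 \<le> s" for h s using that by (rule hypocoercive)
  next
    fix v and s r :: real and C C'
    assume v: "v \<in> space \<mu>" and s: "0 \<le> s" and r: "(0::real) \<le> r" and C: "C \<in> sets \<mu>" "C' \<in> sets \<mu>"
    have Xs: "X s = \<eta> s" "X r = \<eta> r" "X (s + r) = \<eta> (s + r)" using s r by (auto simp: X_def)
    have B: "{\<omega> \<in> space \<AA>. \<eta> s \<omega> \<in> C} \<in> sets (F s)"
      using measurable_sets[OF adapted[OF s], of C] C(1) space_F[OF s] sets_\<mu>
      by (simp add: vimage_def Int_def conj_commute)
    have E: "{\<omega> \<in> space N. X s \<omega> \<in> C \<and> X (s + r) \<omega> \<in> C'} \<in> sets N"
      using X_s C by measurable
    have E': "{\<omega>' \<in> space N. X r \<omega>' \<in> C'} \<in> sets N"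
      using X_s C by measurable
    have G: "(\<lambda>v. emeasure (K v) {\<omega>' \<in> space N. X r \<omega>' \<in> C'}) \<in> borel_measurable \<mu>"
      using measurable_prob_algebraD[OF K_meas] E' by measurable
    have "emeasure (K v) {\<omega> \<in> space N. X s \<omega> \<in> C \<and> X (s + r) \<omega> \<in> C'} =
        emeasure (P v) {\<omega> \<in> {\<omega> \<in> space \<AA>. \<eta> s \<omega> \<in> C}. \<eta> (s + r) \<omega> \<in> C'}"
      using v by (subst emK[OF _ E]) (auto simp: space_\<mu> space_N Xs intro!: arg_cong[where f="emeasure
          (P v)"])
    also have "\<dots> = (\<integral>\<^sup>+\<omega>\<in>{\<omega> \<in> space \<AA>. \<eta> s \<omega> \<in> C}. emeasure (P (\<eta> s \<omega>)) {\<omega>' \<in> space \<AA>. \<eta> r \<omega>' \<in> C'} \<partial>P v)"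
      using v C by (intro markov s r B) (auto simp: space_\<mu> sets_\<mu>)
    also have "\<dots> = (\<integral>\<^sup>+\<omega>. indicator C (X s \<omega>) * emeasure (K (X s \<omega>)) {\<omega>' \<in> space N. X r \<omega>' \<in> C'} \<partial>P v)"
    proof (rule nn_integral_cong)
      fix \<omega> assume "\<omega> \<in> space (P v)"
      then have w: "\<omega> \<in> space N" using v P_sets[THEN sets_eq_imp_space_eq] by (simp add: space_\<mu> space_N)
      have "\<eta> s \<omega> \<in> topspace Q" using measurable_space[OF X_s w, of s] by (simp add: space_\<mu> Xs)
      then show "emeasure (P (\<eta> s \<omega>)) {\<omega>' \<in> space \<AA>. \<eta> r \<omega>' \<in> C'} * indicator {\<omega> \<in> space \<AA>. \<eta> s \<omega> \<in> C} \<omega> =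
          indicator C (X s \<omega>) * emeasure (K (X s \<omega>)) {\<omega>' \<in> space N. X r \<omega>' \<in> C'}"
        using w by (subst emK[OF _ E']) (auto simp: Xs space_N split: split_indicator)
    qed
    also have "\<dots> = (\<integral>\<^sup>+\<omega>. indicator C (X s \<omega>) * emeasure (K (X s \<omega>)) {\<omega>' \<in> space N. X r \<omega>' \<in> C'} \<partial>K v)"
      using v C
      by (intro nnK[symmetric] borel_measurable_times_ennreal measurable_compose[OF X_s G]
          measurable_compose[OF X_s borel_measurable_indicator]) (auto simp: space_\<mu>)
    finally show "emeasure (K v) {\<omega> \<in> space N. X s \<omega> \<in> C \<and> X (s + r) \<omega> \<in> C'} =
        (\<integral>\<^sup>+\<omega>. indicator C (X s \<omega>) * emeasure (K (X s \<omega>)) {\<omega>' \<in> space N. X r \<omega>' \<in> C'} \<partial>K v)" .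
  next
    fix h :: "'q \<Rightarrow> real" and a :: real assume h: "h \<in> L2 \<mu>" and a: "0 < a"
    obtain k where k: "is_resolvent \<mu> T a h k" "AE v in \<mu>. process_resolvent \<eta> P a h v = k v"
      using assoc h a unfolding properly_associated_def by blast
    have R: "process_resolvent X K a h v = process_resolvent \<eta> P a h v" if v: "v \<in> space \<mu>" for v
      unfolding process_resolvent_def
    proof (rule set_lebesgue_integral_cong)
      show "\<forall>s. s \<in> {0<..} \<longrightarrow> exp (- a * s) * (\<integral>\<omega>. h (X s \<omega>) \<partial>K v) = exp (- a * s) * (\<integral>\<omega>. h (\<eta> s \<omega>) \<partial>P v)"
      proof (intro allI impI)
        fix s :: real assume "s \<in> {0<..}"
        then have "X s = \<eta> s" by (simp add: X_def)
        moreover have "(\<integral>\<omega>. h (X s \<omega>) \<partial>K v) = (\<integral>\<omega>. h (X s \<omega>) \<partial>P v)"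
          unfolding K_def using v P_sets
          by (intro integral_distr idN measurable_compose[OF X_s L2_measurable[OF h]]) (auto simp: space_\<mu>)
        ultimately show "exp (- a * s) * (\<integral>\<omega>. h (X s \<omega>) \<partial>K v) = exp (- a * s) * (\<integral>\<omega>. h (\<eta> s \<omega>) \<partial>P v)"
          by simp
      qed
    qed simp
    have "AE v in \<mu>. process_resolvent X K a h v = k v"
      using k(2) AE_space by eventually_elim (simp add: R)
    with k(1) show "\<exists>k. is_resolvent \<mu> T a h k \<and> (AE v in \<mu>. process_resolvent X K a h v = k v)" by blast
  qed
  let ?IL = "initial_law \<AA> \<mu> P"
  have sets_IL: "sets ?IL = sets \<AA>"
    unfolding initial_law_def by (simp add: sets.space_closed)
  \<comment> \<open>A measure given by \<open>measure_of\<close> has the intended values only once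
    countable additivity is verified. Universal measurability of the kernel allows the exchange of
    sum and integral against the completion.\<close>
  have em_IL: "emeasure ?IL B = (\<integral>\<^sup>+v. emeasure (P v) B \<partial>completion \<mu>)" if B: "B \<in> sets \<AA>" for B
  proof (rule emeasure_measure_of[OF initial_law_def])
    show "positive (sets ?IL) (\<lambda>B. \<integral>\<^sup>+v. emeasure (P v) B \<partial>completion \<mu>)"
      by (simp add: positive_def)
    show "countably_additive (sets ?IL) (\<lambda>B. \<integral>\<^sup>+v. emeasure (P v) B \<partial>completion \<mu>)"
    proof (rule countably_additiveI)
      fix D :: "nat \<Rightarrow> 'w set"
      assume D: "range D \<subseteq> sets ?IL" "disjoint_family D"
      have "(\<Sum>i. \<integral>\<^sup>+v. emeasure (P v) (D i) \<partial>completion \<mu>)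
          = (\<integral>\<^sup>+v. (\<Sum>i. emeasure (P v) (D i)) \<partial>completion \<mu>)"
        using D(1) by (intro nn_integral_suminf[symmetric] P_univ prob sets_\<mu>) (auto simp: sets_IL)
      also have "\<dots> = (\<integral>\<^sup>+v. emeasure (P v) (\<Union>i. D i) \<partial>completion \<mu>)"
        using D by (intro nn_integral_cong suminf_emeasure) (auto simp: sets_IL P_sets space_\<mu>)
      finally show "(\<Sum>i. \<integral>\<^sup>+v. emeasure (P v) (D i) \<partial>completion \<mu>)
          = (\<integral>\<^sup>+v. emeasure (P v) (\<Union>i. D i) \<partial>completion \<mu>)" .
    qed
  qed (use B sets_IL sets.space_closed in auto)
  \<comment> \<open>Restricted to \<open>N\<close>, the initial law is the mixture
    \<open>law\<close>: integration against the completion agrees with integration against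
    \<open>\<mu>\<close>.\<close>
  have dIL: "distr ?IL N (\<lambda>\<omega>. \<omega>) = law"
  proof (rule measure_eqI)
    show "sets (distr ?IL N (\<lambda>\<omega>. \<omega>)) = sets law" by (simp add: sets_law)
    fix B assume "B \<in> sets (distr ?IL N (\<lambda>\<omega>. \<omega>))"
    then have B: "B \<in> sets N" by simp
    have "emeasure (distr ?IL N (\<lambda>\<omega>. \<omega>)) B = emeasure ?IL B"
      using B NA sets_eq_imp_space_eq[OF sets_IL]
      by (subst emeasure_distr[OF idN[OF sets_IL]]) (auto simp: Int_absorb2 dest: sets.sets_into_space)
    also have "\<dots> = (\<integral>\<^sup>+v. emeasure (P v) B \<partial>completion \<mu>)"
      using B NA by (intro em_IL) auto
    also have "\<dots> = (\<integral>\<^sup>+v. emeasure (P v) B \<partial>\<mu>)"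
      by (rule nn_integral_completion)
    also have "\<dots> = (\<integral>\<^sup>+v. emeasure (K v) B \<partial>\<mu>)"
      using B by (intro nn_integral_cong) (simp add: emK space_\<mu>)
    also have "\<dots> = emeasure law B"
      unfolding law_def by (rule emeasure_bind[symmetric, OF _ measurable_prob_algebraD[OF K_meas] B])
        (rule \<mu>.not_empty)
    finally show "emeasure (distr ?IL N (\<lambda>\<omega>. \<omega>)) B = emeasure law B" .
  qed
  \<comment> \<open>All times of the window are nonnegative, so the clamping in \<open>X\<close> is
    invisible there.\<close>
  have XI: "set_integrable lborel {0..<t} (\<lambda>s. f (X s \<omega>))
      \<longleftrightarrow> set_integrable lborel {0..<t} (\<lambda>s. f (\<eta> s \<omega>))" for \<omega>
    by (rule set_integrable_cong) (auto simp: X_def)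
  have XL: "(LINT s:{0..<t}|lborel. f (X s \<omega>)) = (LINT s:{0..<t}|lborel. f (\<eta> s \<omega>))" for \<omega>
    by (rule set_lebesgue_integral_cong) (auto simp: X_def)
  note est = time_average_estimate[OF t f, unfolded XI XL]
  define G where "G = (\<lambda>\<omega>. 1 / t * (LINT s:{0..<t}|lborel. f (\<eta> s \<omega>)) - (\<integral>v. f v \<partial>\<mu>))"
  have GL: "G \<in> L2 law" using est(2) by (simp add: G_def)
  have Gm: "G \<in> borel_measurable N"
    using L2_measurable[OF GL] by (simp add: measurable_cong_sets[OF sets_law refl])
  have "AE \<omega> in ?IL. set_integrable lborel {0..<t} (\<lambda>s. f (\<eta> s \<omega>))"
    by (rule AE_distrD[OF idN[OF sets_IL]], unfold dIL, rule est(1))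
  moreover have "G \<in> L2 ?IL"
  proof -
    have "integrable (distr ?IL N (\<lambda>\<omega>. \<omega>)) (\<lambda>\<omega>. (G \<omega>)\<^sup>2)"
      using L2_integrable_power2[OF GL] by (simp add: dIL)
    then have "integrable ?IL (\<lambda>\<omega>. (G \<omega>)\<^sup>2)"
      by (rule integrable_distr[OF idN[OF sets_IL]])
    moreover have "G \<in> borel_measurable ?IL"
      using measurable_compose[OF idN[OF sets_IL] Gm] .
    ultimately show ?thesis by (simp add: L2_def)
  qed
  moreover have "L2norm ?IL G = L2norm law G"
    unfolding L2norm_def dIL[symmetric]
    by (subst integral_distr[OF idN[OF sets_IL]]) (use Gm in auto)
  ultimately show ?thesis
    using est(3) by (simp add: G_def)
qed

section \<open>The topology of the tangent bundle\<close>

text \<open>Serves the unit tangent bundle, whose topology is the trace of that of the tangent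
  bundle.\<close>

lemma countably_regular_subtopology:
  assumes "countably_regular Q"
  shows "countably_regular (subtopology Q S)"
  unfolding countably_regular_def
proof (intro allI impI)
  fix U assume "openin (subtopology Q S) U"
  then obtain V where V: "openin Q V" "U = V \<inter> S" by (auto simp: openin_subtopology)
  obtain B C where BC: "\<forall>k::nat. openin Q (B k) \<and> closedin Q (C k) \<and> B k \<subseteq> C k \<and> C k \<subseteq> V" "V = (\<Union>k. B k)"
    using assms[unfolded countably_regular_def, rule_format, OF V(1)] by (elim exE conjE)
  show "\<exists>B C. (\<forall>k::nat. openin (subtopology Q S) (B k) \<and> closedin (subtopology Q S) (C k) \<and> B k \<subseteq> C k
      \<and> C k \<subseteq> U) \<and> U = (\<Union>k. B k)"
  proof (intro exI conjI allI)
    fix k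
    show "openin (subtopology Q S) (B k \<inter> S)" using BC(1) by (auto simp: openin_subtopology)
    show "closedin (subtopology Q S) (C k \<inter> S)" using BC(1) by (auto simp: closedin_subtopology)
    show "B k \<inter> S \<subseteq> C k \<inter> S" "C k \<inter> S \<subseteq> U" using BC(1) V(2) by auto
    show "U = (\<Union>k. B k \<inter> S)" using BC(2) V(2) by auto
  qed
qed

section \<open>Transition maps of the manifold and of its tangent bundle\<close>

lemma chart_at_in:
  assumes "smooth_atlas A"
  shows "chart_at A x \<in> A" "x \<in> cdom (chart_at A x)"
proof -
  have "\<exists>c. c \<in> A \<and> x \<in> cdom c" using assms unfolding smooth_atlas_def by blast
  from someI_ex[OF this] show "chart_at A x \<in> A" "x \<in> cdom (chart_at A x)"
    unfolding chart_at_def by auto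
qed

context
  fixes A :: "('m::{t2_space, second_countable_topology}, 'e::euclidean_space) chart set"
  assumes atlas: "smooth_atlas A"
begin

lemma chart_homeo:
  assumes "c \<in> A"
  shows "open (cdom c)" "open (cimg c)" "homeomorphism (cdom c) (cimg c) (cmap c) (cinv c)"
  using atlas assms unfolding smooth_atlas_def by auto

lemma cinv_cmap: "c \<in> A \<Longrightarrow> x \<in> cdom c \<Longrightarrow> cinv c (cmap c x) = x"
  using chart_homeo(3) unfolding homeomorphism_def by blast

lemma chart_image_eq:
  assumes "c \<in> A"
  shows "cmap c ` (cdom c \<inter> V) = cinv c -` V \<inter> cimg c"
  using cinv_cmap[OF assms] by (auto simp: image_iff)

lemma chart_image_open:
  assumes c: "c \<in> A" and V: "open V"
  shows "open (cmap c ` (cdom c \<inter> V))"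
proof -
  have "continuous_on (cimg c) (cinv c)" using chart_homeo(3)[OF c] by (simp add: homeomorphism_def)
  then have "open (cinv c -` V \<inter> cimg c)"
    using continuous_on_open_vimage[OF chart_homeo(2)[OF c]] V by auto
  then show ?thesis by (simp only: chart_image_eq[OF c])
qed

lemma transition_smooth:
  assumes "c \<in> A" "d \<in> A"
  shows "smooth_on (cmap c ` (cdom c \<inter> cdom d)) (cmap d \<circ> cinv c)"
  using atlas assms unfolding smooth_atlas_def by blast

lemma transition_differentiable:
  assumes c: "c \<in> A" and d: "d \<in> A" and x: "x \<in> cdom c" "x \<in> cdom d"
  shows "(cmap d \<circ> cinv c) differentiable (at (cmap c x))"
proof -
  have "Ck_on (Suc 0) (cmap c ` (cdom c \<inter> cdom d)) (cmap d \<circ> cinv c)"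
    using transition_smooth[OF c d] unfolding smooth_on_def by blast
  then have "(cmap d \<circ> cinv c) differentiable_on (cmap c ` (cdom c \<inter> cdom d))" by simp
  moreover have y: "cmap c x \<in> cmap c ` (cdom c \<inter> cdom d)" using x by auto
  ultimately have "(cmap d \<circ> cinv c) differentiable (at (cmap c x) within cmap c ` (cdom c \<inter> cdom d))"
    unfolding differentiable_on_def by blast
  then show ?thesis
    by (simp only: at_within_open[OF y chart_image_open[OF c chart_homeo(1)[OF d]]])
qed

text \<open>Chain rule for the passage from the selected chart \<open>b\<close> through
  \<open>c\<close> to \<open>d\<close>; the factorisation of the transition map holds near the
  coordinate point of \<open>x\<close>, which is enough for the derivative.\<close>

lemma tcoord_transition:
  assumes c: "c \<in> A" and d: "d \<in> A" and x: "x \<in> cdom c" "x \<in> cdom d"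
  shows "tcoord A d x e = frechet_derivative (cmap d \<circ> cinv c) (at (cmap c x)) (tcoord A c x e)"
proof -
  define b where "b = chart_at A x"
  have b: "b \<in> A" "x \<in> cdom b" using chart_at_in[OF atlas] by (auto simp: b_def)
  let ?f = "cmap c \<circ> cinv b" and ?h = "cmap d \<circ> cinv c"
  have f: "(?f has_derivative frechet_derivative ?f (at (cmap b x))) (at (cmap b x))"
    using transition_differentiable[OF b(1) c b(2) x(1)] by (simp add: frechet_derivative_works)
  have fx: "?f (cmap b x) = cmap c x" using cinv_cmap[OF b] by simp
  have h: "(?h has_derivative frechet_derivative ?h (at (cmap c x))) (at (?f (cmap b x)))"
    unfolding fx using transition_differentiable[OF c d x] by (simp add: frechet_derivative_works)
  have "((\<lambda>y. ?h (?f y)) has_derivative (\<lambda>e. frechet_derivative ?h (at (cmap c x)) (frechet_derivative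
      ?f (at (cmap b x)) e))) (at (cmap b x))"
    using diff_chain_at[OF f h] by (simp add: o_def)
  then have "(cmap d \<circ> cinv b has_derivative (\<lambda>e. frechet_derivative ?h (at (cmap c x))
      (frechet_derivative ?f (at (cmap b x)) e))) (at (cmap b x))"
  proof (rule has_derivative_transform_within_open)
    show "open (cmap b ` (cdom b \<inter> cdom c))" by (rule chart_image_open[OF b(1) chart_homeo(1)[OF c]])
    show "cmap b x \<in> cmap b ` (cdom b \<inter> cdom c)" using b x by auto
    show "?h (?f y) = (cmap d \<circ> cinv b) y" if "y \<in> cmap b ` (cdom b \<inter> cdom c)" for y
      using that cinv_cmap[OF b(1)] cinv_cmap[OF c] by auto
  qed
  from frechet_derivative_at[OF this] show ?thesis
    unfolding tcoord_def b_def[symmetric] by metis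
qed

text \<open>\<open>Ck_on\<close> gives continuity of the derivative along each basis vector
  separately; expanding the tangent vector in the basis makes it jointly continuous in point and
  vector.\<close>

lemma continuous_on_transition:
  assumes c: "c \<in> A" and d: "d \<in> A"
  shows "continuous_on (cmap c ` (cdom c \<inter> cdom d) \<times> UNIV)
    (\<lambda>z. ((cmap d \<circ> cinv c) (fst z), frechet_derivative (cmap d \<circ> cinv c) (at (fst z)) (snd z)))"
proof -
  let ?S = "cmap c ` (cdom c \<inter> cdom d)" and ?h = "cmap d \<circ> cinv c"
  have Ck: "Ck_on (Suc 0) ?S ?h" using transition_smooth[OF c d] unfolding smooth_on_def by blast
  have hc: "continuous_on ?S ?h" by (rule differentiable_imp_continuous_on) (use Ck in simp)
  have dc: "continuous_on ?S (\<lambda>y. frechet_derivative ?h (at y) i)" if "i \<in> Basis" for i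
    using Ck that by simp
  have rep: "frechet_derivative ?h (at y) \<zeta> = (\<Sum>i\<in>Basis. (\<zeta> \<bullet> i) *\<^sub>R frechet_derivative ?h (at y) i)"
    if "y \<in> ?S" for y \<zeta>
  proof -
    have "?h differentiable (at y)" using transition_differentiable[OF c d] that by auto
    then have lin: "linear (frechet_derivative ?h (at y))" by (rule linear_frechet_derivative)
    have "frechet_derivative ?h (at y) \<zeta> = frechet_derivative ?h (at y) (\<Sum>i\<in>Basis. (\<zeta> \<bullet> i) *\<^sub>R i)"
      by (simp only: euclidean_representation)
    also have "\<dots> = (\<Sum>i\<in>Basis. (\<zeta> \<bullet> i) *\<^sub>R frechet_derivative ?h (at y) i)"
      by (simp only: linear_sum[OF lin] linear_cmul[OF lin])
    finally show ?thesis .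
  qed
  have "continuous_on (?S \<times> UNIV) (\<lambda>z. (?h (fst z), \<Sum>i\<in>Basis. (snd z \<bullet> i) *\<^sub>R frechet_derivative ?h (at
      (fst z)) i))"
    by (intro continuous_intros continuous_on_compose2[OF hc] continuous_on_compose2[OF dc]) auto
  then show ?thesis
    by (rule continuous_on_cong[THEN iffD1, rotated 2]) (auto simp: rep simp del: o_apply)
qed

section \<open>Open and closed sets of the tangent bundle in charts\<close>

lemma TM_chart_simps [simp]:
  "cdom (TM_chart A c) = cdom c \<times> UNIV" "cmap (TM_chart A c) p
      = (cmap c (fst p), tcoord A c (fst p) (snd p))"
  by (simp_all add: TM_chart_def split_beta)

lemma openin_TM_chart:
  assumes "c \<in> A" "open W"
  shows "openin (TM_topology A) {p. fst p \<in> cdom c \<and> cmap (TM_chart A c) p \<in> W}"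
proof -
  have "{p. fst p \<in> cdom c \<and> cmap (TM_chart A c) p \<in> W} = cdom (TM_chart A c) \<inter> cmap (TM_chart A c) -` W"
    by auto
  then show ?thesis
    unfolding TM_topology_def TM_atlas_def
    using assms by (intro topology_generated_by_Basis) blast
qed

text \<open>Continuity of the bundle projection: in each chart the preimage of \<open>V\<close> is a
  cylinder over an open set.\<close>

lemma openin_TM_base:
  assumes V: "open V"
  shows "openin (TM_topology A) {p :: 'm \<times> 'e. fst p \<in> V}"
proof -
  have "{p. fst p \<in> V} = (\<Union>c\<in>A. {p. fst p \<in> cdom c \<and> cmap (TM_chart A c) p \<in> cmap c ` (cdom c \<inter> V) \<times> UNIV})"
  proof (rule set_eqI)
    fix p :: "'m \<times> 'e"
    have "fst p \<in> V \<longleftrightarrow> cmap c (fst p) \<in> cmap c ` (cdom c \<inter> V)" if "c \<in> A" "fst p \<in> cdom c" for c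
      using cinv_cmap[OF that(1)] that(2) by (auto simp: image_iff) (metis that(2))
    then show "p \<in> {p. fst p \<in> V} \<longleftrightarrow>
        p \<in> (\<Union>c\<in>A. {p. fst p \<in> cdom c \<and> cmap (TM_chart A c) p \<in> cmap c ` (cdom c \<inter> V) \<times> UNIV})"
      using chart_at_in[OF atlas, of "fst p"] by auto
  qed
  also have "openin (TM_topology A) \<dots>"
    by (intro openin_Union) (auto intro!: openin_TM_chart open_Times chart_image_open V simp del:
        TM_chart_simps)
  finally show ?thesis .
qed

lemma topspace_TM [simp]: "topspace (TM_topology A) = UNIV"
  using openin_subset[OF openin_TM_base[OF open_UNIV]] by auto

text \<open>The topology is generated by all charts at once; continuity of the coordinate changes
  shows that neighbourhoods can be tested in any one prescribed chart around the point. The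
  induction follows the generation of open sets.\<close>

lemma openin_TM_local:
  assumes U: "openin (TM_topology A) U" and c: "c \<in> A" and p: "p \<in> U" "fst p \<in> cdom c"
  shows "\<exists>W. open W \<and> cmap (TM_chart A c) p \<in> W \<and> {q. fst q \<in> cdom c \<and> cmap (TM_chart A c) q \<in> W} \<subseteq> U"
proof -
  define G where "G = {cdom C \<inter> cmap C -` W | C W. C \<in> TM_atlas A \<and> open W}"
  have "generate_topology_on G U"
    using U unfolding TM_topology_def G_def by (rule openin_topology_generated_by)
  then show ?thesis
    using p
  proof (induction arbitrary: p rule: generate_topology_on.induct)
    case Empty
    then show ?case by simp
  next
    case (Int a b)
    obtain W1 W2 where
      "open W1" "cmap (TM_chart A c) p \<in> W1" "{q. fst q \<in> cdom c \<and> cmap (TM_chart A c) q \<in> W1} \<subseteq> a"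
      "open W2" "cmap (TM_chart A c) p \<in> W2" "{q. fst q \<in> cdom c \<and> cmap (TM_chart A c) q \<in> W2} \<subseteq> b"
      using Int.IH(1)[of p] Int.IH(2)[of p] Int.prems by blast
    then show ?case by (intro exI[of _ "W1 \<inter> W2"] conjI open_Int) blast+
  next
    case (UN K)
    then obtain k where "k \<in> K" "p \<in> k" by auto
    with UN.IH[of k p] UN.prems obtain W where "open W" "cmap (TM_chart A c) p \<in> W"
      "{q. fst q \<in> cdom c \<and> cmap (TM_chart A c) q \<in> W} \<subseteq> k" by blast
    then show ?case using \<open>k \<in> K\<close> by (intro exI[of _ W]) blast
  next
    case (Basis s)
    then obtain D W where D: "D \<in> TM_atlas A" and W: "open W" and s': "s = cdom D \<inter> cmap D -` W"
      unfolding G_def by blast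
    then obtain d where d: "d \<in> A" and "D = TM_chart A d"
      unfolding TM_atlas_def by blast
    then have s: "s = cdom (TM_chart A d) \<inter> cmap (TM_chart A d) -` W" using s' by simp
    \<comment> \<open>\<open>?\<theta>\<close> is the coordinate change from the chart induced by
      \<open>c\<close> to the one induced by \<open>d\<close>, considered over the overlap
      \<open>?S\<close>; the required neighbourhood is the preimage of \<open>W\<close> under
      it.\<close>
    let ?S = "cmap c ` (cdom c \<inter> cdom d) \<times> (UNIV :: 'e set)"
    let ?\<theta> = "\<lambda>z. ((cmap d \<circ> cinv c) (fst z), frechet_derivative (cmap d \<circ> cinv c) (at (fst z)) (snd z))"
    have S: "open ?S" by (intro open_Times open_UNIV chart_image_open[OF c chart_homeo(1)[OF d]])
    have \<theta>: "?\<theta> (cmap (TM_chart A c) q) = cmap (TM_chart A d) q" if "fst q \<in> cdom c" "fst q \<in> cdom d" for q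
      using that by (simp add: tcoord_transition[OF c d that] cinv_cmap[OF c])
    have dom: "fst q \<in> cdom d" if q: "fst q \<in> cdom c" "cmap (TM_chart A c) q \<in> ?S" for q
    proof -
      obtain y where y: "y \<in> cdom c" "y \<in> cdom d" "cmap c (fst q) = cmap c y" using q by auto
      then have "fst q = y" using cinv_cmap[OF c q(1)] cinv_cmap[OF c y(1)] by metis
      then show ?thesis using y by simp
    qed
    have "open (?\<theta> -` W \<inter> ?S)"
      by (rule continuous_on_open_vimage[OF S, THEN iffD1, rule_format, OF continuous_on_transition[OF c
          d] W])
    moreover have "cmap (TM_chart A c) p \<in> ?\<theta> -` W \<inter> ?S"
    proof
      have "fst p \<in> cdom d" using Basis.prems(1) s by auto
      then show "cmap (TM_chart A c) p \<in> ?S" using Basis.prems(2) by auto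
      show "cmap (TM_chart A c) p \<in> ?\<theta> -` W"
        using \<theta>[OF Basis.prems(2) \<open>fst p \<in> cdom d\<close>] Basis.prems(1) s
        by (simp del: TM_chart_simps o_apply)
    qed
    moreover have "{q. fst q \<in> cdom c \<and> cmap (TM_chart A c) q \<in> ?\<theta> -` W \<inter> ?S} \<subseteq> s"
    proof
      fix q assume "q \<in> {q. fst q \<in> cdom c \<and> cmap (TM_chart A c) q \<in> ?\<theta> -` W \<inter> ?S}"
      then have q: "fst q \<in> cdom c" "?\<theta> (cmap (TM_chart A c) q) \<in> W" "cmap (TM_chart A c) q \<in> ?S"
        by (simp_all del: TM_chart_simps o_apply)
      have "fst q \<in> cdom d" by (rule dom[OF q(1,3)])
      with \<theta>[OF q(1) this] q(2) show "q \<in> s"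
        unfolding s by (cases q) (simp del: TM_chart_simps(2) o_apply)
    qed
    ultimately show ?case by (intro exI[of _ "?\<theta> -` W \<inter> ?S"] conjI)
  qed
qed

text \<open>Compactness of \<open>H\<close> prevents accumulation outside the chart: the base points
  of the set form a compact, hence closed, subset of the Hausdorff manifold, and the cylinder over
  its complement separates the points lying over other base points.\<close>

lemma closedin_TM_chart:
  assumes c: "c \<in> A" and H: "compact H" "H \<subseteq> cimg c \<times> UNIV"
  shows "closedin (TM_topology A) {p. fst p \<in> cdom c \<and> cmap (TM_chart A c) p \<in> H}" (is "closedin _ ?K")
  unfolding closedin_def
proof (intro conjI)
  show "openin (TM_topology A) (topspace (TM_topology A) - ?K)"
  proof (subst openin_subopen, intro ballI)
    fix p assume "p \<in> topspace (TM_topology A) - ?K"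
    then have p: "p \<notin> ?K" by simp
    show "\<exists>T. openin (TM_topology A) T \<and> p \<in> T \<and> T \<subseteq> topspace (TM_topology A) - ?K"
    proof (cases "fst p \<in> cdom c")
      case True
      let ?T = "{p. fst p \<in> cdom c \<and> cmap (TM_chart A c) p \<in> - H}"
      have "openin (TM_topology A) ?T"
        using H(1) by (intro openin_TM_chart c) (simp add: compact_imp_closed open_Compl)
      moreover have "p \<in> ?T" using True p by simp
      moreover have "?T \<subseteq> topspace (TM_topology A) - ?K" by auto
      ultimately show ?thesis by blast
    next
      case False
      define k where "k = cinv c ` fst ` H"
      have fH: "fst ` H \<subseteq> cimg c" using H(2) by auto
      have "compact k"
        unfolding k_def using chart_homeo(3)[OF c] H(1) fH
        by (intro compact_continuous_image continuous_on_subset[OF _ fH] continuous_on_fst continuous_on_id)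
          (auto simp: homeomorphism_def)
      then have "open (- k)" by (simp add: compact_imp_closed open_Compl)
      then have "openin (TM_topology A) {p :: 'm \<times> 'e. fst p \<in> - k}" by (rule openin_TM_base)
      moreover have "fst p \<notin> k"
        using False fH chart_homeo(3)[OF c] by (force simp: k_def homeomorphism_def)
      moreover have "{p :: 'm \<times> 'e. fst p \<in> - k} \<subseteq> topspace (TM_topology A) - ?K"
      proof
        fix q assume q: "q \<in> {p :: 'm \<times> 'e. fst p \<in> - k}"
        have "q \<notin> ?K"
        proof
          assume "q \<in> ?K"
          then have "fst q \<in> cdom c" "cmap c (fst q) \<in> fst ` H" by force+
          then have "fst q \<in> k" unfolding k_def using cinv_cmap[OF c] by (metis image_eqI)
          with q show False by simp
        qed
        then show "q \<in> topspace (TM_topology A) - ?K" by simp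
      qed
      ultimately show ?thesis by (intro exI[of _ "{p :: 'm \<times> 'e. fst p \<in> - k}"]) simp
    qed
  qed
qed simp

text \<open>Countably many charts and a countable basis of the coordinate space yield countably many
  coordinate sets \<open>S c b\<close> with compact closure inside the chart image; those whose
  closed version lies in \<open>U\<close> exhaust \<open>U\<close>.\<close>

lemma countably_regular_TM: "countably_regular (TM_topology A)"
  unfolding countably_regular_def
proof (intro allI impI)
  fix U assume U: "openin (TM_topology A) U"
  \<comment> \<open>The atlas may be uncountable; second countability of the manifold selects
    countably many charts that still cover it.\<close>
  have "\<exists>\<D>\<subseteq>cdom ` A. countable \<D> \<and> \<Union>\<D> = \<Union>(cdom ` A)"
    using Lindelof[of "cdom ` A"] chart_homeo(1) by (metis imageE)
  then obtain \<D> where D: "\<D> \<subseteq> cdom ` A" "countable \<D>" "\<Union>\<D> = \<Union>(cdom ` A)" by blast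
  obtain A0 where A0: "A0 \<subseteq> A" "countable A0" "cdom ` A0 = \<D>"
    using D(1,2) by (metis countable_subset_image)
  have cover: "\<exists>c\<in>A0. x \<in> cdom c" for x
    using A0(3) D(3) chart_at_in[OF atlas, of x] by blast
  obtain \<B> :: "('e \<times> 'e) set set" where \<B>: "countable \<B>" "topological_basis \<B>"
    using ex_countable_basis by blast
  define S where "S c b = {p. fst p \<in> cdom c \<and> cmap (TM_chart A c) p \<in> b}" for c and b :: "('e \<times> 'e) set"
  \<comment> \<open>The pair of empty sets keeps the family nonempty, as its enumeration by
    \<open>from_nat_into\<close> requires even for empty \<open>U\<close>.\<close>
  define \<F> where "\<F> = insert ({}, {}) ((\<lambda>(c, b). (S c b, S c (closure b))) `
    {(c, b). c \<in> A0 \<and> b \<in> \<B> \<and> compact (closure b) \<and> closure b \<subseteq> cimg c \<times> UNIV \<and> S c (closure b) \<subseteq> U})"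
  have "countable \<F>"
    unfolding \<F>_def
    by (intro countable_insert countable_image countable_subset[OF _ countable_SIGMA[OF A0(2), of "\<lambda>_.
        \<B>"]] \<B>(1)) auto
  have F: "openin (TM_topology A) (fst z) \<and> closedin (TM_topology A) (snd z) \<and> fst z \<subseteq> snd z \<and> snd z \<subseteq> U"
    if z: "z \<in> \<F>" for z
  proof -
    consider "z = ({}, {})" | c b where "z = (S c b, S c (closure b))" "c \<in> A0" "b
        \<in> \<B>" "compact (closure b)"
        "closure b \<subseteq> cimg c \<times> UNIV" "S c (closure b) \<subseteq> U"
      using z unfolding \<F>_def by auto
    then show ?thesis
    proof cases
      case (2 c b)
      have "c \<in> A" using 2 A0 by auto
      moreover have "open b" using 2 topological_basis_open[OF \<B>(2)] by blast
      moreover have "S c b \<subseteq> S c (closure b)" using closure_subset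
          by (auto simp: S_def simp del: TM_chart_simps)
      ultimately show ?thesis
        using 2 openin_TM_chart[of c b] closedin_TM_chart[of c "closure b"]
            by (simp add: S_def del: TM_chart_simps)
    qed simp
  qed
  define B C where "B k = fst (from_nat_into \<F> k)" and "C k = snd (from_nat_into \<F> k)" for k
  have "\<F> \<noteq> {}" by (simp add: \<F>_def)
  have "openin (TM_topology A) (B k) \<and> closedin (TM_topology A) (C k) \<and> B k \<subseteq> C k \<and> C k \<subseteq> U" for k
    unfolding B_def C_def by (rule F[OF from_nat_into[OF \<open>\<F> \<noteq> {}\<close>]])
  moreover have "U = (\<Union>k. B k)"
  proof
    show "(\<Union>k. B k) \<subseteq> U" using calculation by blast
    show "U \<subseteq> (\<Union>k. B k)"
    proof
      fix p assume p: "p \<in> U"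
      obtain c where c: "c \<in> A0" "fst p \<in> cdom c" using cover by blast
      then have cA: "c \<in> A" using A0 by auto
      let ?z = "cmap (TM_chart A c) p"
      obtain W where W: "open W" "?z \<in> W" "S c W \<subseteq> U"
        using openin_TM_local[OF U cA p c(2)] unfolding S_def by blast
      have O: "open (W \<inter> cimg c \<times> UNIV)" and Z: "?z \<in> W \<inter> cimg c \<times> UNIV"
        using W chart_homeo(2)[OF cA] c by (auto intro: open_Int open_Times)
      \<comment> \<open>Local compactness of the coordinate space: a basis set within a small ball
        has compact closure inside both \<open>W\<close> and the chart image.\<close>
      obtain r where r: "0 < r" "cball ?z r \<subseteq> W \<inter> cimg c \<times> UNIV"
        using O[unfolded open_contains_cball, rule_format, OF Z] by (elim exE conjE)
      obtain b where b: "b \<in> \<B>" "?z \<in> b" "b \<subseteq> ball ?z r"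
        using topological_basisE[OF \<B>(2), of "ball ?z r" ?z] r(1) by auto
      have cl: "closure b \<subseteq> cball ?z r"
        using closure_mono[OF b(3)] r(1) by (metis closure_ball)
      then have "compact (closure b)" by (meson bounded_cball bounded_subset closed_closure
          compact_eq_bounded_closed)
      moreover have "S c (closure b) \<subseteq> U" using cl r(2) W(3) unfolding S_def by blast
      ultimately have "(S c b, S c (closure b)) \<in> \<F>"
        unfolding \<F>_def
        by (intro insertI2 image_eqI[of _ _ "(c, b)"]) (use c(1) b(1) cl r(2) in auto)
      then obtain k where "from_nat_into \<F> k = (S c b, S c (closure b))"
        using from_nat_into_surj[OF \<open>countable \<F>\<close>] by blast
      then have "B k = S c b" by (simp add: B_def)
      moreover have "p \<in> S c b" using c(2) b(2) by (simp add: S_def del: TM_chart_simps)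
      ultimately show "p \<in> (\<Union>k. B k)" by blast
    qed
  qed
  ultimately show "\<exists>B C. (\<forall>k::nat. openin (TM_topology A) (B k) \<and> closedin (TM_topology A) (C k)
      \<and> B k \<subseteq> C k \<and> C k \<subseteq> U) \<and> U = (\<Union>k. B k)"
    by blast
qed

end

section \<open>Normalisation of the invariant measure\<close>

text \<open>Gram-Schmidt for the inner product \<open>B\<close>: a vector outside the span of
  \<open>S\<close> minus its projection is nonzero and can be normalised.\<close>

lemma ex_orthonormal_set:
  fixes B :: "'e::euclidean_space \<Rightarrow> 'e \<Rightarrow> real"
  assumes bil: "bilinear B" and sym: "\<And>u w. B u w = B w u" and pos: "\<And>u. u \<noteq> 0 \<Longrightarrow> 0 < B u u"
    and k: "k \<le> DIM('e)"
  shows "\<exists>S. finite S \<and> card S = k \<and> (\<forall>u\<in>S. \<forall>w\<in>S. B u w = (if u = w then 1 else 0))"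
  using k
proof (induction k)
  case 0
  then show ?case by (intro exI[of _ "{}"]) simp
next
  case (Suc k)
  then obtain S where S: "finite S" "card S = k" "\<forall>u\<in>S. \<forall>w\<in>S. B u w = (if u = w then 1 else 0)" by auto
  have "dim (span S) < DIM('e)"
    using dim_le_card[OF subset_refl S(1)] S(2) Suc.prems by simp
  then have "span S \<noteq> UNIV" by (metis dim_UNIV less_irrefl)
  then obtain a where a: "a \<notin> span S" by auto
  define b where "b = a - (\<Sum>s\<in>S. B a s *\<^sub>R s)"
  have "(\<Sum>s\<in>S. B a s *\<^sub>R s) \<in> span S" by (intro span_sum span_scale span_base)
  then have "b \<noteq> 0" using a unfolding b_def by (metis eq_iff_diff_eq_0)
  then have Bb: "0 < B b b" by (rule pos)
  have lin: "linear (\<lambda>u. B u w)" for w using bil unfolding bilinear_def by blast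
  have orth: "B b s = 0" if "s \<in> S" for s
  proof -
    have "B b s = B a s - (\<Sum>r\<in>S. B a r * B r s)"
      unfolding b_def by (simp add: linear_diff[OF lin] linear_sum[OF lin] linear_cmul[OF lin])
    also have "(\<Sum>r\<in>S. B a r * B r s) = (\<Sum>r\<in>S. if r = s then B a r else 0)"
      by (rule sum.cong) (use S(3) that in auto)
    also have "\<dots> = B a s" using S(1) that by simp
    finally show ?thesis by simp
  qed
  define e where "e = b /\<^sub>R sqrt (B b b)"
  have Be: "B e w = B b w / sqrt (B b b)" for w
    unfolding e_def by (simp add: linear_cmul[OF lin] field_simps)
  have ee: "B e e = 1"
    using Bb Be[of e] Be[of b] sym[of b e] by (simp add: field_simps)
  have es: "B e s = 0" "B s e = 0" if "s \<in> S" for s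
    using Be[of s] orth[OF that] sym[of s e] by auto
  have "e \<notin> S" using es ee by force
  then show ?case
    using S ee es by (intro exI[of _ "insert e S"]) auto
qed

lemma ex_linear_isometry:
  fixes B :: "'e::euclidean_space \<Rightarrow> 'e \<Rightarrow> real"
  assumes bil: "bilinear B" and sym: "\<And>u w. B u w = B w u" and pos: "\<And>u. u \<noteq> 0 \<Longrightarrow> 0 < B u u"
  shows "\<exists>J :: 'e \<Rightarrow> 'e. linear J \<and> (\<forall>u w. B (J u) (J w) = u \<bullet> w)"
proof -
  obtain S where S: "finite S" "card S = DIM('e)" "\<forall>u\<in>S. \<forall>w\<in>S. B u w = (if u = w then 1 else 0)"
    using ex_orthonormal_set[OF assms, of "DIM('e)"] by auto
  obtain h where h: "bij_betw h (Basis :: 'e set) S"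
    using finite_same_card_bij[OF finite_Basis S(1)] S(2) by auto
  define J where "J u = (\<Sum>i\<in>Basis. (u \<bullet> i) *\<^sub>R h i)" for u :: 'e
  have "linear J"
    unfolding J_def by (rule linearI) (simp_all add: inner_add_left scaleR_add_left sum.distrib
        scaleR_sum_right)
  have l1: "linear (\<lambda>u. B u w)" and l2: "linear (B w)" for w
    using bil unfolding bilinear_def by auto
  have hh: "B (h i) (h j) = (if i = j then 1 else 0)" if "i \<in> Basis" "j \<in> Basis" for i j
    using S(3) h that unfolding bij_betw_def inj_on_def by auto
  have "B (J u) (J w) = u \<bullet> w" for u w
  proof -
    have "B (J u) (J w) = (\<Sum>i\<in>Basis. (u \<bullet> i) * B (h i) (J w))"
      by (subst J_def) (simp add: linear_sum[OF l1] linear_cmul[OF l1])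
    also have "\<dots> = (\<Sum>i\<in>Basis. (u \<bullet> i) * (\<Sum>j\<in>Basis. (w \<bullet> j) * B (h i) (h j)))"
      unfolding J_def by (simp add: linear_sum[OF l2] linear_cmul[OF l2])
    also have "\<dots> = (\<Sum>i\<in>Basis. (u \<bullet> i) * (\<Sum>j\<in>Basis. if i = j then w \<bullet> j else 0))"
      by (intro sum.cong refl arg_cong2[where f="(*)"]) (auto simp: hh)
    also have "\<dots> = u \<bullet> w"
      by (simp add: euclidean_inner[of u w])
    finally show ?thesis .
  qed
  with \<open>linear J\<close> show ?thesis by (intro exI[of _ J] conjI allI)
qed

text \<open>The selection in \<open>frame\<close> has its intended properties because such an
  isometry exists.\<close>

lemma frame_isometry:
  fixes g :: "('m, 'e::euclidean_space) metric"
  assumes "riemannian_metric A g"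
  shows "linear (frame g x)" "g x (frame g x u) (frame g x w) = u \<bullet> w"
proof -
  have "\<exists>J :: 'e \<Rightarrow> 'e. linear J \<and> (\<forall>u w. g x (J u) (J w) = u \<bullet> w)"
    using assms unfolding riemannian_metric_def by (intro ex_linear_isometry) auto
  from someI_ex[OF this] show "linear (frame g x)" "g x (frame g x u) (frame g x w) = u \<bullet> w"
    unfolding frame_def by auto
qed

lemma metric_measurable:
  fixes g :: "('m, 'e::euclidean_space) metric"
  assumes "riemannian_metric A g"
  shows "(\<lambda>e. g x e e) \<in> borel_measurable borel"
proof -
  have "bilinear (g x)" using assms unfolding riemannian_metric_def by blast
  then have "bounded_bilinear (g x)" by (simp add: bilinear_conv_bounded_bilinear)
  then have "continuous_on UNIV (\<lambda>e. g x e e)"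
    by (rule bounded_bilinear.continuous_on) (intro continuous_intros)+
  then show ?thesis by (rule borel_measurable_continuous_onI)
qed

lemma frame_measurable:
  fixes g :: "('m, 'e::euclidean_space) metric"
  assumes "riemannian_metric A g"
  shows "frame g x \<in> borel_measurable borel"
  using frame_isometry(1)[OF assms]
  by (intro borel_measurable_continuous_onI linear_continuous_on) (simp add: linear_conv_bounded_linear)

text \<open>The density factorises over the coordinates into one-dimensional normal densities with
  variance \<open>1 / \<beta>\<close>, each of mass one.\<close>

lemma nn_integral_gaussian:
  assumes "0 < \<beta>"
  shows "(\<integral>\<^sup>+(u::'e::euclidean_space). ennreal ((\<beta> / (2 * pi)) powr (real DIM('e) / 2) * exp (- \<beta> * (u \<bullet>
      u) / 2)) \<partial>lborel) = 1"
proof -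
  let ?n = "normal_density 0 (1 / sqrt \<beta>)"
  have "(\<beta> / (2 * pi)) powr (real DIM('e) / 2) * exp (- \<beta> * (u \<bullet> u) / 2)
      = (\<Prod>i\<in>Basis. ?n (u \<bullet> i))" for u :: 'e
  proof -
    have n: "?n y = sqrt (\<beta> / (2 * pi)) * exp (- \<beta> * (y * y) / 2)" for y
      using assms by (simp add: normal_density_def power_divide real_sqrt_divide power2_eq_square)
    have "(\<Prod>i\<in>Basis. ?n (u \<bullet> i)) = sqrt (\<beta> / (2 * pi)) ^ DIM('e) * exp (\<Sum>i\<in>Basis.
        - \<beta> * ((u \<bullet> i) * (u \<bullet> i)) / 2)"
      by (simp only: n prod.distrib prod_constant exp_sum[OF finite_Basis])
    also have "(\<Sum>i\<in>Basis. - \<beta> * ((u \<bullet> i) * (u \<bullet> i)) / 2) = - \<beta> * (u \<bullet> u) / 2"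
      by (simp only: euclidean_inner[of u u] sum_distrib_left sum_divide_distrib)
    also have "sqrt (\<beta> / (2 * pi)) ^ DIM('e) = (\<beta> / (2 * pi)) powr (real DIM('e) / 2)"
      using assms by (simp add: powr_half_sqrt[symmetric] powr_realpow[symmetric] powr_powr)
    finally show ?thesis by simp
  qed
  then have "(\<integral>\<^sup>+(u::'e). ennreal ((\<beta> / (2 * pi)) powr (real DIM('e) / 2) * exp (- \<beta> * (u \<bullet> u) / 2))
      \<partial>lborel)
      = (\<integral>\<^sup>+(u::'e). (\<Prod>i\<in>Basis. ennreal (?n (u \<bullet> i))) \<partial>lborel)"
    by (simp add: prod_ennreal)
  also have "\<dots> = (\<Prod>i\<in>(Basis :: 'e set). (\<integral>\<^sup>+y. ennreal (?n y) \<partial>lborel))"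
    by (rule nn_integral_lborel_prod) auto
  also have "(\<integral>\<^sup>+y. ennreal (?n y) \<partial>lborel) = 1"
  proof -
    interpret prob_space "density lborel (\<lambda>y. ennreal (?n y))"
      using assms by (intro prob_space_normal_density) simp
    show ?thesis using emeasure_space_1 by (simp add: emeasure_density)
  qed
  finally show ?thesis by simp
qed

text \<open>Fibre Lebesgue measure is an image under \<open>frame\<close>, so substitution produces
  no Jacobian and turns \<open>g x e e\<close> into the Euclidean square.\<close>

lemma fibre_gaussian_total:
  fixes g :: "('m, 'e::euclidean_space) metric"
  assumes g: "riemannian_metric A g" and \<beta>: "0 < \<beta>"
  shows "emeasure (fibre_gaussian g \<beta> x) UNIV = 1"
proof -
  note [measurable] = metric_measurable[OF g] frame_measurable[OF g]
  have "emeasure (fibre_gaussian g \<beta> x) UNIV =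
      (\<integral>\<^sup>+e. ennreal ((\<beta> / (2 * pi)) powr (real DIM('e) / 2) * exp (- \<beta> * g x e e / 2)) \<partial>fibre_lebesgue
          g x)"
    unfolding fibre_gaussian_def fibre_lebesgue_def by (subst emeasure_density) auto
  also have "\<dots> = (\<integral>\<^sup>+(u::'e). ennreal ((\<beta> / (2 * pi)) powr (real DIM('e) / 2) * exp (- \<beta> * (u \<bullet> u) / 2))
      \<partial>lborel)"
    unfolding fibre_lebesgue_def by (subst nn_integral_distr) (auto simp: frame_isometry(2)[OF g])
  also have "\<dots> = 1" by (rule nn_integral_gaussian[OF \<beta>])
  finally show ?thesis .
qed

text \<open>\<open>frame\<close> pulls the unit ball of the fibre back to the Euclidean one, whose
  volume is positive and finite; radial projection sends every nonzero vector to the sphere.\<close>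

lemma fibre_sphere_measure_total:
  fixes g :: "('m, 'e::euclidean_space) metric"
  assumes g: "riemannian_metric A g"
  shows "emeasure (fibre_sphere_measure g x) {e. g x e e = 1} = 1"
proof -
  note [measurable] = metric_measurable[OF g] frame_measurable[OF g]
  let ?\<Lambda> = "fibre_lebesgue g x" and ?D = "{e. g x e e \<le> 1}"
  have sets_\<Lambda> [measurable_cong]: "sets ?\<Lambda> = sets borel" by (simp add: fibre_lebesgue_def)
  have space_\<Lambda>: "space ?\<Lambda> = UNIV" by (simp add: fibre_lebesgue_def)
  have D: "?D \<in> sets borel" by measurable
  have em: "emeasure ?\<Lambda> C = emeasure lborel {u. frame g x u \<in> C}" if "C \<in> sets borel" for C
    unfolding fibre_lebesgue_def using that by (subst emeasure_distr) (auto simp: vimage_def)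
  have "{u :: 'e. frame g x u \<in> ?D} = cball 0 1"
    by (simp add: set_eq_iff frame_isometry(2)[OF g] norm_le_square)
  then have eD: "emeasure ?\<Lambda> ?D = emeasure lborel (cball (0 :: 'e) 1)" using em[OF D] by simp
  have "emeasure lborel (cball (0 :: 'e) 1) \<noteq> 0"
    using content_cball_pos[of 1 "0 :: 'e"] by (auto simp: measure_def)
  moreover have "emeasure lborel (cball (0 :: 'e) 1) \<noteq> \<infinity>"
    using emeasure_lborel_cball_finite[of "0 :: 'e" 1] by simp
  ultimately have nz: "emeasure ?\<Lambda> ?D \<noteq> 0" "emeasure ?\<Lambda> ?D \<noteq> \<infinity>" using eD by auto
  let ?U = "uniform_measure ?\<Lambda> ?D"
  interpret U: prob_space ?U by (rule prob_space_uniform_measure[OF nz])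
  have pos: "0 < g x u u" if "u \<noteq> 0" for u
    using g that unfolding riemannian_metric_def by blast
  have "frame g x u = 0 \<longleftrightarrow> u = 0" for u
    using frame_isometry[OF g, of x] pos by (metis inner_eq_zero_iff linear_0 less_irrefl)
  \<comment> \<open>The origin must be shown to be negligible: division by its zero norm gives 0
    rather than a unit vector.\<close>
  then have "emeasure ?\<Lambda> {0} = emeasure lborel {0 :: 'e}"
    using em[of "{0}"] by simp
  then have z0: "emeasure ?\<Lambda> {0} = 0" by simp
  have norm1: "g x (e /\<^sub>R gnorm g x e) (e /\<^sub>R gnorm g x e) = 1" if "e \<noteq> 0" for e
  proof -
    have bil: "bilinear (g x)" using g unfolding riemannian_metric_def by blast
    show ?thesis
      using pos[OF that] by (simp add: bilinear_lmul[OF bil] bilinear_rmul[OF bil] gnorm_def field_simps)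
  qed
  have rm [measurable]: "(\<lambda>e. e /\<^sub>R gnorm g x e) \<in> borel_measurable borel"
    unfolding gnorm_def by measurable
  have "emeasure (fibre_sphere_measure g x) {e. g x e e = 1} =
      emeasure ?U {e. g x (e /\<^sub>R gnorm g x e) (e /\<^sub>R gnorm g x e) = 1}"
    unfolding fibre_sphere_measure_def
    by (subst emeasure_distr) (auto simp: vimage_def fibre_lebesgue_def)
  also have "\<dots> = emeasure ?U (space ?U)"
  proof (rule emeasure_eq_AE)
    have "emeasure ?U {0} = 0"
      using z0 by (subst emeasure_uniform_measure)
        (auto simp: sets_\<Lambda> D intro: emeasure_eq_0[of "{0}"])
    then have "AE e in ?U. e \<noteq> 0"
      by (intro AE_I[of _ _ "{0}"]) (auto simp: sets_\<Lambda>)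
    then show "AE e in ?U. e \<in> {e. g x (e /\<^sub>R gnorm g x e) (e /\<^sub>R gnorm g x e) = 1} \<longleftrightarrow> e \<in> space ?U"
      by eventually_elim (simp add: norm1 fibre_lebesgue_def)
  qed (auto simp: sets_\<Lambda> space_\<Lambda>)
  finally show ?thesis by (simp only: U.emeasure_space_1)
qed

text \<open>The disintegration is tested with the constant 1. The slice over \<open>x\<close> is the
  whole fibre for the tangent bundle and the unit sphere for \<open>SM\<close>.\<close>

lemma prob_space_disintegrates:
  assumes dis: "disintegrates X base \<nu> \<mu>" and base: "prob_space base"
    and total: "\<And>x. emeasure (\<nu> x) {e. (x, e) \<in> topspace X} = 1"
  shows "prob_space \<mu>"
proof
  \<comment> \<open>Nonmeasurable sets have \<open>emeasure\<close> 0 by convention, so the value 1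
    forces measurability of the slice.\<close>
  have m: "{e. (x, e) \<in> topspace X} \<in> sets (\<nu> x)" for x
    using total[of x] emeasure_notin_sets by fastforce
  have "sets \<mu> = sets (borel_sets_of X)" using dis by (simp add: disintegrates_def)
  have "emeasure \<mu> (space \<mu>) = (\<integral>\<^sup>+v. 1 \<partial>\<mu>)" by simp
  also have "\<dots> = (\<integral>\<^sup>+x. (\<integral>\<^sup>+e\<in>{e. (x, e) \<in> topspace X}. 1 \<partial>\<nu> x) \<partial>base)"
    using dis unfolding disintegrates_def by (elim conjE allE[of _ "\<lambda>_. 1"]) simp
  also have "\<dots> = (\<integral>\<^sup>+x. 1 \<partial>base)"
    using m total by simp
  also have "\<dots> = 1" using base by (simp add: prob_space.emeasure_space_1)
  finally show "emeasure \<mu> (space \<mu>) = 1" .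
qed

text \<open>The first two conjuncts give the third its meaning: Bochner integrals of nonintegrable
  functions are 0 by convention, so integrability of the path and square integrability of the
  deviation are asserted along with the norm bound.\<close>

theorem corollary5p2:
  fixes A :: "('m::{t2_space, second_countable_topology}, real ^ 'n) chart set"
    and g :: "('m, real ^ 'n) metric"
    and lam :: "'m measure"
    and Q :: "('m \<times> (real ^ 'n)) topology"
    and \<mu> :: "('m \<times> (real ^ 'n)) measure"
    and D :: "('m \<times> (real ^ 'n) \<Rightarrow> real) set"
    and L :: "('m \<times> (real ^ 'n) \<Rightarrow> real) \<Rightarrow> 'm \<times> (real ^ 'n) \<Rightarrow> real"
    and T :: "real \<Rightarrow> ('m \<times> (real ^ 'n) \<Rightarrow> real) \<Rightarrow> 'm \<times> (real ^ 'n) \<Rightarrow> real"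
    and \<kappa>1 \<kappa>2 t :: real
    and \<AA> :: "'w measure"
    and F :: "real \<Rightarrow> 'w measure"
    and \<eta> :: "real \<Rightarrow> 'w \<Rightarrow> 'm \<times> (real ^ 'n)"
    and P :: "'m \<times> (real ^ 'n) \<Rightarrow> 'w measure"
    and f :: "'m \<times> (real ^ 'n) \<Rightarrow> real"
  assumes manifold: "complete_connected_riemannian_manifold A g"
    and dim: "CARD('n) \<ge> 2"
    and volume: "riemannian_volume A g lam"
    and setting: "(\<exists>\<alpha> \<beta> \<Psi>. langevin_setting A g lam \<alpha> \<beta> \<Psi> Q \<mu> D L) \<or>
                  (\<exists>\<sigma> \<Psi>. fibre_lay_down_setting A g lam \<sigma> \<Psi> Q \<mu> D L)"
    and semigroup: "contraction_semigroup \<mu> T"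
    and gen: "generated_by_closure \<mu> T D L"
    and kappa: "0 < \<kappa>1" "0 < \<kappa>2"
    and hypocoercive: "\<And>h s. h \<in> L2 \<mu> \<Longrightarrow> 0 \<le> s \<Longrightarrow>
          L2norm \<mu> (\<lambda>v. T s h v - L2_inner \<mu> h (\<lambda>_. 1))
            \<le> \<kappa>1 * exp (- \<kappa>2 * s) * L2norm \<mu> (\<lambda>v. h v - L2_inner \<mu> h (\<lambda>_. 1))"
    and hunt: "hunt_process Q \<AA> F \<eta> P"
    and assoc: "properly_associated Q \<mu> T \<eta> P"
    and f: "f \<in> L2 \<mu>"
    and t: "0 < t"
  shows "(AE \<omega> in initial_law \<AA> \<mu> P. set_integrable lborel {0..<t} (\<lambda>s. f (\<eta> s \<omega>))) \<and>
         (\<lambda>\<omega>. 1 / t * (LINT s:{0..<t}|lborel. f (\<eta> s \<omega>)) - (\<integral>v. f v \<partial>\<mu>)) \<in> L2 (initial_law \<AA> \<mu> P) \<and>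
         L2norm (initial_law \<AA> \<mu> P)
             (\<lambda>\<omega>. 1 / t * (LINT s:{0..<t}|lborel. f (\<eta> s \<omega>)) - (\<integral>v. f v \<partial>\<mu>))
           \<le> 2 / sqrt t * sqrt (2 * \<kappa>1 / \<kappa>2 * (1 - exp (- t * \<kappa>2)))
              * L2norm \<mu> (\<lambda>v. f v - (\<integral>v. f v \<partial>\<mu>))"
proof -
  have atlas: "smooth_atlas A" and g: "riemannian_metric A g"
    using manifold unfolding complete_connected_riemannian_manifold_def by auto
  note top = topspace_TM[OF atlas]
  have "prob_space \<mu> \<and> sets \<mu> = sets (borel_sets_of Q) \<and> countably_regular Q"
    using setting
  proof (elim disjE exE)
    fix \<alpha> \<beta> \<Psi> assume "langevin_setting A g lam \<alpha> \<beta> \<Psi> Q \<mu> D L"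
    then have \<beta>: "0 < \<beta>" and base: "prob_space (weighted_volume lam (\<lambda>x. \<beta> * \<Psi> x))"
      and Q: "Q = TM_topology A"
      and dis: "disintegrates Q (weighted_volume lam (\<lambda>x. \<beta> * \<Psi> x)) (fibre_gaussian g \<beta>) \<mu>"
      unfolding langevin_setting_def Let_def potential_conditions_def P1_def by blast+
    have "prob_space \<mu>"
      by (rule prob_space_disintegrates[OF dis base])
        (simp add: Q top fibre_gaussian_total[OF g \<beta>])
    moreover have "sets \<mu> = sets (borel_sets_of Q)" using dis by (simp add: disintegrates_def)
    ultimately show ?thesis using countably_regular_TM[OF atlas] Q by simp
  next
    fix \<sigma> \<Psi> assume "fibre_lay_down_setting A g lam \<sigma> \<Psi> Q \<mu> D L"
    then have base: "prob_space (weighted_volume lam \<Psi>)" and Q: "Q = SM_topology A g"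
      and dis: "disintegrates Q (weighted_volume lam \<Psi>) (fibre_sphere_measure g) \<mu>"
      unfolding fibre_lay_down_setting_def potential_conditions_def P1_def by blast+
    have "prob_space \<mu>"
      by (rule prob_space_disintegrates[OF dis base])
        (simp add: Q SM_topology_def SM_def top fibre_sphere_measure_total[OF g])
    moreover have "sets \<mu> = sets (borel_sets_of Q)" using dis by (simp add: disintegrates_def)
    ultimately show ?thesis
      using countably_regular_subtopology[OF countably_regular_TM[OF atlas]] Q by (simp add: SM_topology_def)
  qed
  then show ?thesis
    using hunt_time_average_estimate[OF _ _ _ semigroup kappa hypocoercive hunt assoc f t] by blast
qed

end
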